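(* For every integer $t\ge 1$ let $\Gamma_t = P_t \square P_t$ be the square $t \times t$ grid. Then for every sufficiently large integer $t$, \[ \mathrm{TR}(\Gamma_t) > \mathrm{R}(\Gamma_t). \] Consequently, there are infinitely many (pairwise non-isomorphic) connected planar bipartite graphs $G$ of maximum degree four such that $\mathrm{TR}(G) > \mathrm{R}(G)$.
   Context: Graphs are finite, simple, and have at least one vertex. $P_t$ denotes the path on $t$ vertices, and $\square$ denotes the Cartesian product of graphs. For a graph $G$, $e(G)$ denotes its number of edges. For a graph $G$ without isolated vertices, $\mathrm{R}(G)$ denotes the diagonal Ramsey number: the least integer $n$ such that every red--blue colouring of the edges of the complete graph $K_n$ contains a monochromatic copy of $G$ (as a not necessarily induced subgraph). Let $G$ be a graph without isolated vertices and $m = e(G)$. In a red--blue edge-coloured complete graph, a Ramsey chain with target graph $G$ is a sequence $G_1, G_2, \ldots, G_m$ of pairwise edge-disjoint monochromatic subgraphs (each $G_i$ is monochromatic, but different $G_i$ may have different colours) such that $e(G_i) = i$ for all $i$, $G_i$ is isomorphic to a subgraph of $G_{i+1}$ for $1 \leq i < m$, and $G_m \cong G$. The target Ramsey number $\mathrm{TR}(G)$ is the least integer $n$ such that every red--blue colouring of the edges of $K_n$ contains a Ramsey chain with target $G$. It is known (Chartrand and Zhang) that $\mathrm{TR}(G)$ exists for every graph $G$ without isolated vertices. *)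

theory Defs
  imports "HOL-Analysis.Analysis" "HOL-Library.Ramsey"
begin

section \<open>Finite simple graphs\<close>

datatype 'a graph = Graph (verts: "'a set") (edges: "'a set set")

definition simple_graph :: "'a graph \<Rightarrow> bool" where
  "simple_graph G \<longleftrightarrow>
     finite (verts G) \<and> verts G \<noteq> {} \<and> edges G \<subseteq> [verts G]\<^bsup>2\<^esup>"

definition subgraph :: "'a graph \<Rightarrow> 'a graph \<Rightarrow> bool" where
  "subgraph H G \<longleftrightarrow> simple_graph H \<and> verts H \<subseteq> verts G \<and> edges H \<subseteq> edges G"

definition graph_iso :: "'a graph \<Rightarrow> 'b graph \<Rightarrow> bool" where
  "graph_iso G H \<longleftrightarrow>
     (\<exists>f. bij_betw f (verts G) (verts H) \<and>
          (\<forall>u\<in>verts G. \<forall>v\<in>verts G. {u, v} \<in> edges G \<longleftrightarrow> {f u, f v} \<in> edges H))"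

definition complete_graph :: "nat \<Rightarrow> nat graph" where
  "complete_graph n = Graph {..<n} ([{..<n}]\<^bsup>2\<^esup>)"

definition path_graph :: "nat \<Rightarrow> nat graph" where
  "path_graph t = Graph {..<t} {{i, Suc i} | i. Suc i < t}"

definition cartesian_product :: "'a graph \<Rightarrow> 'b graph \<Rightarrow> ('a \<times> 'b) graph" where
  "cartesian_product G H = Graph (verts G \<times> verts H)
     ({{(u, v), (u, v')} | u v v'. u \<in> verts G \<and> {v, v'} \<in> edges H} \<union>
      {{(u, v), (u', v)} | u u' v. {u, u'} \<in> edges G \<and> v \<in> verts H})"

definition grid_graph :: "nat \<Rightarrow> (nat \<times> nat) graph" where
  "grid_graph t = cartesian_product (path_graph t) (path_graph t)"

definition degree :: "'a graph \<Rightarrow> 'a \<Rightarrow> nat" where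
  "degree G v = card {e \<in> edges G. v \<in> e}"

definition max_degree :: "'a graph \<Rightarrow> nat" where
  "max_degree G = Max (degree G ` verts G)"

definition connected_graph :: "'a graph \<Rightarrow> bool" where
  "connected_graph G \<longleftrightarrow>
     (\<forall>u\<in>verts G. \<forall>v\<in>verts G. (\<lambda>x y. {x, y} \<in> edges G)\<^sup>*\<^sup>* u v)"

definition bipartite_graph :: "'a graph \<Rightarrow> bool" where
  "bipartite_graph G \<longleftrightarrow>
     (\<exists>A B. A \<union> B = verts G \<and> A \<inter> B = {} \<and>
            (\<forall>e\<in>edges G. \<exists>a\<in>A. \<exists>b\<in>B. e = {a, b}))"

text \<open>A drawing in the plane sends vertices to distinct points and every edge to an arc
  between its two end points, such that the relative interior of an edge contains no vertex
  and no point of any other edge.\<close>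

definition plane_drawing ::
  "'a graph \<Rightarrow> ('a \<Rightarrow> complex) \<Rightarrow> ('a set \<Rightarrow> real \<Rightarrow> complex) \<Rightarrow> bool" where
  "plane_drawing G p \<gamma> \<longleftrightarrow>
     inj_on p (verts G) \<and>
     (\<forall>e\<in>edges G.
        arc (\<gamma> e) \<and> {pathstart (\<gamma> e), pathfinish (\<gamma> e)} = p ` e \<and>
        (path_image (\<gamma> e) - p ` e) \<inter> p ` verts G = {} \<and>
        (\<forall>e'\<in>edges G. e' \<noteq> e \<longrightarrow> (path_image (\<gamma> e) - p ` e) \<inter> path_image (\<gamma> e') = {}))"

definition planar_graph :: "'a graph \<Rightarrow> bool" where
  "planar_graph G \<longleftrightarrow> (\<exists>p \<gamma>. plane_drawing G p \<gamma>)"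

section \<open>Ramsey numbers and target Ramsey numbers\<close>

datatype colour = Red | Blue

text \<open>A colouring of the edges of a complete graph is a total function on vertex sets;
  its values outside the edge set are irrelevant.\<close>

definition mono_coloured :: "(nat set \<Rightarrow> colour) \<Rightarrow> nat graph \<Rightarrow> bool" where
  "mono_coloured c H \<longleftrightarrow> (\<exists>k. \<forall>e\<in>edges H. c e = k)"

text \<open>Both numbers below are meant for simple graphs without isolated vertices. For these
  the minimum is over a nonempty set; otherwise \<open>LEAST\<close> may be unspecified.\<close>

definition ramsey_number :: "'a graph \<Rightarrow> nat" where
  "ramsey_number G = (LEAST n. \<forall>c. \<exists>H. subgraph H (complete_graph n) \<and>
                                          mono_coloured c H \<and> graph_iso H G)"

definition ramsey_chain ::
  "nat \<Rightarrow> (nat set \<Rightarrow> colour) \<Rightarrow> 'a graph \<Rightarrow> (nat \<Rightarrow> nat graph) \<Rightarrow> bool" where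
  "ramsey_chain n c G H \<longleftrightarrow>
     (let m = card (edges G) in
       (\<forall>i\<in>{1..m}. subgraph (H i) (complete_graph n) \<and> mono_coloured c (H i) \<and>
                   card (edges (H i)) = i) \<and>
       (\<forall>i\<in>{1..m}. \<forall>j\<in>{1..m}. i \<noteq> j \<longrightarrow> edges (H i) \<inter> edges (H j) = {}) \<and>
       (\<forall>i\<in>{1..<m}. \<exists>F. subgraph F (H (Suc i)) \<and> graph_iso (H i) F) \<and>
       graph_iso (H m) G)"

definition target_ramsey_number :: "'a graph \<Rightarrow> nat" where
  "target_ramsey_number G = (LEAST n. \<forall>c. \<exists>H. ramsey_chain n c G H)"

end

theory Submission
  imports Defs
begin

text \<open>Let \<open>m = 2 t (t - 1)\<close> be the number of edges of the grid. A Ramsey chain in \<open>K\<^sub>n\<close> consists of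
  \<open>1 + \<dots> + m\<close> distinct edges, which forces \<open>n > m\<close>. Hence it suffices that every colouring of \<open>K\<^sub>m\<close>
  contains a monochromatic grid. As \<open>m\<close> is almost \<open>2 t\<^sup>2\<close>, this follows by the connected matching
  method: apply the regularity lemma, find in one colour of the reduced graph a connected matching covering
  about \<open>54\<close> percent of the vertices, and let the antidiagonals of the grid walk through the reduced graph such that
  every matching edge absorbs its share of the grid. Since the antidiagonals have only \<open>O(t)\<close> vertices
  while the clusters have order \<open>t\<^sup>2\<close>, a greedy embedding along this walk succeeds and no blow-up lemma
  is needed.\<close>

section \<open>Regularity\<close>

text \<open>What makes crude tools sufficient is a constant margin. The grid has t^2 vertices and
  \<open>2 * t * (t - 1)\<close> is almost twice that, so a connected matching has to cover some
  fixed proportion above one half. The value 27/50 leaves room to plan only 24/25 of every cluster,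
  as 24/25 * 27/50 = 324/625 > 1/2. The remaining 1/25 is shared equally by the detours of the walk
  and by a reserve that keeps the greedy choice alive. Grid edges join only consecutive
  antidiagonals, so assigning antidiagonals to clusters amounts to a walk in the reduced graph, and
  any connected part of it, bipartite or not, can host this walk. Clusters may have different sizes:
  the matching is found on the vertices themselves, with adjacency inherited from their clusters.
  The number of matching edges between two clusters then acts as a weight in a fractional matching
  of the reduced graph, and no equipartition is required.\<close>

definition block_avg :: "'a set \<Rightarrow> ('a \<Rightarrow> 'b) \<Rightarrow> ('a \<Rightarrow> real) \<Rightarrow> 'a \<Rightarrow> real" where
  "block_avg Z l g z = (\<Sum>w\<in>{w\<in>Z. l w = l z}. g w) / card {w\<in>Z. l w = l z}"

lemma block_avg_cong: "l z = l w \<Longrightarrow> block_avg Z l g z = block_avg Z l g w"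
  by (simp add: block_avg_def)

text \<open>\<open>block_avg\<close> is the conditional expectation of \<open>g\<close> on the
  partition of \<open>Z\<close> into the fibres of \<open>l\<close>. It preserves the sum over each
  fibre, and a function \<open>h\<close> constant on fibres factors out; in other words, averaging
  is an orthogonal projection.\<close>

lemma sum_block_avg:
  assumes Z: "finite Z"
    and h: "\<And>z w. z \<in> Z \<Longrightarrow> w \<in> Z \<Longrightarrow> l z = l w \<Longrightarrow> h z = h w"
  shows "(\<Sum>z\<in>Z. block_avg Z l g z * h z) = (\<Sum>z\<in>Z. g z * h z)"
proof -
  have "(\<Sum>z\<in>{z\<in>Z. l z = b}. block_avg Z l g z * h z) = (\<Sum>z\<in>{z\<in>Z. l z = b}. g z * h z)"
    if b: "b \<in> l ` Z" for b
  proof -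
    obtain z0 where z0: "z0 \<in> Z" "b = l z0" using b by auto
    let ?B = "{z\<in>Z. l z = b}"
    have fin: "finite ?B" "?B \<noteq> {}" using Z z0 by auto
    then have c: "card ?B \<noteq> 0" by simp
    have 1: "h z = h z0" if "z \<in> ?B" for z using h[of z z0] that z0 by simp
    have 2: "block_avg Z l g z = (\<Sum>w\<in>?B. g w) / card ?B" if "z \<in> ?B" for z
      using that by (simp add: block_avg_def)
    have "(\<Sum>z\<in>?B. block_avg Z l g z * h z) = (\<Sum>z\<in>?B. (\<Sum>w\<in>?B. g w) / card ?B * h z0)"
      using 1 2 by (intro sum.cong) auto
    also have "\<dots> = (\<Sum>w\<in>?B. g w) * h z0" using c by simp
    also have "\<dots> = (\<Sum>z\<in>?B. g z * h z)"
      unfolding sum_distrib_right using 1 by (intro sum.cong) auto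
    finally show ?thesis .
  qed
  then show ?thesis
    unfolding sum.image_gen[OF Z, of "\<lambda>z. block_avg Z l g z * h z" l]
      sum.image_gen[OF Z, of "\<lambda>z. g z * h z" l] by (rule sum.cong[OF refl])
qed

text \<open>The coarser average is constant on the fibres of both labels. Testing it against the
  finer average, against \<open>g\<close> or against itself therefore gives the same value, so the
  mixed term of the square equals the energy of the coarser average.\<close>

lemma block_avg_pythagoras:
  assumes Z: "finite Z"
    and ref: "\<And>z w. z \<in> Z \<Longrightarrow> w \<in> Z \<Longrightarrow> l' z = l' w \<Longrightarrow> l z = l w"
  shows "(\<Sum>z\<in>Z. (block_avg Z l' g z - block_avg Z l g z)\<^sup>2) =
         (\<Sum>z\<in>Z. (block_avg Z l' g z)\<^sup>2) - (\<Sum>z\<in>Z. (block_avg Z l g z)\<^sup>2)"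
proof -
  have "(\<Sum>z\<in>Z. block_avg Z l' g z * block_avg Z l g z) = (\<Sum>z\<in>Z. g z * block_avg Z l g z)"
    by (intro sum_block_avg Z block_avg_cong ref) auto
  also have "\<dots> = (\<Sum>z\<in>Z. block_avg Z l g z * block_avg Z l g z)"
    by (intro sum_block_avg[symmetric] Z block_avg_cong)
  finally have *: "(\<Sum>z\<in>Z. block_avg Z l' g z * block_avg Z l g z) = (\<Sum>z\<in>Z. (block_avg Z l g z)\<^sup>2)"
    by (simp add: power2_eq_square)
  have "(\<Sum>z\<in>Z. (block_avg Z l' g z - block_avg Z l g z)\<^sup>2) =
      (\<Sum>z\<in>Z. (block_avg Z l' g z)\<^sup>2 + (block_avg Z l g z)\<^sup>2 - 2 * (block_avg Z l' g z * block_avg Z l g z))"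
    by (intro sum.cong) (auto simp: power2_diff)
  then show ?thesis
    by (simp add: sum_subtractf sum.distrib sum_distrib_left[symmetric] *)
qed

section \<open>Densities, atoms and the energy of a partition\<close>

definition edge_density :: "('a \<times> 'b \<Rightarrow> real) \<Rightarrow> 'a set \<Rightarrow> 'b set \<Rightarrow> real" where
  "edge_density g A B = (\<Sum>z\<in>A \<times> B. g z) / (card A * card B)"

text \<open>Formulated through its witnesses, since these are the sets that are added in order to
  refine the partition.\<close>

definition irregular :: "('a \<times> 'b \<Rightarrow> real) \<Rightarrow> real \<Rightarrow> 'a set \<Rightarrow> 'b set \<Rightarrow> bool" where
  "irregular g \<epsilon> A B \<longleftrightarrow> (\<exists>A'\<subseteq>A. \<exists>B'\<subseteq>B. \<epsilon> * card A \<le> card A' \<and> \<epsilon> * card B \<le> card B' \<and>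
     \<epsilon> \<le> \<bar>edge_density g A' B' - edge_density g A B\<bar>)"

text \<open>A partition of \<open>V\<close> is represented by a finite family \<open>\<F>\<close> of sets: its parts are the atoms of
  \<open>\<F>\<close>. Refining a partition then just means enlarging \<open>\<F>\<close>, and a family of size \<open>a\<close> has at most
  \<open>2 ^ a\<close> atoms.\<close>

definition cell_code :: "'a set set \<Rightarrow> 'a \<Rightarrow> 'a set set" where
  "cell_code \<F> x = {F \<in> \<F>. x \<in> F}"

definition atom :: "'a set \<Rightarrow> 'a set set \<Rightarrow> 'a \<Rightarrow> 'a set" where
  "atom V \<F> x = {y \<in> V. cell_code \<F> y = cell_code \<F> x}"

text \<open>Summing over ordered pairs of vertices instead of pairs of parts weights each pair of
  atoms by its size, so atoms of unequal size need no special treatment.\<close>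

definition energy :: "('a \<times> 'a \<Rightarrow> real) \<Rightarrow> 'a set \<Rightarrow> 'a set set \<Rightarrow> real" where
  "energy g V \<F> = (\<Sum>(x, y)\<in>V \<times> V. (edge_density g (atom V \<F> x) (atom V \<F> y))\<^sup>2)"

text \<open>Again counted in vertices: an irregular pair of atoms contributes the product of their
  sizes.\<close>

definition irregular_pairs :: "('a \<times> 'a \<Rightarrow> real) \<Rightarrow> real \<Rightarrow> 'a set \<Rightarrow> 'a set set \<Rightarrow> ('a \<times> 'a) set" where
  "irregular_pairs g \<epsilon> V \<F> = {(x, y) \<in> V \<times> V. irregular g \<epsilon> (atom V \<F> x) (atom V \<F> y)}"

lemma atom_subset: "atom V \<F> x \<subseteq> V" by (auto simp: atom_def)

lemma atom_self: "x \<in> V \<Longrightarrow> x \<in> atom V \<F> x" by (auto simp: atom_def)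

lemma atom_eq: "y \<in> atom V \<F> x \<Longrightarrow> atom V \<F> y = atom V \<F> x" by (auto simp: atom_def)

lemma atom_mem_iff: "y \<in> atom V \<F> x \<longleftrightarrow> y \<in> V \<and> atom V \<F> y = atom V \<F> x"
  using atom_self[of y V \<F>] atom_eq[of y V \<F> x] atom_subset[of V \<F> x] by auto

lemma card_atoms:
  assumes "finite \<F>"
  shows "finite (atom V \<F> ` V)" "card (atom V \<F> ` V) \<le> 2 ^ card \<F>"
proof -
  have sub: "atom V \<F> ` V \<subseteq> (\<lambda>T. {y \<in> V. cell_code \<F> y = T}) ` Pow \<F>"
    by (auto simp: atom_def cell_code_def image_iff)
  have fin: "finite (Pow \<F>)" using assms by simp
  show "finite (atom V \<F> ` V)" using finite_subset[OF sub] fin by simp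
  have "card (atom V \<F> ` V) \<le> card (Pow \<F>)"
    using surj_card_le[OF fin sub] .
  then show "card (atom V \<F> ` V) \<le> 2 ^ card \<F>" using assms by (simp add: card_Pow)
qed

text \<open>The blocks of a product partition are rectangles, and the average over a rectangle is a
  density. This turns \<open>energy\<close> into the squared norm of a projection, to which the
  Pythagorean identity applies.\<close>

lemma block_avg_cell_code:
  "block_avg (V \<times> V) (map_prod (cell_code \<F>) (cell_code \<F>)) g (x, y) = edge_density g (atom V \<F> x) (atom V \<F> y)"
proof -
  have "{w \<in> V \<times> V. map_prod (cell_code \<F>) (cell_code \<F>) w = map_prod (cell_code \<F>) (cell_code \<F>) (x, y)}
      = atom V \<F> x \<times> atom V \<F> y"
    by (auto simp: atom_def)
  then show ?thesis by (simp add: block_avg_def edge_density_def card_cartesian_product)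
qed

lemma energy_eq:
  "energy g V \<F> = (\<Sum>z\<in>V \<times> V. (block_avg (V \<times> V) (map_prod (cell_code \<F>) (cell_code \<F>)) g z)\<^sup>2)"
  unfolding energy_def by (intro sum.cong) (auto simp: block_avg_cell_code)

lemma edge_density_bounds:
  assumes "\<And>z. 0 \<le> g z" "\<And>z. g z \<le> 1" "finite A" "finite B"
  shows "0 \<le> edge_density g A B" "edge_density g A B \<le> 1"
proof -
  have "(\<Sum>z\<in>A \<times> B. g z) \<le> (\<Sum>z\<in>A \<times> B. 1)" by (intro sum_mono assms)
  then have "(\<Sum>z\<in>A \<times> B. g z) \<le> card A * card B" by (simp add: card_cartesian_product)
  then show "edge_density g A B \<le> 1" unfolding edge_density_def
    by (auto simp: divide_le_eq_1)
  show "0 \<le> edge_density g A B" unfolding edge_density_def using assms by (intro divide_nonneg_nonneg sum_nonneg) auto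
qed

lemma energy_le:
  assumes "\<And>z. 0 \<le> g z" "\<And>z. g z \<le> 1" "finite V"
  shows "energy g V \<F> \<le> (card V)\<^sup>2"
proof -
  have "finite (atom V \<F> x)" for x using assms(3) by (simp add: atom_def)
  then have "energy g V \<F> \<le> (\<Sum>(x, y)\<in>V \<times> V. 1)" unfolding energy_def
    by (intro sum_mono) (auto intro!: power_le_one edge_density_bounds assms)
  then show ?thesis by (simp add: card_cartesian_product power2_eq_square split_def)
qed

lemma cell_code_mono: "\<F> \<subseteq> \<G> \<Longrightarrow> cell_code \<G> x = cell_code \<G> y \<Longrightarrow> cell_code \<F> x = cell_code \<F> y"
  by (auto simp: cell_code_def set_eq_iff)

lemma energy_diff:
  assumes "finite V" "\<F> \<subseteq> \<G>"
  shows "energy g V \<G> - energy g V \<F> =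
    (\<Sum>(x, y)\<in>V \<times> V. (edge_density g (atom V \<G> x) (atom V \<G> y) - edge_density g (atom V \<F> x) (atom V \<F> y))\<^sup>2)"
proof -
  have "(\<Sum>(x, y)\<in>V \<times> V. (edge_density g (atom V \<G> x) (atom V \<G> y) - edge_density g (atom V \<F> x) (atom V \<F> y))\<^sup>2)
   = (\<Sum>z\<in>V \<times> V. (block_avg (V \<times> V) (map_prod (cell_code \<G>) (cell_code \<G>)) g z
        - block_avg (V \<times> V) (map_prod (cell_code \<F>) (cell_code \<F>)) g z)\<^sup>2)"
    by (intro sum.cong) (auto simp: block_avg_cell_code)
  also have "\<dots> = energy g V \<G> - energy g V \<F>"
    unfolding energy_eq
  proof (rule block_avg_pythagoras)
    show "map_prod (cell_code \<F>) (cell_code \<F>) z = map_prod (cell_code \<F>) (cell_code \<F>) w"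
      if "map_prod (cell_code \<G>) (cell_code \<G>) z = map_prod (cell_code \<G>) (cell_code \<G>) w" for z w
      using that cell_code_mono[OF assms(2), of "fst z" "fst w"] cell_code_mono[OF assms(2), of "snd z" "snd w"]
      by (cases z; cases w) simp
  qed (use assms(1) in simp)
  finally show ?thesis by simp
qed

lemma sum_sq_ge_card:
  fixes f :: "'a \<Rightarrow> real"
  assumes "finite S"
  shows "(\<Sum>z\<in>S. f z)\<^sup>2 \<le> card S * (\<Sum>z\<in>S. (f z)\<^sup>2)"
  using Cauchy_Schwarz_ineq_sum[of "\<lambda>_. 1" f S] by simp

text \<open>Once \<open>A\<close> and \<open>B\<close> belong to the family,
  \<open>A \<times> B\<close> is a union of refined blocks inside one old block. The mean of the
  refined densities on it is \<open>edge_density g A B\<close>, which differs from the old density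
  by at least \<epsilon>. Cauchy-Schwarz turns this into a gain of \<epsilon>^2 times the size of
  \<open>A \<times> B\<close>, which is at least \<epsilon>^4 times the size of the old
  block.\<close>

lemma witness_gain:
  fixes \<epsilon> :: real
  assumes V: "finite V" and FG: "\<F> \<subseteq> \<G>" and \<epsilon>: "\<epsilon> > 0"
    and x: "x \<in> V" and y: "y \<in> V"
    and A: "A \<subseteq> atom V \<F> x" "A \<in> \<G>" "\<epsilon> * card (atom V \<F> x) \<le> card A"
    and B: "B \<subseteq> atom V \<F> y" "B \<in> \<G>" "\<epsilon> * card (atom V \<F> y) \<le> card B"
    and d: "\<epsilon> \<le> \<bar>edge_density g A B - edge_density g (atom V \<F> x) (atom V \<F> y)\<bar>"
  shows "\<epsilon> ^ 4 * card (atom V \<F> x \<times> atom V \<F> y) \<le>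
    (\<Sum>(x, y)\<in>atom V \<F> x \<times> atom V \<F> y.
      (edge_density g (atom V \<G> x) (atom V \<G> y) - edge_density g (atom V \<F> x) (atom V \<F> y))\<^sup>2)"
proof -
  let ?E = "\<lambda>(u, v). edge_density g (atom V \<G> u) (atom V \<G> v)"
  let ?D = "\<lambda>(u, v). edge_density g (atom V \<G> u) (atom V \<G> v) - edge_density g (atom V \<F> u) (atom V \<F> v)"
  let ?X = "atom V \<F> x" and ?Y = "atom V \<F> y"
  define d0 where "d0 = edge_density g ?X ?Y"
  have fin: "finite ?X" "finite ?Y" using V by (auto simp: atom_def)
  have AV: "A \<subseteq> V" "B \<subseteq> V" using A(1) B(1) atom_subset[of V \<F>] by (meson subset_trans)+
  have finAB: "finite A" "finite B" using AV V finite_subset by auto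
  have cX: "card ?X > 0" "card ?Y > 0" using fin atom_self[OF x] atom_self[OF y] card_gt_0_iff by blast+
  have cA: "card A > 0" "card B > 0"
  proof -
    have "0 < \<epsilon> * card ?X" "0 < \<epsilon> * card ?Y" using \<epsilon> cX by simp_all
    then have "0 < real (card A)" "0 < real (card B)" using A(3) B(3) by linarith+
    then show "card A > 0" "card B > 0" by simp_all
  qed
  have ind: "(\<Sum>z\<in>V \<times> V. h z * indicator (A \<times> B) z) = (\<Sum>z\<in>A \<times> B. h z)" for h :: "'a \<times> 'a \<Rightarrow> real"
  proof -
    have "(\<Sum>z\<in>V \<times> V. h z * indicator (A \<times> B) z) = (\<Sum>z\<in>A \<times> B. h z * indicator (A \<times> B) z)"
      using AV V by (intro sum.mono_neutral_right) (auto simp: indicator_def)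
    then show ?thesis by (simp add: indicator_def)
  qed
  have "(\<Sum>z\<in>A \<times> B. ?E z) = (\<Sum>z\<in>A \<times> B. block_avg (V \<times> V) (map_prod (cell_code \<G>) (cell_code \<G>)) g z)"
    by (intro sum.cong) (auto simp: block_avg_cell_code)
  \<comment> \<open>The indicator of \<open>A \<times> B\<close> is constant on the refined blocks
    because \<open>A\<close> and \<open>B\<close> are in \<open>\<G>\<close>, so averaging does not
    change this sum.\<close>
  also have "\<dots> = (\<Sum>z\<in>V \<times> V. g z * indicator (A \<times> B) z)"
    unfolding ind[symmetric]
  proof (rule sum_block_avg)
    have same: "u \<in> F \<longleftrightarrow> v \<in> F" if "cell_code \<G> u = cell_code \<G> v" "F \<in> \<G>" for u v F
      using that by (auto simp: cell_code_def set_eq_iff)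
    show "indicator (A \<times> B) z = (indicator (A \<times> B) w :: real)"
      if "map_prod (cell_code \<G>) (cell_code \<G>) z = map_prod (cell_code \<G>) (cell_code \<G>) w" for z w
    proof -
      have "cell_code \<G> (fst z) = cell_code \<G> (fst w)" "cell_code \<G> (snd z) = cell_code \<G> (snd w)"
        using that by (cases z; cases w; simp)+
      then have "fst z \<in> A \<longleftrightarrow> fst w \<in> A" "snd z \<in> B \<longleftrightarrow> snd w \<in> B" using same A(2) B(2) by blast+
      then show ?thesis by (simp add: indicator_def mem_Times_iff)
    qed
  qed (use V in auto)
  also have "\<dots> = edge_density g A B * (card A * card B)"
    unfolding ind using cA by (simp add: edge_density_def)
  finally have E: "(\<Sum>z\<in>A \<times> B. ?E z) = edge_density g A B * (card A * card B)" .
  have dF: "edge_density g (atom V \<F> u) (atom V \<F> v) = d0" if "(u, v) \<in> ?X \<times> ?Y" for u v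
    using that atom_eq[of u V \<F> x] atom_eq[of v V \<F> y] by (simp add: d0_def)
  have "(\<Sum>z\<in>A \<times> B. ?D z) = (\<Sum>z\<in>A \<times> B. ?E z - d0)"
    using dF A B by (intro sum.cong) auto
  also have "\<dots> = (edge_density g A B - d0) * (card A * card B)"
    by (simp add: sum_subtractf E card_cartesian_product algebra_simps)
  finally have S: "(\<Sum>z\<in>A \<times> B. ?D z) = (edge_density g A B - d0) * (card A * card B)" .
  have "(card A * card B) * ((edge_density g A B - d0)\<^sup>2 * (card A * card B)) = (\<Sum>z\<in>A \<times> B. ?D z)\<^sup>2"
    unfolding S by (simp add: power2_eq_square)
  also have "\<dots> \<le> card (A \<times> B) * (\<Sum>z\<in>A \<times> B. (?D z)\<^sup>2)"
    by (rule sum_sq_ge_card) (use finAB in auto)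
  finally have 1: "(edge_density g A B - d0)\<^sup>2 * (card A * card B) \<le> (\<Sum>z\<in>A \<times> B. (?D z)\<^sup>2)"
    using cA by (simp add: card_cartesian_product)
  have 2: "\<epsilon>\<^sup>2 \<le> (edge_density g A B - d0)\<^sup>2"
    using d \<epsilon> unfolding d0_def by (metis abs_le_square_iff abs_of_pos)
  have 3: "(\<epsilon> * card ?X) * (\<epsilon> * card ?Y) \<le> card A * card B"
    using mult_mono[OF A(3) B(3)] \<epsilon> by simp
  have "\<epsilon> ^ 4 * card (?X \<times> ?Y) = \<epsilon>\<^sup>2 * ((\<epsilon> * card ?X) * (\<epsilon> * card ?Y))"
    by (simp add: card_cartesian_product power2_eq_square power4_eq_xxxx)
  also have "\<dots> \<le> (edge_density g A B - d0)\<^sup>2 * (card A * card B)"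
    by (rule mult_mono[OF 2 3]) (use \<epsilon> in auto)
  also note 1
  also have "(\<Sum>z\<in>A \<times> B. (?D z)\<^sup>2) \<le> (\<Sum>z\<in>?X \<times> ?Y. (?D z)\<^sup>2)"
    by (rule sum_mono2) (use fin A B in auto)
  finally show ?thesis by (simp add: split_def)
qed

text \<open>All irregular pairs of atoms receive their witnesses at once. There are at most
  \<open>4 ^ card \<F>\<close> pairs of atoms with two witnesses each, and a gain of \<epsilon>^4
  per vertex pair accumulates over more than \<epsilon> \<open>(card V)\<^sup>2\<close> vertex
  pairs.\<close>

lemma energy_increment:
  fixes \<epsilon> :: real
  assumes V: "finite V" and F: "finite \<F>" and \<epsilon>: "\<epsilon> > 0"
    and irr: "\<epsilon> * (card V)\<^sup>2 < card (irregular_pairs g \<epsilon> V \<F>)"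
  shows "\<exists>\<G>. \<F> \<subseteq> \<G> \<and> finite \<G> \<and> card \<G> \<le> card \<F> + 2 * 4 ^ card \<F> \<and>
    energy g V \<F> + \<epsilon> ^ 5 * (card V)\<^sup>2 \<le> energy g V \<G>"
proof -
  define P where "P = atom V \<F> ` V"
  have P: "finite P" "card P \<le> 2 ^ card \<F>" using card_atoms[OF F] by (simp_all add: P_def)
  define good where "good A B C \<longleftrightarrow> fst C \<subseteq> A \<and> snd C \<subseteq> B \<and>
     \<epsilon> * card A \<le> card (fst C) \<and> \<epsilon> * card B \<le> card (snd C) \<and>
     \<epsilon> \<le> \<bar>edge_density g (fst C) (snd C) - edge_density g A B\<bar>" for A B C
  \<comment> \<open>For a regular pair of atoms the choice is arbitrary; adding such sets as well is
    harmless, since further sets only refine the partition.\<close>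
  define wA wB where "wA A B = fst (SOME C. good A B C)" and "wB A B = snd (SOME C. good A B C)" for A B
  have w: "wA A B \<subseteq> A" "wB A B \<subseteq> B" "\<epsilon> * card A \<le> card (wA A B)" "\<epsilon> * card B \<le> card (wB A B)"
     "\<epsilon> \<le> \<bar>edge_density g (wA A B) (wB A B) - edge_density g A B\<bar>" if irr: "irregular g \<epsilon> A B" for A B
  proof -
    obtain A' B' where "good A B (A', B')" using irr unfolding irregular_def good_def by auto
    then have "good A B (SOME C. good A B C)" by (rule someI)
    then show "wA A B \<subseteq> A" "wB A B \<subseteq> B" "\<epsilon> * card A \<le> card (wA A B)" "\<epsilon> * card B \<le> card (wB A B)"
     "\<epsilon> \<le> \<bar>edge_density g (wA A B) (wB A B) - edge_density g A B\<bar>"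
      unfolding good_def wA_def wB_def by blast+
  qed
  define \<G> where "\<G> = \<F> \<union> case_prod wA ` (P \<times> P) \<union> case_prod wB ` (P \<times> P)"
  have FG: "\<F> \<subseteq> \<G>" and finG: "finite \<G>" using F P by (auto simp: \<G>_def)
  have PP: "card (f ` (P \<times> P)) \<le> 4 ^ card \<F>" for f :: "'a set \<times> 'a set \<Rightarrow> 'a set"
  proof -
    have "card (f ` (P \<times> P)) \<le> card P * card P" using card_image_le[of "P \<times> P" f] P by (simp add: card_cartesian_product)
    also have "\<dots> \<le> 2 ^ card \<F> * 2 ^ card \<F>" using P by (intro mult_mono) auto
    also have "\<dots> = 4 ^ card \<F>" by (simp flip: power_mult_distrib)
    finally show ?thesis .
  qed
  have "card \<G> \<le> card \<F> + card (case_prod wA ` (P \<times> P)) + card (case_prod wB ` (P \<times> P))"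
    unfolding \<G>_def using card_Un_le[of "\<F> \<union> case_prod wA ` (P \<times> P)" "case_prod wB ` (P \<times> P)"]
      card_Un_le[of \<F> "case_prod wA ` (P \<times> P)"] by linarith
  also have "\<dots> \<le> card \<F> + 2 * 4 ^ card \<F>" using PP[of "case_prod wA"] PP[of "case_prod wB"] by linarith
  finally have cG: "card \<G> \<le> card \<F> + 2 * 4 ^ card \<F>" .
  let ?D = "\<lambda>(u, v). (edge_density g (atom V \<G> u) (atom V \<G> v) - edge_density g (atom V \<F> u) (atom V \<F> v))\<^sup>2"
  let ?I = "irregular_pairs g \<epsilon> V \<F>"
  let ?l = "map_prod (atom V \<F>) (atom V \<F>)"
  have finI: "finite ?I" using V by (auto simp: irregular_pairs_def intro: finite_subset[of _ "V \<times> V"])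
  have block: "{z \<in> ?I. ?l z = b} = fst b \<times> snd b"
    and gain: "\<epsilon> ^ 4 * card (fst b \<times> snd b) \<le> (\<Sum>z\<in>fst b \<times> snd b. ?D z)"
    if b': "b \<in> ?l ` ?I" for b
  proof -
    obtain x y where xy: "x \<in> V" "y \<in> V" "irregular g \<epsilon> (atom V \<F> x) (atom V \<F> y)"
      and b: "b = (atom V \<F> x, atom V \<F> y)"
      using b' by (auto simp: irregular_pairs_def)
    \<comment> \<open>Irregularity depends only on the atoms of the two vertices, so the irregular
      vertex pairs fill whole rectangles.\<close>
    show "{z \<in> ?I. ?l z = b} = fst b \<times> snd b"
    proof (rule set_eqI)
      fix z :: "'a \<times> 'a"
      obtain u v where z: "z = (u, v)" by (cases z)
      have "z \<in> {z \<in> ?I. ?l z = b} \<longleftrightarrow> (u \<in> V \<and> atom V \<F> u = atom V \<F> x) \<and> (v \<in> V \<and> atom V \<F> v = atom V \<F> y)"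
        using xy(3) by (auto simp: irregular_pairs_def b z)
      then show "z \<in> {z \<in> ?I. ?l z = b} \<longleftrightarrow> z \<in> fst b \<times> snd b"
        by (simp add: b z atom_mem_iff)
    qed
    show "\<epsilon> ^ 4 * card (fst b \<times> snd b) \<le> (\<Sum>z\<in>fst b \<times> snd b. ?D z)"
      unfolding b fst_conv snd_conv
    proof (rule witness_gain[OF V FG \<epsilon> xy(1,2) w(1)[OF xy(3)] _ w(3)[OF xy(3)] w(2)[OF xy(3)] _ w(4,5)[OF xy(3)]])
      show "wA (atom V \<F> x) (atom V \<F> y) \<in> \<G>" "wB (atom V \<F> x) (atom V \<F> y) \<in> \<G>"
        using xy(1,2) by (auto simp: \<G>_def P_def)
    qed
  qed
  have cV: "(card V)\<^sup>2 = card (V \<times> V)" by (simp add: card_cartesian_product power2_eq_square)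
  have "\<epsilon> ^ 5 * (card V)\<^sup>2 \<le> \<epsilon> ^ 4 * card ?I"
    using irr \<epsilon> mult_left_mono[of "\<epsilon> * (card V)\<^sup>2" "card ?I" "\<epsilon> ^ 4"] by (simp add: eval_nat_numeral mult.assoc)
  also have "\<dots> = (\<Sum>z\<in>?I. \<epsilon> ^ 4)" by simp
  also have "\<dots> = (\<Sum>b\<in>?l ` ?I. \<Sum>z\<in>{z \<in> ?I. ?l z = b}. \<epsilon> ^ 4)" by (rule sum.image_gen[OF finI])
  also have "\<dots> = (\<Sum>b\<in>?l ` ?I. \<epsilon> ^ 4 * card (fst b \<times> snd b))"
    by (intro sum.cong refl) (simp add: block del: fst_map_prod snd_map_prod)
  also have "\<dots> \<le> (\<Sum>b\<in>?l ` ?I. \<Sum>z\<in>fst b \<times> snd b. ?D z)" by (intro sum_mono gain)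
  also have "\<dots> = (\<Sum>b\<in>?l ` ?I. \<Sum>z\<in>{z \<in> ?I. ?l z = b}. ?D z)" 
    by (intro sum.cong refl) (simp add: block)
  also have "\<dots> = (\<Sum>z\<in>?I. ?D z)" by (rule sum.image_gen[OF finI, symmetric])
  also have "\<dots> \<le> (\<Sum>z\<in>V \<times> V. ?D z)" using V by (intro sum_mono2) (auto simp: irregular_pairs_def)
  also have "\<dots> = energy g V \<G> - energy g V \<F>" using energy_diff[OF V FG] by simp
  finally have "energy g V \<F> + \<epsilon> ^ 5 * (card V)\<^sup>2 \<le> energy g V \<G>" by simp
  then show ?thesis using FG finG cG by blast
qed

text \<open>The number \<open>n\<close> bounds how many increments of \<epsilon>^5
  \<open>(card V)\<^sup>2\<close> still fit below the maximal energy, and every failure of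
  regularity uses up one of them. The iterated map follows the growth of the family in
  \<open>energy_increment\<close>.\<close>

lemma regularity_aux:
  fixes \<epsilon> :: real
  assumes g: "\<And>z. 0 \<le> g z" "\<And>z. g z \<le> 1" and V: "finite V" and \<epsilon>: "\<epsilon> > 0"
  shows "finite \<F> \<Longrightarrow> card \<F> \<le> a \<Longrightarrow> (card V)\<^sup>2 \<le> energy g V \<F> + n * \<epsilon> ^ 5 * (card V)\<^sup>2 \<Longrightarrow>
    \<exists>\<G>. \<F> \<subseteq> \<G> \<and> finite \<G> \<and> card \<G> \<le> ((\<lambda>a. a + 2 * 4 ^ a) ^^ n) a \<and>
      card (irregular_pairs g \<epsilon> V \<G>) \<le> \<epsilon> * (card V)\<^sup>2"
proof (induction n arbitrary: \<F> a)
  case 0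
  show ?case
  proof (cases "card (irregular_pairs g \<epsilon> V \<F>) \<le> \<epsilon> * (card V)\<^sup>2")
    case False
    then obtain \<G> where "energy g V \<F> + \<epsilon> ^ 5 * (card V)\<^sup>2 \<le> energy g V \<G>"
      using energy_increment[OF V 0(1) \<epsilon>, of g] by force
    \<comment> \<open>The energy is already maximal, so the gain must vanish; this forces
      \<open>V\<close> to be empty, and then no pair is irregular.\<close>
    then have "\<epsilon> ^ 5 * (card V)\<^sup>2 \<le> 0" using 0 energy_le[of g V \<G>] g V by fastforce
    then have "card V = 0" using \<epsilon> by (simp add: mult_le_0_iff)
    then have "V = {}" using V by simp
    then have False using False by (simp add: irregular_pairs_def)
    then show ?thesis ..
  qed (use 0 in auto)
next
  case (Suc n)
  let ?gr = "\<lambda>a::nat. a + 2 * 4 ^ a"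
  have mono: "a \<le> b \<Longrightarrow> ?gr a \<le> ?gr b" for a b by (intro add_mono mult_left_mono power_increasing) auto
  have mono_n: "a \<le> b \<Longrightarrow> (?gr ^^ k) a \<le> (?gr ^^ k) b" for a b k
    by (induction k) (auto intro: mono)
  show ?case
  proof (cases "card (irregular_pairs g \<epsilon> V \<F>) \<le> \<epsilon> * (card V)\<^sup>2")
    case True
    have "a \<le> (?gr ^^ k) a" for k by (induction k) (auto intro: le_trans)
    then show ?thesis using True Suc.prems le_trans by blast
  next
    case False
    then obtain \<G> where G: "\<F> \<subseteq> \<G>" "finite \<G>" "card \<G> \<le> ?gr (card \<F>)" 
      "energy g V \<F> + \<epsilon> ^ 5 * (card V)\<^sup>2 \<le> energy g V \<G>"
      using energy_increment[OF V Suc.prems(1) \<epsilon>, of g] by force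
    have "card \<G> \<le> ?gr a" using G(3) mono[OF Suc.prems(2)] by linarith
    moreover have "(card V)\<^sup>2 \<le> energy g V \<G> + n * \<epsilon> ^ 5 * (card V)\<^sup>2"
      using G(4) Suc.prems(3) by (simp add: algebra_simps)
    ultimately obtain \<H> where "\<G> \<subseteq> \<H>" "finite \<H>" "card \<H> \<le> (?gr ^^ n) (?gr a)"
      "card (irregular_pairs g \<epsilon> V \<H>) \<le> \<epsilon> * (card V)\<^sup>2"
      using Suc.IH[OF G(2)] by blast
    moreover have "(f ^^ n) (f a) = (f ^^ Suc n) a" for f :: "nat \<Rightarrow> nat" by (simp add: funpow_swap1)
    note this[of ?gr]
    ultimately show ?thesis using G(1) by (metis (no_types, lifting) subset_trans)
  qed
qed

text \<open>\<open>K\<close> depends only on \<open>a\<close> and \<epsilon>. The family to be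
  refined is prescribed, which later serves to force the clusters to be small.\<close>

theorem regularity_lemma:
  fixes \<epsilon> :: real
  assumes "\<epsilon> > 0"
  obtains K where "\<And>V (\<F> :: 'a set set) g. finite V \<Longrightarrow> finite \<F> \<Longrightarrow> card \<F> \<le> a \<Longrightarrow> (\<And>z. 0 \<le> g z) \<Longrightarrow> (\<And>z. g z \<le> 1) \<Longrightarrow>
    \<exists>\<G>. \<F> \<subseteq> \<G> \<and> finite \<G> \<and> card \<G> \<le> K \<and> card (irregular_pairs g \<epsilon> V \<G>) \<le> \<epsilon> * (card V)\<^sup>2"
proof -
  obtain n :: nat where n: "1 \<le> n * \<epsilon> ^ 5"
    using reals_Archimedean3[of "\<epsilon> ^ 5"] assms by (metis less_imp_le zero_less_power)
  show ?thesis
  proof (rule that[of "((\<lambda>a. a + 2 * 4 ^ a) ^^ n) a"])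
    fix V :: "'a set" and \<F> :: "'a set set" and g :: "'a \<times> 'a \<Rightarrow> real"
    assume *: "finite V" "finite \<F>" "card \<F> \<le> a" and g: "\<And>z. 0 \<le> g z" "\<And>z. g z \<le> 1"
    have "0 \<le> energy g V \<F>" unfolding energy_def by (intro sum_nonneg) auto
    then have "(card V)\<^sup>2 \<le> energy g V \<F> + n * \<epsilon> ^ 5 * (card V)\<^sup>2"
      using mult_right_mono[OF n, of "(card V)\<^sup>2"] by simp
    then show "\<exists>\<G>. \<F> \<subseteq> \<G> \<and> finite \<G> \<and> card \<G> \<le> ((\<lambda>a. a + 2 * 4 ^ a) ^^ n) a \<and>
        card (irregular_pairs g \<epsilon> V \<G>) \<le> \<epsilon> * (card V)\<^sup>2"
      by (rule regularity_aux[OF g *(1) assms *(2,3)])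
  qed
qed

section \<open>Large connected monochromatic matchings\<close>

text \<open>Storing each edge as one ordered pair makes its ends available through
  \<open>fst\<close> and \<open>snd\<close>; the covered set becomes a disjoint union of two
  injective images, which is convenient for counting.\<close>

definition matching :: "('a \<Rightarrow> 'a \<Rightarrow> bool) \<Rightarrow> 'a set \<Rightarrow> ('a \<times> 'a) set \<Rightarrow> bool" where
  "matching R V M \<longleftrightarrow> M \<subseteq> V \<times> V \<and> (\<forall>(x, y)\<in>M. R x y) \<and>
     inj_on fst M \<and> inj_on snd M \<and> fst ` M \<inter> snd ` M = {}"

definition cover :: "('a \<times> 'a) set \<Rightarrow> 'a set" where
  "cover M = fst ` M \<union> snd ` M"

definition max_matching :: "('a \<Rightarrow> 'a \<Rightarrow> bool) \<Rightarrow> 'a set \<Rightarrow> ('a \<times> 'a) set \<Rightarrow> bool" where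
  "max_matching R V M \<longleftrightarrow> matching R V M \<and> (\<forall>M'. matching R V M' \<longrightarrow> card M' \<le> card M)"

lemma matching_finite: "matching R V M \<Longrightarrow> finite V \<Longrightarrow> finite M"
  unfolding matching_def using finite_subset[of M "V \<times> V"] by blast

lemma cover_subset: "matching R V M \<Longrightarrow> cover M \<subseteq> V"
  unfolding matching_def cover_def by auto

lemma card_cover: "matching R V M \<Longrightarrow> finite V \<Longrightarrow> card (cover M) = 2 * card M"
  using matching_finite[of R V M] unfolding matching_def cover_def
  by (simp add: card_Un_disjoint card_image)

lemma ex_max_matching:
  assumes "finite V"
  obtains M where "max_matching R V M"
proof -
  let ?S = "card ` {M. matching R V M}"
  have "{M. matching R V M} \<subseteq> Pow (V \<times> V)" by (auto simp: matching_def)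
  then have fin: "finite {M. matching R V M}" using assms finite_subset by blast
  have "{} \<in> {M. matching R V M}" by (auto simp: matching_def)
  then have "Max ?S \<in> ?S" using fin by (intro Max_in) auto
  then obtain M where "matching R V M" "card M = Max ?S" by auto
  moreover have "card M' \<le> Max ?S" if "matching R V M'" for M' using that fin by (intro Max_ge) auto
  ultimately show ?thesis using that[of M] by (simp add: max_matching_def)
qed

lemma matching_insert:
  assumes "matching R V M" "x \<in> V" "y \<in> V" "x \<noteq> y" "R x y" "x \<notin> cover M" "y \<notin> cover M"
  shows "matching R V (insert (x, y) M)" "(x, y) \<notin> M" "cover (insert (x, y) M) = cover M \<union> {x, y}"
proof -
  show "(x, y) \<notin> M" using assms(6) by (force simp: cover_def)
  show "cover (insert (x, y) M) = cover M \<union> {x, y}" by (auto simp: cover_def)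
  show "matching R V (insert (x, y) M)"
    using assms unfolding matching_def cover_def by (auto simp: inj_on_insert)
qed

lemma matching_remove:
  assumes "matching R V M" "(a, b) \<in> M"
  shows "matching R V (M - {(a, b)})" "cover (M - {(a, b)}) = cover M - {a, b}" "a \<noteq> b"
proof -
  have 1: "inj_on fst M" "inj_on snd M" "fst ` M \<inter> snd ` M = {}" using assms by (auto simp: matching_def)
  show "matching R V (M - {(a, b)})"
    using assms unfolding matching_def by (auto intro: inj_on_subset)
  have "fst ` (M - {(a, b)}) = fst ` M - {a}" "snd ` (M - {(a, b)}) = snd ` M - {b}"
    using inj_on_image_set_diff[OF 1(1), of M "{(a, b)}"] inj_on_image_set_diff[OF 1(2), of M "{(a, b)}"] assms(2)
    by auto
  then have *: "cover (M - {(a, b)}) = (fst ` M - {a}) \<union> (snd ` M - {b})" by (simp add: cover_def)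
  have ab: "a \<in> fst ` M" "b \<in> snd ` M" using assms(2) by force+
  then have "a \<notin> snd ` M" "b \<notin> fst ` M" using 1(3) by blast+
  then show "cover (M - {(a, b)}) = cover M - {a, b}" "a \<noteq> b"
    using ab unfolding * unfolding cover_def by blast+
qed

lemma max_matching_unmatched:
  assumes M: "max_matching R V M" and V: "finite V"
    and xy: "x \<in> V - cover M" "y \<in> V - cover M" "x \<noteq> y"
  shows "\<not> R x y"
proof
  assume "R x y"
  then have "matching R V (insert (x, y) M)" "(x, y) \<notin> M"
    using matching_insert[of R V M x y] M xy by (auto simp: max_matching_def)
  then show False using M matching_finite[of R V M] V by (fastforce simp: max_matching_def)
qed

text \<open>Exchanging \<open>(a, b)\<close> for \<open>(a, x)\<close> and \<open>(b, y)\<close> is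
  the augmentation along the path x, a, b, y. Augmenting paths of length one and three are the only
  ones that the bound below relies on.\<close>

lemma max_matching_no_augment:
  assumes M: "max_matching R V M" and V: "finite V" and ab: "(a, b) \<in> M"
    and xy: "x \<in> V - cover M" "y \<in> V - cover M" "x \<noteq> y" and R: "R a x" "R b y"
  shows False
proof -
  let ?M1 = "M - {(a, b)}" let ?M2 = "insert (a, x) ?M1"
  have m: "matching R V M" using M by (simp add: max_matching_def)
  have abc: "a \<in> cover M" "b \<in> cover M" using ab by (force simp: cover_def)+
  have abV: "a \<in> V" "b \<in> V" using cover_subset[OF m] abc by auto
  note m1 = matching_remove[OF m ab]
  have 1: "a \<noteq> x" "a \<notin> cover ?M1" "x \<notin> cover ?M1" "x \<in> V" using abc xy m1(2) by auto
  note m2 = matching_insert[OF m1(1) abV(1) 1(4,1) R(1) 1(2,3)]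
  have 2: "b \<noteq> y" "b \<notin> cover ?M2" "y \<notin> cover ?M2" "y \<in> V"
    unfolding m2(3) m1(2) using abc xy m1(3) by blast+
  note m3 = matching_insert[OF m2(1) abV(2) 2(4,1) R(2) 2(2,3)]
  have fin: "finite M" using matching_finite[OF m V] .
  have "card (insert (b, y) ?M2) = Suc (Suc (card ?M1))"
    using fin by (simp only: card_insert_disjoint[OF _ m2(2)] card_insert_disjoint[OF _ m3(2)]
        finite_insert finite_Diff)
  also have "\<dots> = Suc (card M)" using ab fin by (metis card_Suc_Diff1)
  finally have "card (insert (b, y) ?M2) = Suc (card M)" .
  moreover have "card (insert (b, y) ?M2) \<le> card M" using M m3(1) unfolding max_matching_def by blast
  ultimately show False by simp
qed

section \<open>Components and matchings of an almost complete two-coloured graph\<close>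

definition joined :: "('a \<Rightarrow> 'a \<Rightarrow> bool) \<Rightarrow> 'a set \<Rightarrow> 'a \<Rightarrow> 'a \<Rightarrow> bool" where
  "joined R V = (\<lambda>x y. x \<in> V \<and> y \<in> V \<and> R x y)\<^sup>*\<^sup>*"

fun other :: "colour \<Rightarrow> colour" where
  "other Red = Blue" | "other Blue = Red"

lemma joined_step: "x \<in> V \<Longrightarrow> y \<in> V \<Longrightarrow> R x y \<Longrightarrow> joined R V x y"
  by (auto simp: joined_def)

lemma joined_trans: "joined R V x y \<Longrightarrow> joined R V y z \<Longrightarrow> joined R V x z"
  by (auto simp: joined_def)

lemma common_neighbour:
  assumes "finite S" "card {y \<in> S. \<not> P y} \<le> k" "card {y \<in> S. \<not> P' y} \<le> k" "2 * k < card S"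
  obtains y where "y \<in> S" "P y" "P' y"
proof -
  have "\<not> S \<subseteq> {y \<in> S. \<not> P y} \<union> {y \<in> S. \<not> P' y}"
  proof
    assume "S \<subseteq> {y \<in> S. \<not> P y} \<union> {y \<in> S. \<not> P' y}"
    then have "card S \<le> card ({y \<in> S. \<not> P y} \<union> {y \<in> S. \<not> P' y})"
      using assms(1) by (intro card_mono) auto
    then show False using assms card_Un_le[of "{y \<in> S. \<not> P y}" "{y \<in> S. \<not> P' y}"] by linarith
  qed
  then show ?thesis using that by blast
qed

text \<open>An abstract reduced graph. A pair may carry both colours or none, and \<open>k\<close>
  bounds the number of partners with none, the vertex itself included. It will be used with
  \<open>k\<close> equal to two per cent of the original number of vertices, of which another two
  per cent may have been deleted; \<open>4 \<le> k\<close> absorbs additive constants.\<close>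

locale near_complete =
  fixes R :: "colour \<Rightarrow> 'a \<Rightarrow> 'a \<Rightarrow> bool" and V :: "'a set" and k :: nat
  assumes V: "finite V" and sym: "R c x y \<Longrightarrow> R c y x" and irrefl: "\<not> R c x x"
    and miss: "x \<in> V \<Longrightarrow> card {y \<in> V. \<not> R Red x y \<and> \<not> R Blue x y} \<le> k"
    and big: "49 * k \<le> card V" and k: "4 \<le> k"
begin

lemma miss_other:
  assumes "x \<in> V" "S \<subseteq> V" "\<And>y. y \<in> S \<Longrightarrow> \<not> R c x y"
  shows "card {y \<in> S. \<not> R (other c) x y} \<le> k"
proof -
  have "card {y \<in> S. \<not> R (other c) x y} \<le> card {y \<in> V. \<not> R Red x y \<and> \<not> R Blue x y}"
    by (rule card_mono) (use V assms in \<open>cases c; auto\<close>)+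
  then show ?thesis using miss[OF assms(1)] by simp
qed

text \<open>Take a largest union \<open>P\<close> of red components with at most half of the
  vertices. If \<open>P\<close> has more than \<open>2 * k\<close> vertices, then every pair across
  its boundary is blue or missing, and two vertices on one side have a common blue neighbour on the
  other, so blue connects everything. Otherwise the rest is connected in red: if it split, one of
  its parts would contradict the choice of \<open>P\<close>.\<close>

lemma large_component:
  obtains c Q where "Q \<subseteq> V" "card V \<le> card Q + 2 * k"
    "\<And>x y. x \<in> Q \<Longrightarrow> y \<in> Q \<Longrightarrow> joined (R c) V x y"
proof -
  define closed where "closed P \<longleftrightarrow> P \<subseteq> V \<and> (\<forall>x\<in>P. \<forall>y\<in>V. R Red x y \<longrightarrow> y \<in> P)" for P
  define small where "small P \<longleftrightarrow> closed P \<and> 2 * card P \<le> card V" for P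
  have "\<exists>P. small P \<and> (\<forall>P'. small P' \<longrightarrow> card P' \<le> card P)"
    by (rule ex_has_greatest_nat[of small "{}" _ "Suc (card V)"]) (auto simp: small_def closed_def)
  then obtain P where P: "closed P" "2 * card P \<le> card V" and
    maxP: "\<And>P'. closed P' \<Longrightarrow> 2 * card P' \<le> card V \<Longrightarrow> card P' \<le> card P" by (auto simp: small_def)
  have PV: "P \<subseteq> V" using P by (simp add: closed_def)
  have finP: "finite P" using PV V finite_subset by blast
  have cVP: "card (V - P) = card V - card P" using PV finP by (simp add: card_Diff_subset)
  have cross: "\<not> R Red x y" "\<not> R Red y x" if "x \<in> P" "y \<in> V - P" for x y
    using that P(1) sym by (auto simp: closed_def)
  show ?thesis
  proof (cases "2 * k < card P")
    case True
    have inP: "joined (R Blue) V x x'" if "x \<in> P" "x' \<in> P" for x x'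
    proof -
      have "card {y \<in> V - P. \<not> R Blue x y} \<le> k" "card {y \<in> V - P. \<not> R Blue x' y} \<le> k"
        using miss_other[of x "V - P" Red] miss_other[of x' "V - P" Red] that PV cross by auto
      moreover have "2 * k < card (V - P)" using True P(2) cVP by simp
      ultimately obtain y where "y \<in> V - P" "R Blue x y" "R Blue x' y"
        using common_neighbour[of "V - P" "R Blue x" k "R Blue x'"] V by blast
      then show ?thesis using that PV sym by (intro joined_trans[of _ _ x y x'] joined_step) auto
    qed
    have notinP: "joined (R Blue) V x x'" if "x \<in> V - P" "x' \<in> V - P" for x x'
    proof -
      have "card {y \<in> P. \<not> R Blue x y} \<le> k" "card {y \<in> P. \<not> R Blue x' y} \<le> k"
        using miss_other[of x P Red] miss_other[of x' P Red] that PV cross by auto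
      then obtain y where "y \<in> P" "R Blue x y" "R Blue x' y"
        using common_neighbour[of P "R Blue x" k "R Blue x'"] finP True by blast
      then show ?thesis using that PV sym by (intro joined_trans[of _ _ x y x'] joined_step) auto
    qed
    have mixed: "joined (R Blue) V x x'" "joined (R Blue) V x' x" if "x \<in> P" "x' \<in> V - P" for x x'
    proof -
      have "card {y \<in> V - P. \<not> R Blue x y} \<le> k"
        using miss_other[of x "V - P" Red] that PV cross by auto
      moreover have "2 * k < card (V - P)" using True P(2) cVP by simp
      ultimately obtain y where y: "y \<in> V - P" "R Blue x y"
        using common_neighbour[of "V - P" "R Blue x" k "R Blue x"] V by blast
      have "joined (R Blue) V x y" "joined (R Blue) V y x"
        using y that PV sym by (auto intro: joined_step)
      then show "joined (R Blue) V x x'" "joined (R Blue) V x' x"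
        using notinP[of y x'] notinP[of x' y] y that by (blast intro: joined_trans)+
    qed
    have "joined (R Blue) V x y" if "x \<in> V" "y \<in> V" for x y
      using inP[of x y] notinP[of x y] mixed[of x y] mixed[of y x] that by blast
    then show ?thesis using that[of V Blue] by simp
  next
    case False
    have "joined (R Red) V x y" if xy: "x \<in> V - P" "y \<in> V - P" for x y
    proof (rule ccontr)
      assume nj: "\<not> joined (R Red) V x y"
      define C where "C = {z \<in> V. joined (R Red) V x z}"
      define D where "D = V - P - C"
      have closedC: "closed C" unfolding closed_def C_def
        by (auto intro: joined_trans joined_step)
      have back_C: "z \<in> C" if "z' \<in> C" "z \<in> V" "R Red z z'" for z z'
        using closedC sym[OF that(3)] that by (auto simp: closed_def)
      have xC: "x \<in> C" using xy by (auto simp: C_def joined_def)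
      have CP: "z \<notin> P" if "z \<in> C" for z
      proof -
        have "joined (R Red) V x z" using that by (simp add: C_def)
        then show ?thesis unfolding joined_def
          by (induction) (use xy cross in auto)
      qed
      have closedD: "closed D" unfolding closed_def D_def using back_C cross by auto
      have yD: "y \<in> D" using nj xy by (auto simp: D_def C_def)
      have fin: "finite C" "finite D" using V by (auto simp: C_def D_def)
      have "card (P \<union> C) = card P + card C" "card (P \<union> D) = card P + card D" "card (C \<union> D) = card C + card D"
        using CP finP fin by (intro card_Un_disjoint; auto simp: D_def)+
      moreover have "closed (P \<union> C)" "closed (P \<union> D)" using P(1) closedC closedD by (auto simp: closed_def)
      moreover have "card C > 0" "card D > 0" using xC yD fin card_gt_0_iff by blast+
      \<comment> \<open>By maximality of \<open>P\<close>, enlarging it by a nonempty part must lead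
        beyond half of the vertices.\<close>
      ultimately have 1: "card V < 2 * (card P + card C)" "card V < 2 * (card P + card D)"
        using maxP[of "P \<union> C"] maxP[of "P \<union> D"] by (metis add_le_same_cancel1 leI le_zero_eq less_numeral_extra(3))+
      have "card C + card D \<le> card V"
        using \<open>card (C \<union> D) = card C + card D\<close> card_mono[OF V, of "C \<union> D"] by (auto simp: C_def D_def)
      then have "2 * card C \<le> card V \<or> 2 * card D \<le> card V" by linarith
      \<comment> \<open>A part with at most half of the vertices competes with \<open>P\<close> and
        so has at most \<open>2 * k\<close> of them. Together with \<open>P\<close> this is at most
        \<open>4 * k\<close>, far below half of \<open>49 * k\<close>.\<close>
      then have "card C \<le> 2 * k \<or> card D \<le> 2 * k" using maxP closedC closedD False by force
      then show False using 1 False big k by (elim disjE; simp)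
    qed
    then show ?thesis by (intro that[of "V - P" Red]) (use cVP False in auto)
  qed
qed

text \<open>If a maximum matching in the colour of the large component is too small, then the unmatched set \<open>X\<close>
  is almost complete in the other colour. Since there is no augmenting path, every matching edge has an
  end that has at most one neighbour in \<open>X\<close>; these ends, the set \<open>A\<close>, are joined to almost all of \<open>X\<close>
  in the other colour, and a maximum matching on \<open>X \<union> A\<close> in that colour is large.\<close>

theorem connected_matching:
  obtains c M where "matching (R c) V M" "27 * k \<le> 2 * card M"
    "\<And>x y. x \<in> cover M \<Longrightarrow> y \<in> cover M \<Longrightarrow> joined (R c) V x y"
proof -
  obtain c Q where Q: "Q \<subseteq> V" "card V \<le> card Q + 2 * k"
    and conQ: "\<And>x y. x \<in> Q \<Longrightarrow> y \<in> Q \<Longrightarrow> joined (R c) V x y" by (rule large_component) blast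
  have finQ: "finite Q" using Q V finite_subset by blast
  \<comment> \<open>Searching inside \<open>Q\<close> makes the connectedness of the matching
    automatic.\<close>
  obtain M where M: "max_matching (R c) Q M" using ex_max_matching[OF finQ] .
  then have mM: "matching (R c) Q M" by (simp add: max_matching_def)
  have finM: "finite M" using matching_finite[OF mM finQ] .
  have covQ: "cover M \<subseteq> Q" using cover_subset[OF mM] .
  show ?thesis
  proof (cases "27 * k \<le> 2 * card M")
    case True
    have "matching (R c) V M" using mM Q(1) unfolding matching_def by fast
    then show ?thesis using that[of c M] True conQ covQ by blast
  next
    case False
    define X where "X = Q - cover M"
    define R' where "R' = R (other c)"
    have finX: "finite X" and XV: "X \<subseteq> V" and XQ: "X \<subseteq> Q" using finQ Q by (auto simp: X_def)
    have cX: "card X = card Q - 2 * card M"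
      unfolding X_def using card_cover[OF mM finQ] covQ finQ
      by (simp add: card_Diff_subset finite_subset)
    have indX: "\<not> R c x y" if "x \<in> X" "y \<in> X" for x y
      using max_matching_unmatched[OF M finQ, of x y] that irrefl by (auto simp: X_def)
    \<comment> \<open>If both ends had two neighbours in \<open>X\<close>, distinct uncovered
      neighbours could be chosen for them, which is an augmentation.\<close>
    have "\<exists>e\<in>{fst p, snd p}. card {x \<in> X. R c e x} \<le> 1" if p: "p \<in> M" for p
    proof (rule ccontr)
      assume "\<not> ?thesis"
      then have "card {x \<in> X. R c (fst p) x} > 1" "card {x \<in> X. R c (snd p) x} > 1" by auto
      then have 2: "card {x \<in> X. R c (fst p) x} > 1" "card {x \<in> X. R c (snd p) x} \<noteq> 0" by linarith+
      then have "{x \<in> X. R c (snd p) x} \<noteq> {}" by (metis card.empty)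
      then obtain x where x: "x \<in> X" "R c (snd p) x" by blast
      have "\<not> {x \<in> X. R c (fst p) x} \<subseteq> {x}"
        using 2(1) card_mono[of "{x}" "{x \<in> X. R c (fst p) x}"] by auto
      then obtain y where "y \<in> X" "R c (fst p) y" "x \<noteq> y" by blast
      then show False using x max_matching_no_augment[OF M finQ, of "fst p" "snd p" y x] p 
        by (auto simp: X_def)
    qed
    then obtain e where e: "\<And>p. p \<in> M \<Longrightarrow> e p \<in> {fst p, snd p}" "\<And>p. p \<in> M \<Longrightarrow> card {x \<in> X. R c (e p) x} \<le> 1"
      by metis
    define A where "A = e ` M"
    have inj_e: "inj_on e M"
    proof (rule inj_onI)
      fix p q assume pq: "p \<in> M" "q \<in> M" "e p = e q"
      have "inj_on fst M" "inj_on snd M" "fst ` M \<inter> snd ` M = {}" using mM by (auto simp: matching_def)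
      then show "p = q" using e(1)[OF pq(1)] e(1)[OF pq(2)] pq
        by (auto dest: inj_onD)
    qed
    have Acov: "A \<subseteq> cover M"
    proof
      fix a assume "a \<in> A"
      then obtain p where "p \<in> M" "a = e p" by (auto simp: A_def)
      then show "a \<in> cover M" using e(1)[of p] by (auto simp: cover_def)
    qed
    have AX: "A \<inter> X = {}" using Acov by (auto simp: X_def)
    have finA: "finite A" and cA: "card A = card M" using finM inj_e by (auto simp: A_def card_image)
    define W where "W = X \<union> A"
    have W: "finite W" "W \<subseteq> V" using finX finA XV Acov covQ Q by (auto simp: W_def)
    define bad where "bad w = {x \<in> X. \<not> R' w x}" for w
    have finbad: "finite (bad w)" for w using finX by (simp add: bad_def)
    \<comment> \<open>At most \<open>k\<close> vertices of \<open>X\<close> are joined to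
      \<open>w\<close> in neither colour, and at most one is joined to it in colour
      \<open>c\<close>.\<close>
    have cbad: "card (bad w) \<le> k + 1" if "w \<in> W" for w
    proof -
      have 1: "card {x \<in> X. R c w x} \<le> 1"
      proof (cases "w \<in> X")
        case True
        then have "{x \<in> X. R c w x} = {}" using indX by blast
        then show ?thesis by (simp only: card.empty)
      qed (use that e(2) in \<open>auto simp: W_def A_def\<close>)
      have "card {x \<in> X - {x \<in> X. R c w x}. \<not> R (other c) w x} \<le> k"
        by (rule miss_other) (use that W XV in auto)
      moreover have "bad w \<subseteq> {x \<in> X - {x \<in> X. R c w x}. \<not> R (other c) w x} \<union> {x \<in> X. R c w x}"
        by (auto simp: bad_def R'_def)
      then have "card (bad w) \<le> card ({x \<in> X - {x \<in> X. R c w x}. \<not> R (other c) w x} \<union> {x \<in> X. R c w x})"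
        using finX by (intro card_mono) auto
      ultimately show ?thesis
        using 1 card_Un_le[of "{x \<in> X - {x \<in> X. R c w x}. \<not> R (other c) w x}" "{x \<in> X. R c w x}"]
        by linarith
    qed
    \<comment> \<open>\<open>Q\<close> has at least \<open>47 * k\<close> vertices, of which the
      matching covers fewer than \<open>27 * k\<close>.\<close>
    have cX20: "20 * k \<le> card X" using cX Q(2) big False by linarith
    have con: "joined R' V w w'" if ww: "w \<in> W" "w' \<in> W" for w w'
    proof -
      have "2 * (k + 1) < card X" using cX20 k by simp
      then obtain x where "x \<in> X" "R' w x" "R' w' x"
        using common_neighbour[OF finX cbad[OF ww(1), unfolded bad_def] cbad[OF ww(2), unfolded bad_def]]
        by metis
      then show ?thesis using ww W XV sym
        by (intro joined_trans[of _ _ w x w'] joined_step) (auto simp: R'_def)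
    qed
    obtain M' where M': "max_matching R' W M'" using ex_max_matching[OF W(1)] .
    then have mM': "matching R' W M'" by (simp add: max_matching_def)
    have finM': "finite M'" using matching_finite[OF mM' W(1)] .
    have inj': "inj_on fst M'" "inj_on snd M'" using mM' by (auto simp: matching_def)
    have covW: "cover M' \<subseteq> W" using cover_subset[OF mM'] .
    define U where "U = W - cover M'"
    have finU: "finite U" using W by (simp add: U_def)
    have UX: "card (U \<inter> X) \<le> k + 1"
    proof (cases "U \<inter> X = {}")
      case False
      then obtain u where u: "u \<in> U" "u \<in> X" by auto
      have "U \<inter> X \<subseteq> bad u"
        using max_matching_unmatched[OF M' W(1), of u] u irrefl by (auto simp: bad_def U_def R'_def)
      then have "card (U \<inter> X) \<le> card (bad u)" using finbad by (intro card_mono)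
      then show ?thesis using cbad[of u] u by (auto simp: W_def)
    qed simp
    have "27 * k \<le> 2 * card M'"
    proof (cases "card (U \<inter> A) \<le> 1")
      case True
      \<comment> \<open>At most \<open>k + 2\<close> vertices of \<open>W\<close> are uncovered,
        while \<open>W\<close> has \<open>card Q - card M\<close> vertices, which is more than
        \<open>33 * k\<close>.\<close>
      have "card U \<le> card (U \<inter> X) + card (U \<inter> A)"
        using card_Un_le[of "U \<inter> X" "U \<inter> A"] by (metis Int_Un_distrib U_def W_def Diff_subset Int_absorb2)
      moreover have "card U = card W - 2 * card M'"
        unfolding U_def using card_cover[OF mM' W(1)] covW W
        by (simp add: card_Diff_subset finite_subset)
      moreover have "card W = card X + card A"
        unfolding W_def using finX finA AX by (intro card_Un_disjoint) auto
      ultimately show ?thesis using True UX cA cX Q(2) big False k by linarith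
    next
      case False': False
      then obtain a a' where a: "a \<in> U \<inter> A" "a' \<in> U \<inter> A" "a \<noteq> a'"
        by (metis One_nat_def card_le_Suc0_iff_eq finU finite_Int)
      have aW: "a \<in> W" "a' \<in> W" using a by (auto simp: U_def)
      define MX where "MX = {p \<in> M'. fst p \<in> X \<and> snd p \<in> X}"
      \<comment> \<open>The uncovered vertices \<open>a\<close> and \<open>a'\<close> would augment
        an edge whose first end is joined to \<open>a\<close> and second end to \<open>a'\<close>.
        Hence at most \<open>2 * k + 2\<close> edges of \<open>M'\<close> lie inside
        \<open>X\<close>, and nearly all vertices of \<open>X\<close> use up an edge of their
        own.\<close>
      have "fst p \<in> bad a \<or> snd p \<in> bad a'" if "p \<in> MX" for p
        using max_matching_no_augment[OF M' W(1), of "fst p" "snd p" a a'] that a sym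
        by (auto simp: MX_def bad_def U_def R'_def)
      then have "MX \<subseteq> {p \<in> M'. fst p \<in> bad a} \<union> {p \<in> M'. snd p \<in> bad a'}" by (auto simp: MX_def)
      then have "card MX \<le> card ({p \<in> M'. fst p \<in> bad a} \<union> {p \<in> M'. snd p \<in> bad a'})"
        using finM' by (intro card_mono) auto
      also have "\<dots> \<le> card {p \<in> M'. fst p \<in> bad a} + card {p \<in> M'. snd p \<in> bad a'}" by (rule card_Un_le)
      also have "\<dots> \<le> card (bad a) + card (bad a')"
        by (intro add_mono card_inj_on_le[of fst] card_inj_on_le[of snd])
          (use finbad inj' in \<open>auto intro: inj_on_subset\<close>)
      finally have MX: "card MX \<le> 2 * k + 2" using cbad[OF aW(1)] cbad[OF aW(2)] by linarith
      let ?F = "{p \<in> M'. fst p \<in> X}" and ?S = "{p \<in> M'. snd p \<in> X}"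
      have "X \<subseteq> (U \<inter> X) \<union> (fst ` ?F \<union> snd ` ?S)" by (auto simp: U_def W_def cover_def)
      then have "card X \<le> card ((U \<inter> X) \<union> (fst ` ?F \<union> snd ` ?S))" using finU finM' by (intro card_mono) auto
      also have "\<dots> \<le> card (U \<inter> X) + (card (fst ` ?F) + card (snd ` ?S))"
        by (meson card_Un_le add_left_mono order_trans)
      also have "\<dots> \<le> (k + 1) + (card ?F + card ?S)"
        using UX finM' by (intro add_mono card_image_le) auto
      also have "card ?F + card ?S = card (?F \<union> ?S) + card (?F \<inter> ?S)"
        using finM' by (intro card_Un_Int) auto
      also have "?F \<inter> ?S = MX" by (auto simp: MX_def)
      finally have "card X \<le> (k + 1) + (card (?F \<union> ?S) + card MX)" .
      moreover have "card (?F \<union> ?S) \<le> card M'" using finM' by (intro card_mono) auto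
      ultimately show ?thesis using MX cX20 k by linarith
    qed
    moreover have "matching R' V M'" using mM' W(2) unfolding matching_def by fast
    ultimately show ?thesis using that[of "other c" M'] con covW unfolding R'_def by blast
  qed
qed

end

section \<open>Embedding strips\<close>

text \<open>Greedy choice in the order of the indices. Among the candidates for a vertex, at most
  \<open>t\<close> are already used in this layer, fewer than \<open>b\<close> see less than a
  quarter of \<open>T\<close>, and fewer than \<open>b\<close> see less than a quarter of what the
  preceding image sees in \<open>T\<close>; any other candidate will do. Two successive quarters
  give the factor 16. The bound \<open>4 * e \<le> card T\<close> keeps the smaller target large
  enough for \<open>dense\<close>.\<close>

lemma layer_step:
  fixes nb :: "'v \<Rightarrow> 'v set" and C :: "nat \<Rightarrow> 'v set" and b e :: real
  assumes fin: "finite S" "finite I" and I: "card I \<le> t"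
    and C: "\<And>i. i \<in> I \<Longrightarrow> C i \<subseteq> S" "\<And>i. i \<in> I \<Longrightarrow> 2 * b + t \<le> card (C i)"
    and dense: "\<And>B. B \<subseteq> T \<Longrightarrow> e \<le> card B \<Longrightarrow> card {a \<in> S. 4 * card (nb a \<inter> B) < card B} < b"
    and big: "4 * e \<le> card T" "0 \<le> e"
  shows "\<exists>g. inj_on g I \<and> (\<forall>i\<in>I. g i \<in> C i \<and> card T \<le> 4 * card (nb (g i) \<inter> T)) \<and>
    (\<forall>i. i \<in> I \<and> Suc i \<in> I \<longrightarrow> card T \<le> 16 * card (nb (g i) \<inter> (nb (g (Suc i)) \<inter> T)))"
proof -
  have "\<exists>g. inj_on g (I \<inter> {..<n}) \<and> (\<forall>i\<in>I \<inter> {..<n}. g i \<in> C i \<and> card T \<le> 4 * card (nb (g i) \<inter> T)) \<and>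
    (\<forall>i. i \<in> I \<inter> {..<n} \<and> Suc i \<in> I \<inter> {..<n} \<longrightarrow> card T \<le> 16 * card (nb (g i) \<inter> (nb (g (Suc i)) \<inter> T)))"
    for n
  proof (induction n)
    case 0
    show ?case by simp
  next
    case (Suc n)
    then obtain g where g: "inj_on g (I \<inter> {..<n})"
      "\<And>i. i \<in> I \<Longrightarrow> i < n \<Longrightarrow> g i \<in> C i" "\<And>i. i \<in> I \<Longrightarrow> i < n \<Longrightarrow> card T \<le> 4 * card (nb (g i) \<inter> T)"
      "\<And>i. i \<in> I \<Longrightarrow> Suc i \<in> I \<Longrightarrow> Suc i < n \<Longrightarrow> card T \<le> 16 * card (nb (g i) \<inter> (nb (g (Suc i)) \<inter> T))"
      by auto
    show ?case
    proof (cases "n \<in> I")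
      case False
      then have "I \<inter> {..<Suc n} = I \<inter> {..<n}" by (auto simp: less_Suc_eq)
      then show ?thesis using Suc by presburger
    next
      case True
      define U where "U = g ` (I \<inter> {..<n})"
      \<comment> \<open>If the preceding index does not belong to the layer, there is no common
        neighbourhood to protect, and \<open>T\<close> itself takes its place.\<close>
      define T' where "T' = (if 0 < n \<and> n - 1 \<in> I then nb (g (n - 1)) \<inter> T else T)"
      define bad where "bad B = {a \<in> S. 4 * card (nb a \<inter> B) < card B}" for B
      have "e \<le> card T'"
      proof (cases "0 < n \<and> n - 1 \<in> I")
        case True
        then have "card T \<le> 4 * card T'" using g(3)[of "n - 1"] by (simp add: T'_def)
        then show ?thesis using big by linarith
      qed (use big in \<open>auto simp: T'_def\<close>)
      then have 1: "card (bad T') < b" unfolding bad_def by (intro dense) (auto simp: T'_def)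
      have 2: "card (bad T) < b" unfolding bad_def by (intro dense) (use big in auto)
      have "card U \<le> card (I \<inter> {..<n})" unfolding U_def using fin by (intro card_image_le) auto
      also have "\<dots> \<le> card I" using fin by (intro card_mono) auto
      finally have 3: "card U \<le> t" using I by simp
      have "card (U \<union> bad T \<union> bad T') \<le> card U + card (bad T) + card (bad T')"
        by (meson add_le_mono1 card_Un_le le_trans)
      then have "card (U \<union> bad T \<union> bad T') < card (C n)" using 1 2 3 C(2)[OF True] by linarith
      moreover have "finite (U \<union> bad T \<union> bad T')" using fin by (auto simp: U_def bad_def)
      ultimately have "\<not> C n \<subseteq> U \<union> bad T \<union> bad T'" using card_mono[of "U \<union> bad T \<union> bad T'" "C n"] by linarith
      then obtain a where a: "a \<in> C n" "a \<notin> U" "a \<notin> bad T" "a \<notin> bad T'" by blast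
      have aS: "a \<in> S" using a(1) C(1)[OF True] by auto
      define g' where "g' = g(n := a)"
      have old: "g' i = g i" if "i < n" for i using that by (simp add: g'_def)
      have new: "g' n = a" by (simp add: g'_def)
      have "I \<inter> {..<Suc n} = insert n (I \<inter> {..<n})" using True by (auto simp: less_Suc_eq)
      moreover have "inj_on g' (insert n (I \<inter> {..<n}))"
      proof -
        have "I \<inter> {..<n} - {n} = I \<inter> {..<n}" by auto
        moreover have "g' ` (I \<inter> {..<n}) = U" unfolding U_def by (intro image_cong) (auto simp: old)
        moreover have "inj_on g' (I \<inter> {..<n})"
          using g(1) by (subst inj_on_cong[of _ g' g]) (auto simp: old)
        ultimately show ?thesis using a(2) by (simp only: inj_on_insert new simp_thms)
      qed
      ultimately have inj: "inj_on g' (I \<inter> {..<Suc n})" by simp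
      have 4: "card T \<le> 4 * card (nb a \<inter> T)" using a(3) aS by (simp add: bad_def)
      have 5: "card T' \<le> 4 * card (nb a \<inter> T')" using a(4) aS by (simp add: bad_def)
      have "card T \<le> 16 * card (nb (g' i) \<inter> (nb (g' (Suc i)) \<inter> T))" if "i \<in> I" "Suc i \<in> I" "Suc i < Suc n" for i
      proof (cases "Suc i = n")
        case True
        then have T': "T' = nb (g i) \<inter> T" using that by (auto simp: T'_def)
        have "card T \<le> 4 * card T'" unfolding T' using g(3)[of i] that True by simp
        moreover have "nb a \<inter> T' = nb (g i) \<inter> (nb a \<inter> T)" unfolding T' by blast
        ultimately show ?thesis using 5 True new old[of i] by simp
      next
        case False
        then show ?thesis using g(4)[of i] that old by simp
      qed
      moreover have "g' i \<in> C i \<and> card T \<le> 4 * card (nb (g' i) \<inter> T)" if "i \<in> I" "i < Suc n" for i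
        using that g(2,3)[of i] 4 a(1) by (cases "i = n") (auto simp: old new)
      ultimately show ?thesis using inj by (intro exI[of _ g']) simp
    qed
  qed
  note ex = this
  obtain n where "I \<subseteq> {..<n}" using fin(2) finite_nat_iff_bounded by blast
  then have "I \<inter> {..<n} = I" by auto
  then show ?thesis using ex[of n] by simp
qed

text \<open>A strip has layers \<open>I s\<close>, and \<open>(s, i)\<close> is adjacent to \<open>(Suc s, i)\<close> and \<open>(Suc s, Suc i)\<close>. Layer \<open>s\<close> is
  embedded greedily into the unused part of \<open>S s\<close>, in such a way that consecutive images keep many common
  neighbours in the unused part of \<open>S (Suc s)\<close>. Since the layers are short, hardly anything is used up
  between the choice of a vertex and the choice of its neighbours; hence the clusters may be filled up
  to a small proportion \<open>\<mu>\<close>.\<close>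

lemma strip_embedding:
  fixes nb :: "'v \<Rightarrow> 'v set" and S :: "nat \<Rightarrow> 'v set" and I :: "nat \<Rightarrow> nat set" and \<epsilon> \<mu> :: real
  assumes fin: "\<And>s. finite (S s)" "\<And>s. finite (I s)" and I: "\<And>s. card (I s) \<le> t"
    and ne: "\<And>s. s < T \<Longrightarrow> S s \<noteq> {}" and \<epsilon>: "0 < \<epsilon>" and \<mu>: "\<mu> \<le> 1"
    and dense: "\<And>s B. Suc s < T \<Longrightarrow> B \<subseteq> S (Suc s) \<Longrightarrow> \<epsilon> * card (S (Suc s)) \<le> card B \<Longrightarrow>
      card {a \<in> S s. 4 * card (nb a \<inter> B) < card B} < \<epsilon> * card (S s)"
    and cap: "\<And>s. s < T \<Longrightarrow>
      \<mu> * card (S s) + (\<Sum>s'\<in>{s'. s' < s \<and> S s' \<inter> S s \<noteq> {}}. card (I s')) \<le> card (S s)"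
    and const: "\<And>s. s < T \<Longrightarrow> 16 * (2 * (\<epsilon> * card (S s)) + 2 * t) \<le> \<mu> * card (S s)"
  obtains f where "inj_on (\<lambda>(s, i). f s i) (SIGMA s:{..<T}. I s)"
    "\<And>s i. s < T \<Longrightarrow> i \<in> I s \<Longrightarrow> f s i \<in> S s"
    "\<And>s i j. Suc s < T \<Longrightarrow> i \<in> I s \<Longrightarrow> j \<in> I (Suc s) \<Longrightarrow> j = i \<or> j = Suc i \<Longrightarrow> f (Suc s) j \<in> nb (f s i)"
proof -
  define used where "used f n = (\<Union>s<n. f s ` I s)" for f :: "nat \<Rightarrow> nat \<Rightarrow> 'v" and n
  \<comment> \<open>Only the images of layer \<open>n - 1\<close> restrict the vertex
    \<open>(n, j)\<close>; for \<open>n = 0\<close> the condition is vacuous.\<close>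
  define cand where "cand f n j = {v \<in> S n - used f n.
      \<forall>s i. Suc s = n \<longrightarrow> i \<in> I s \<longrightarrow> j = i \<or> j = Suc i \<longrightarrow> v \<in> nb (f s i)}" for f n j
  define good where "good f n \<longleftrightarrow> inj_on (\<lambda>(s, i). f s i) (SIGMA s:{..<n}. I s) \<and>
      (\<forall>s<n. \<forall>i\<in>I s. f s i \<in> S s) \<and>
      (\<forall>s i j. Suc s < n \<longrightarrow> i \<in> I s \<longrightarrow> j \<in> I (Suc s) \<longrightarrow> j = i \<or> j = Suc i \<longrightarrow> f (Suc s) j \<in> nb (f s i))"
    for f n
  \<comment> \<open>The candidate sets have the size that \<open>layer_step\<close> asks for when
    layer \<open>n\<close> is embedded; past the last layer nothing is demanded.\<close>
  define ready where "ready f n \<longleftrightarrow> (n < T \<longrightarrow> (\<forall>j\<in>I n. 2 * (\<epsilon> * card (S n)) + t \<le> card (cand f n j)))" for f n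
  have free: "\<mu> * card (S (Suc n)) \<le> card (S (Suc n) - used f n)" if "Suc n < T" "good f n" for f n
  proof -
    let ?J = "{s'. s' < Suc n \<and> S s' \<inter> S (Suc n) \<noteq> {}}"
    have "used f n \<inter> S (Suc n) \<subseteq> (\<Union>s\<in>?J. f s ` I s)"
    proof
      fix v assume v: "v \<in> used f n \<inter> S (Suc n)"
      then obtain s i where si: "s < n" "i \<in> I s" "v = f s i" by (auto simp: used_def)
      then have "v \<in> S s" using that(2) by (simp add: good_def)
      then have "s \<in> ?J" using v si by auto
      then show "v \<in> (\<Union>s\<in>?J. f s ` I s)" using si by blast
    qed
    then have "card (used f n \<inter> S (Suc n)) \<le> card (\<Union>s\<in>?J. f s ` I s)" using fin by (intro card_mono) auto
    also have "\<dots> \<le> (\<Sum>s\<in>?J. card (f s ` I s))" by (rule card_UN_le) simp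
    also have "\<dots> \<le> (\<Sum>s\<in>?J. card (I s))" by (intro sum_mono card_image_le fin)
    finally have "\<mu> * card (S (Suc n)) + card (used f n \<inter> S (Suc n)) \<le> card (S (Suc n))"
      using cap[OF that(1)] by linarith
    moreover have "card (S (Suc n)) = card (used f n \<inter> S (Suc n)) + card (S (Suc n) - used f n)"
      using card_Int_Diff[of "S (Suc n)" "used f n"] fin by (simp add: Int_commute)
    ultimately show ?thesis by linarith
  qed
  have "\<exists>f. good f n \<and> ready f n" if "n \<le> T" for n
    using that
  proof (induction n)
    case 0
    have "2 * (\<epsilon> * card (S 0)) + t \<le> card (S 0)" if "0 < T"
      using const[OF that] mult_right_mono[OF \<mu>, of "card (S 0)"] mult_nonneg_nonneg[of \<epsilon> "card (S 0)"] \<epsilon> by simp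
    then have "good (\<lambda>_ _. undefined) 0 \<and> ready (\<lambda>_ _. undefined) 0"
      by (auto simp: good_def ready_def cand_def used_def)
    then show ?case by blast
  next
    case (Suc n)
    then obtain f where f: "good f n" "ready f n" by auto
    have nT: "n < T" using Suc by simp
    \<comment> \<open>\<open>T0\<close> is fixed before layer \<open>n\<close> is placed, and that
      layer may take up to \<open>t\<close> further vertices from it; this accounts for one of the
      two \<open>t\<close> in \<open>const\<close>. After the last layer there is nothing to look
      ahead to, and the empty set with threshold 0 makes the requirements trivial.\<close>
    define T0 where "T0 = (if Suc n < T then S (Suc n) - used f n else {})"
    define e where "e = (if Suc n < T then \<epsilon> * card (S (Suc n)) else 0)"
    have T0: "Suc n < T \<Longrightarrow> 16 * (2 * (\<epsilon> * card (S (Suc n))) + 2 * t) \<le> card T0"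
      using free[of n f] f(1) const[of "Suc n"] by (simp add: T0_def)
    have pos: "0 < \<epsilon> * card (S n)" using ne[OF nT] fin(1) \<epsilon> by (simp add: card_gt_0_iff)
    have "\<exists>g. inj_on g (I n) \<and> (\<forall>i\<in>I n. g i \<in> cand f n i \<and> card T0 \<le> 4 * card (nb (g i) \<inter> T0)) \<and>
      (\<forall>i. i \<in> I n \<and> Suc i \<in> I n \<longrightarrow> card T0 \<le> 16 * card (nb (g i) \<inter> (nb (g (Suc i)) \<inter> T0)))"
    proof (rule layer_step[where S = "S n" and t = t and b = "\<epsilon> * card (S n)" and e = e])
      show "card {a \<in> S n. 4 * card (nb a \<inter> B) < card B} < \<epsilon> * card (S n)" if "B \<subseteq> T0" "e \<le> card B" for B
      proof (cases "Suc n < T")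
        case True
        then show ?thesis using dense[OF True, of B] that by (auto simp: T0_def e_def)
      next
        case False
        then show ?thesis using that pos by (simp add: T0_def)
      qed
      show "4 * e \<le> card T0" 
        using T0 mult_nonneg_nonneg[of \<epsilon> "card (S (Suc n))"] \<epsilon> by (auto simp: e_def)
    qed (use f(2) nT I fin \<epsilon> in \<open>auto simp: ready_def e_def cand_def\<close>)
    then obtain g where g: "inj_on g (I n)" "\<And>i. i \<in> I n \<Longrightarrow> g i \<in> cand f n i"
      "\<And>i. i \<in> I n \<Longrightarrow> card T0 \<le> 4 * card (nb (g i) \<inter> T0)"
      "\<And>i. i \<in> I n \<Longrightarrow> Suc i \<in> I n \<Longrightarrow> card T0 \<le> 16 * card (nb (g i) \<inter> (nb (g (Suc i)) \<inter> T0))" by metis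
    define f' where "f' = f(n := g)"
    have old: "f' s = f s" if "s < n" for s using that by (simp add: f'_def)
    have new: "f' n = g" by (simp add: f'_def)
    have used_old: "used f' n = used f n" unfolding used_def by (intro SUP_cong) (auto simp: old)
    have used_new: "used f' (Suc n) = used f n \<union> g ` I n"
      using used_old by (simp add: used_def lessThan_Suc new Un_commute)
    have "good f' (Suc n)"
    proof -
      have "inj_on (\<lambda>(s, i). f' s i) (SIGMA s:{..<Suc n}. I s)"
      proof -
        have old_inj: "s = s' \<and> i = i'" if "s < n" "s' < n" "i \<in> I s" "i' \<in> I s'" "f s i = f s' i'" for s s' i i'
          using f(1) that unfolding good_def inj_on_def by fastforce
        have "g i \<noteq> f s' i'" if "i \<in> I n" "s' < n" "i' \<in> I s'" for i s' i'
          using g(2)[OF that(1)] that by (auto simp: cand_def used_def)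
        then show ?thesis using old_inj g(1)
          unfolding inj_on_def by (auto simp: less_Suc_eq old new) metis+
      qed
      moreover have "f' s i \<in> S s" if "s < Suc n" "i \<in> I s" for s i
        using that f(1) g(2)[of i] by (cases "s = n") (auto simp: old new good_def cand_def)
      moreover have "f' (Suc s) j \<in> nb (f' s i)"
        if "Suc s < Suc n" "i \<in> I s" "j \<in> I (Suc s)" "j = i \<or> j = Suc i" for s i j
      proof (cases "Suc s = n")
        case True
        then show ?thesis using that g(2)[of j] by (auto simp: cand_def old new)
      next
        case False
        then show ?thesis using that f(1) by (auto simp: good_def old)
      qed
      ultimately show ?thesis unfolding good_def by blast
    qed
    moreover have "ready f' (Suc n)"
      unfolding ready_def
    proof (intro impI ballI)
      fix j assume sn: "Suc n < T" and j: "j \<in> I (Suc n)"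
      define K where "K = {v \<in> T0. \<forall>i\<in>I n. j = i \<or> j = Suc i \<longrightarrow> v \<in> nb (g i)}"
      have finT0: "finite T0" using fin by (simp add: T0_def)
      \<comment> \<open>The vertex \<open>(Suc n, j)\<close> has at most the neighbours
        \<open>j\<close> and \<open>j - 1\<close> in layer \<open>n\<close>, hence four cases; two
        images leave a sixteenth of \<open>T0\<close>, a single one leaves a quarter.\<close>
      have K: "card T0 \<le> 16 * card K"
      proof (cases "j \<in> I n")
        case True
        show ?thesis
        proof (cases "\<exists>i\<in>I n. j = Suc i")
          case True
          then obtain i where i: "i \<in> I n" "j = Suc i" by blast
          then have "K = nb (g i) \<inter> (nb (g (Suc i)) \<inter> T0)" using \<open>j \<in> I n\<close> by (auto simp: K_def)
          then show ?thesis using g(4)[of i] i \<open>j \<in> I n\<close> by simp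
        next
          case False
          then have "K = nb (g j) \<inter> T0" using True by (auto simp: K_def)
          then show ?thesis using g(3)[of j] True by simp
        qed
      next
        case no: False
        show ?thesis
        proof (cases "\<exists>i\<in>I n. j = Suc i")
          case True
          then obtain i where i: "i \<in> I n" "j = Suc i" by blast
          then have "K = nb (g i) \<inter> T0" using no by (auto simp: K_def)
          then show ?thesis using g(3)[of i] i by simp
        next
          case False
          then have "K = T0" using no by (auto simp: K_def)
          then show ?thesis by simp
        qed
      qed
      have "cand f' (Suc n) j = K - g ` I n"
        using sn by (auto simp: cand_def K_def T0_def used_new new)
      moreover have "card K - card (g ` I n) \<le> card (K - g ` I n)"
        using fin by (intro diff_card_le_card_Diff) auto
      moreover have "card (g ` I n) \<le> t" using card_image_le[OF fin(2), of g n] I[of n] by linarith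
      ultimately have "card K \<le> card (cand f' (Suc n) j) + t" by simp
      then have "card T0 \<le> 16 * (card (cand f' (Suc n) j) + t)" using K by simp
      then have "real (card T0) \<le> 16 * (real (card (cand f' (Suc n) j)) + real t)"
        using of_nat_mono[of "card T0" "16 * (card (cand f' (Suc n) j) + t)", where 'a = real] by simp
      then show "2 * (\<epsilon> * card (S (Suc n))) + t \<le> card (cand f' (Suc n) j)"
        using T0[OF sn] by simp
    qed
    ultimately show ?case by blast
  qed
  from this[of T] obtain f where "good f T" by auto
  then show ?thesis using that[of f] unfolding good_def by blast
qed

section \<open>Walks with prescribed loads\<close>

text \<open>Consecutive terms pair off to at most one in absolute value, and
  \<open>L \<le> 2 * t\<close> allows at most \<open>t\<close> pairs; an unpaired last term costs at
  most another \<open>t\<close>.\<close>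

lemma alternating_sum_bound:
  fixes w :: "nat \<Rightarrow> real" and t :: real
  assumes w: "\<And>s. \<bar>w (Suc s) - w s\<bar> \<le> 1" "\<And>s. 0 \<le> w s" "\<And>s. w s \<le> t" and L: "L \<le> 2 * t"
  shows "\<bar>\<Sum>k<L. (- 1) ^ k * w (b + k)\<bar> \<le> 2 * t"
proof -
  have even: "\<bar>\<Sum>k<2 * q. (- 1) ^ k * w (b + k)\<bar> \<le> q" for q
  proof (induction q)
    case (Suc q)
    have "(\<Sum>k<2 * Suc q. (- 1) ^ k * w (b + k)) = (\<Sum>k<2 * q. (- 1) ^ k * w (b + k)) + (w (b + 2 * q) - w (Suc (b + 2 * q)))"
      by simp
    then show ?case using Suc w(1)[of "b + 2 * q"] by linarith
  qed simp
  show ?thesis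
  proof (cases "even L")
    case True
    then obtain q where "L = 2 * q" by blast
    then show ?thesis using even[of q] L by simp
  next
    case False
    then obtain q where q: "L = Suc (2 * q)" using oddE by (metis Suc_eq_plus1)
    have "(\<Sum>k<L. (- 1) ^ k * w (b + k)) = (\<Sum>k<2 * q. (- 1) ^ k * w (b + k)) + w (b + 2 * q)" by (simp add: q)
    moreover have "real q \<le> t" using L q by simp
    ultimately show ?thesis using even[of q] w(2,3)[of "b + 2 * q"] by linarith
  qed
qed

text \<open>The two halves differ by at most \<open>2 * t\<close>, so each is within
  \<open>t\<close> of their mean.\<close>

lemma alternating_halves:
  fixes w :: "nat \<Rightarrow> real" and t :: real
  assumes w: "\<And>s. \<bar>w (Suc s) - w s\<bar> \<le> 1" "\<And>s. 0 \<le> w s" "\<And>s. w s \<le> t" and L: "L \<le> 2 * t"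
  shows "(\<Sum>k | k < L \<and> even k. w (b + k)) \<le> (\<Sum>k<L. w (b + k)) / 2 + t"
    "(\<Sum>k | k < L \<and> odd k. w (b + k)) \<le> (\<Sum>k<L. w (b + k)) / 2 + t"
proof -
  let ?E = "\<Sum>k | k < L \<and> even k. w (b + k)" and ?O = "\<Sum>k | k < L \<and> odd k. w (b + k)"
  have split: "sum h {..<L} = (\<Sum>k | k < L \<and> even k. h k) + (\<Sum>k | k < L \<and> odd k. h k)" for h :: "nat \<Rightarrow> real"
  proof -
    have "sum h {..<L} = sum h ({k. k < L \<and> even k} \<union> {k. k < L \<and> odd k})" by (intro sum.cong) auto
    then show ?thesis by (subst (asm) sum.union_disjoint) auto
  qed
  have "(\<Sum>k<L. (- 1) ^ k * w (b + k)) = ?E - ?O"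
    unfolding split[of "\<lambda>k. (- 1) ^ k * w (b + k)"] by (simp add: sum_negf)
  then have "\<bar>?E - ?O\<bar> \<le> 2 * t" using alternating_sum_bound[where w = w, OF w L, of b] by simp
  then show "?E \<le> (\<Sum>k<L. w (b + k)) / 2 + t" "?O \<le> (\<Sum>k<L. w (b + k)) / 2 + t"
    unfolding split[of "\<lambda>k. w (b + k)"] by (simp_all add: field_simps abs_le_iff)
qed

section \<open>The load that a walk puts on the vertices it visits\<close>

definition load :: "(nat \<Rightarrow> real) \<Rightarrow> (nat \<Rightarrow> 'b) \<Rightarrow> nat \<Rightarrow> nat \<Rightarrow> 'b \<Rightarrow> real" where
  "load w \<phi> a b v = (\<Sum>s | a \<le> s \<and> s < b \<and> \<phi> s = v. w s)"

lemma load_split: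
  assumes "a \<le> b" "b \<le> c"
  shows "load w \<phi> a c v = load w \<phi> a b v + load w \<phi> b c v"
proof -
  have "{s. a \<le> s \<and> s < c \<and> \<phi> s = v} = {s. a \<le> s \<and> s < b \<and> \<phi> s = v} \<union> {s. b \<le> s \<and> s < c \<and> \<phi> s = v}"
    using assms by auto
  then show ?thesis unfolding load_def by (simp add: sum.union_disjoint disjoint_iff)
qed

lemma load_cong: "(\<And>s. a \<le> s \<Longrightarrow> s < b \<Longrightarrow> \<phi> s = \<psi> s) \<Longrightarrow> load w \<phi> a b v = load w \<psi> a b v"
  unfolding load_def by (intro sum.cong) auto

lemma load_mono: "b \<le> c \<Longrightarrow> (\<And>s. 0 \<le> w s) \<Longrightarrow> load w \<phi> a b v \<le> load w \<phi> a c v"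
  unfolding load_def by (intro sum_mono2) auto

lemma load_le:
  fixes t :: real
  assumes "\<And>s. 0 \<le> w s" "\<And>s. w s \<le> t"
  shows "load w \<phi> a (a + n) v \<le> n * t"
proof -
  have "load w \<phi> a (a + n) v \<le> (\<Sum>s\<in>{a..<a + n}. w s)"
    unfolding load_def using assms by (intro sum_mono2) auto
  also have "\<dots> \<le> (\<Sum>s\<in>{a..<a + n}. t)" by (intro sum_mono assms)
  finally show ?thesis by simp
qed

text \<open>The bound is a sum of two conditional terms, so that it remains valid when
  \<open>i = j\<close>.\<close>

lemma load_alternating:
  fixes t :: real
  assumes w: "\<And>s. \<bar>w (Suc s) - w s\<bar> \<le> 1" "\<And>s. 0 \<le> w s" "\<And>s. w s \<le> t" and L: "L \<le> 2 * t"
    and \<psi>: "\<And>k. \<psi> (b + k) = (if even k then i else j)"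
  shows "load w \<psi> b (b + L) v \<le>
    (if v = i then (\<Sum>k<L. w (b + k)) / 2 + t else 0) + (if v = j then (\<Sum>k<L. w (b + k)) / 2 + t else 0)"
proof -
  let ?E = "\<Sum>k | k < L \<and> even k. w (b + k)" and ?O = "\<Sum>k | k < L \<and> odd k. w (b + k)"
  note h = alternating_halves[where w = w, OF w L, of b]
  have nn: "0 \<le> (\<Sum>k<L. w (b + k)) / 2 + t" using w(2,3)[of 0] by (intro add_nonneg_nonneg divide_nonneg_nonneg sum_nonneg w) auto
  have "load w \<psi> b (b + L) v = (\<Sum>k | k < L \<and> \<psi> (b + k) = v. w (b + k))"
    unfolding load_def
    by (rule sum.reindex_bij_witness[of _ "\<lambda>k. b + k" "\<lambda>s. s - b"]) auto
  also have "\<dots> \<le> (if v = i then ?E else 0) + (if v = j then ?O else 0)"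
  proof -
    have "(\<Sum>k | k < L \<and> \<psi> (b + k) = v. w (b + k)) =
        (\<Sum>k\<in>{k. k < L \<and> even k \<and> v = i} \<union> {k. k < L \<and> odd k \<and> v = j}. w (b + k))"
      by (intro sum.cong) (auto simp: \<psi>)
    also have "\<dots> = (\<Sum>k | k < L \<and> even k \<and> v = i. w (b + k)) + (\<Sum>k | k < L \<and> odd k \<and> v = j. w (b + k))"
      by (intro sum.union_disjoint) auto
    also have "\<dots> = (if v = i then ?E else 0) + (if v = j then ?O else 0)" by auto
    finally show ?thesis by simp
  qed
  also have "\<dots> \<le> (if v = i then (\<Sum>k<L. w (b + k)) / 2 + t else 0) + (if v = j then (\<Sum>k<L. w (b + k)) / 2 + t else 0)"
    using h by (intro add_mono) auto
  finally show ?thesis .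
qed

text \<open>The walk visits the listed edges one after the other and oscillates along \<open>(i, j, m)\<close> until both ends have
  received the load \<open>m\<close>; as consecutive layers differ by at most one, both ends fill up at the same
  speed. The error term accounts for the connecting paths.\<close>

lemma walk_through_edges:
  fixes w :: "nat \<Rightarrow> real" and t :: real and R :: "'b \<Rightarrow> 'b \<Rightarrow> bool" and es :: "('b \<times> 'b \<times> real) list" and D T :: nat
  assumes w: "\<And>s. \<bar>w (Suc s) - w s\<bar> \<le> 1" "\<And>s. 0 \<le> w s" "\<And>s. w s \<le> t" and wpos: "\<And>s. s < T \<Longrightarrow> 0 < w s"
    and T: "T \<le> 2 * t"
    and path: "\<And>x y. x \<in> Q \<Longrightarrow> y \<in> Q \<Longrightarrow> \<exists>n\<le>D. (R ^^ n) x y"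
    and es: "\<And>i j m. (i, j, m) \<in> set es \<Longrightarrow> i \<in> Q \<and> j \<in> Q \<and> R i j \<and> R j i \<and> 0 \<le> m"
    and total: "s0 \<le> T" "(\<Sum>s\<in>{s0..<T}. w s) \<le> (\<Sum>(i, j, m)\<leftarrow>es. 2 * m)" and a: "a \<in> Q"
  shows "\<exists>\<phi>. \<phi> s0 = a \<and> (\<forall>s. s0 \<le> s \<longrightarrow> Suc s < T \<longrightarrow> R (\<phi> s) (\<phi> (Suc s))) \<and>
    (\<forall>v. load w \<phi> s0 T v \<le> (\<Sum>(i, j, m)\<leftarrow>es. (if v = i then m else 0) + (if v = j then m else 0))
        + length es * ((D + 4) * t))"
  using es total a
proof (induction es arbitrary: s0 a)
  case Nil
  \<comment> \<open>The capacity is exhausted and all weights are positive, so no layers are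
    left.\<close>
  have "s0 = T"
  proof (rule ccontr)
    assume "s0 \<noteq> T"
    then have "0 < w s0" "w s0 \<le> (\<Sum>s\<in>{s0..<T}. w s)" using wpos[of s0] Nil(2) w(2) by (auto intro!: member_le_sum)
    then show False using Nil(3) by simp
  qed
  moreover have "load w \<phi> T T v = 0" for \<phi> :: "nat \<Rightarrow> 'b" and v
    unfolding load_def by (intro sum.neutral) auto
  ultimately show ?case by (intro exI[of _ "\<lambda>_. a"]) auto
next
  case (Cons e es)
  obtain i j m where e: "e = (i, j, m)" by (cases e) auto
  have ij: "i \<in> Q" "j \<in> Q" "R i j" "R j i" "0 \<le> m" using Cons.prems(1)[of i j m] e by auto
  have t0: "0 \<le> t" using w(2,3)[of 0] by linarith
  obtain n where n: "n \<le> D" "(R ^^ n) a i" using path[OF Cons.prems(4) ij(1)] by blast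
  obtain p where p: "p 0 = a" "p n = i" "\<And>k. k < n \<Longrightarrow> R (p k) (p (Suc k))"
    using n(2) by (auto simp: relpowp_fun_conv)
  define b where "b = s0 + n"
  \<comment> \<open>A path from \<open>a\<close> to \<open>i\<close>, followed by an oscillation
    that starts in \<open>i\<close> at time \<open>b\<close>.\<close>
  define \<psi> where "\<psi> s = (if s < b then p (s - s0) else if even (s - b) then i else j)" for s
  have \<psi>0: "\<psi> s0 = a" using p by (auto simp: \<psi>_def b_def)
  have \<psi>R: "R (\<psi> s) (\<psi> (Suc s))" if "s0 \<le> s" for s
  proof (cases "Suc s < b")
    case True
    then show ?thesis using that p(3)[of "s - s0"] by (simp add: \<psi>_def b_def Suc_diff_le)
  next
    case False
    show ?thesis
    proof (cases "Suc s = b")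
      case True
      then have "Suc s - s0 = n" "s - s0 < n" using that by (auto simp: b_def)
      then show ?thesis using True that p(2) p(3)[of "s - s0"] by (auto simp: \<psi>_def Suc_diff_le)
    next
      case False
      then have "b \<le> s" using \<open>\<not> Suc s < b\<close> by simp
      then show ?thesis using ij by (auto simp: \<psi>_def Suc_diff_le)
    qed
  qed
  have \<psi>Q: "\<psi> s \<in> Q" if "b \<le> s" for s using that ij by (auto simp: \<psi>_def)
  \<comment> \<open>Each end receives half of at most \<open>2 * m + t\<close> and the alternation
    error \<open>t\<close>, hence at most \<open>m + 2 * t\<close>. Both ends together with a path
    of at most \<open>D\<close> layers give the error \<open>(D + 4) * t\<close>.\<close>
  have seg: "load w \<psi> s0 (b + L) v \<le> (if v = i then m else 0) + (if v = j then m else 0) + (D + 4) * t"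
    if L: "b + L \<le> T" and W: "(\<Sum>k<L. w (b + k)) \<le> 2 * m + t" for L v
  proof -
    have "load w \<psi> s0 b v \<le> n * t" unfolding b_def by (rule load_le[where w = w, OF w(2,3)])
    also have "\<dots> \<le> D * t" using n t0 by (intro mult_right_mono) auto
    finally have 1: "load w \<psi> s0 b v \<le> D * t" .
    have "load w \<psi> b (b + L) v \<le> (if v = i then (\<Sum>k<L. w (b + k)) / 2 + t else 0) + (if v = j then (\<Sum>k<L. w (b + k)) / 2 + t else 0)"
      by (rule load_alternating[where w = w, OF w]) (use L T in \<open>auto simp: \<psi>_def\<close>)
    also have "\<dots> \<le> (if v = i then m + 2 * t else 0) + (if v = j then m + 2 * t else 0)"
      using W t0 by (intro add_mono) (auto simp: field_simps)
    also have "\<dots> \<le> (if v = i then m else 0) + (if v = j then m else 0) + 4 * t" using t0 by auto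
    finally have 2: "load w \<psi> b (b + L) v \<le> (if v = i then m else 0) + (if v = j then m else 0) + 4 * t" .
    have "load w \<psi> s0 (b + L) v = load w \<psi> s0 b v + load w \<psi> b (b + L) v"
      by (rule load_split) (auto simp: b_def)
    also have "\<dots> \<le> D * t + ((if v = i then m else 0) + (if v = j then m else 0) + 4 * t)"
      using 1 2 by (rule add_mono)
    also have "\<dots> = (if v = i then m else 0) + (if v = j then m else 0) + (D + 4) * t" by (simp add: algebra_simps)
    finally show ?thesis .
  qed
  let ?g = "\<lambda>v es. (\<Sum>(i, j, m)\<leftarrow>es. (if v = i then m else 0) + (if v = j then m else 0))"
  have "0 \<le> m'" if "(i', j', m') \<in> set es" for i' j' m' using Cons.prems(1)[of i' j' m'] that by simp
  then have g0: "0 \<le> ?g v es" for v by (intro sum_list_nonneg) (auto split: if_splits)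
  have len: "length (e # es) * ((D + 4) * t) = (D + 4) * t + length es * ((D + 4) * t)" by (simp add: algebra_simps)
  have gc: "?g v (e # es) = (if v = i then m else 0) + (if v = j then m else 0) + ?g v es" for v by (simp add: e)
  show ?case
  proof (cases "\<exists>L. b + L \<le> T \<and> 2 * m < (\<Sum>k<L. w (b + k))")
    case False
    \<comment> \<open>The weight never exceeds \<open>2 * m\<close> up to time \<open>T\<close>, so
      the walk stays with this edge until the end; it may even end on the connecting path.\<close>
    have "load w \<psi> s0 T v \<le> ?g v (e # es) + length (e # es) * ((D + 4) * t)" for v
    proof (cases "b \<le> T")
      case True
      have "load w \<psi> s0 (b + (T - b)) v \<le> (if v = i then m else 0) + (if v = j then m else 0) + (D + 4) * t"
      proof (rule seg)
        have "\<not> 2 * m < (\<Sum>k<T - b. w (b + k))" using False True by auto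
        then show "(\<Sum>k<T - b. w (b + k)) \<le> 2 * m + t" using t0 by linarith
      qed (use True in simp)
      moreover have "0 \<le> length es * ((D + 4) * t)" using t0 by simp
      ultimately show ?thesis unfolding gc len using g0[of v] True by simp
    next
      case bT: False
      have "load w \<psi> s0 T v \<le> load w \<psi> s0 (s0 + n) v" using bT by (intro load_mono w) (simp add: b_def)
      also have "\<dots> \<le> n * t" by (rule load_le[where w = w, OF w(2,3)])
      also have "\<dots> \<le> (D + 4) * t" using n t0 by (intro mult_right_mono) auto
      finally have "load w \<psi> s0 T v \<le> (D + 4) * t" .
      moreover have "0 \<le> length es * ((D + 4) * t)" using t0 by simp
      ultimately show ?thesis unfolding gc len using g0[of v] ij(5) by auto
    qed
    then show ?thesis using \<psi>0 \<psi>R by (intro exI[of _ \<psi>]) auto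
  next
    case True
    \<comment> \<open>Stopping at the first excess over \<open>2 * m\<close> overshoots by at most
      one layer, and enough weight has been spent for the rest to fit the remaining edges.\<close>
    define L where "L = (LEAST L. b + L \<le> T \<and> 2 * m < (\<Sum>k<L. w (b + k)))"
    have L: "b + L \<le> T" "2 * m < (\<Sum>k<L. w (b + k))" using LeastI_ex[OF True] by (auto simp: L_def)
    obtain l where l: "L = Suc l" using L(2) ij(5) by (cases L) auto
    have "\<not> 2 * m < (\<Sum>k<l. w (b + k))" 
      using not_less_Least[of l "\<lambda>L. b + L \<le> T \<and> 2 * m < (\<Sum>k<L. w (b + k))"] L(1) l unfolding L_def by auto
    then have W: "(\<Sum>k<L. w (b + k)) \<le> 2 * m + t" using w(3)[of "b + l"] unfolding l by simp
    define s1 where "s1 = b + L"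
    have "(\<Sum>s\<in>{s0..<T}. w s) = (\<Sum>s\<in>{s0..<b}. w s) + (\<Sum>s\<in>{b..<s1}. w s) + (\<Sum>s\<in>{s1..<T}. w s)"
      using L(1) by (simp add: sum.atLeastLessThan_concat b_def s1_def)
    moreover have "(\<Sum>s\<in>{b..<s1}. w s) = (\<Sum>k<L. w (b + k))"
      unfolding s1_def using sum.shift_bounds_nat_ivl[of w 0 b L] by (simp add: atLeast0LessThan add.commute)
    moreover have "0 \<le> (\<Sum>s\<in>{s0..<b}. w s)" by (intro sum_nonneg w)
    ultimately have "(\<Sum>s\<in>{s1..<T}. w s) \<le> (\<Sum>(i, j, m)\<leftarrow>es. 2 * m)"
      using Cons.prems(3) L(2) by (simp add: e)
    then obtain \<phi> where \<phi>: "\<phi> s1 = \<psi> s1" "\<And>s. s1 \<le> s \<Longrightarrow> Suc s < T \<Longrightarrow> R (\<phi> s) (\<phi> (Suc s))"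
      "\<And>v. load w \<phi> s1 T v \<le> ?g v es + length es * ((D + 4) * t)"
      using Cons.IH[of s1 "\<psi> s1"] Cons.prems(1) L(1) \<psi>Q[of s1] by (auto simp: s1_def)
    define \<theta> where "\<theta> s = (if s < s1 then \<psi> s else \<phi> s)" for s
    have "s0 < s1" using l by (simp add: s1_def b_def)
    then have "\<theta> s0 = a" using \<psi>0 by (simp add: \<theta>_def)
    moreover have "R (\<theta> s) (\<theta> (Suc s))" if s: "s0 \<le> s" "Suc s < T" for s
      using \<psi>R[OF s(1)] \<phi>(2)[OF _ s(2)] \<phi>(1) by (cases "Suc s = s1") (auto simp: \<theta>_def)
    moreover have "load w \<theta> s0 T v \<le> ?g v (e # es) + length (e # es) * ((D + 4) * t)" for v
    proof -
      have "load w \<theta> s0 T v = load w \<theta> s0 s1 v + load w \<theta> s1 T v"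
        using \<open>s0 < s1\<close> L(1) by (intro load_split) (auto simp: s1_def)
      also have "load w \<theta> s0 s1 v = load w \<psi> s0 s1 v" by (intro load_cong) (auto simp: \<theta>_def)
      also have "load w \<theta> s1 T v = load w \<phi> s1 T v" by (intro load_cong) (auto simp: \<theta>_def)
      finally show ?thesis unfolding gc len using seg[OF L(1) W, of v] \<phi>(3)[of v] by (simp add: s1_def)
    qed
    ultimately show ?thesis by blast
  qed
qed

section \<open>The reduced structure of a colouring\<close>

definition edge_ind :: "(nat set \<Rightarrow> colour) \<Rightarrow> colour \<Rightarrow> nat \<times> nat \<Rightarrow> real" where
  "edge_ind c k = (\<lambda>(x, y). if c {x, y} = k then 1 else 0)"

text \<open>The only consequence of regularity that the embedding uses. The roles of
  \<open>A\<close> and \<open>B\<close> differ, so links between clusters ask for it in both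
  directions.\<close>

definition dense_pair :: "real \<Rightarrow> (nat set \<Rightarrow> colour) \<Rightarrow> colour \<Rightarrow> nat set \<Rightarrow> nat set \<Rightarrow> bool" where
  "dense_pair \<epsilon> c k A B \<longleftrightarrow> (\<forall>B'\<subseteq>B. \<epsilon> * real (card B) \<le> real (card B') \<longrightarrow>
     real (card {a \<in> A. 4 * card ({b. c {a, b} = k} \<inter> B') < card B'}) < \<epsilon> * real (card A))"

lemma edge_density_edge_ind_sym: "edge_density (edge_ind c k) B A = edge_density (edge_ind c k) A B"
proof -
  have "(\<Sum>z\<in>B \<times> A. edge_ind c k z) = (\<Sum>z\<in>A \<times> B. edge_ind c k z)"
    by (rule sum.reindex_bij_witness[of _ prod.swap prod.swap]) (auto simp: edge_ind_def insert_commute)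
  then show ?thesis by (simp add: edge_density_def mult.commute)
qed

lemma irregular_edge_ind_sym:
  assumes "irregular (edge_ind c k) \<epsilon> A B"
  shows "irregular (edge_ind c k) \<epsilon> B A"
proof -
  obtain A' B' where "A' \<subseteq> A" "B' \<subseteq> B" "\<epsilon> * card A \<le> card A'" "\<epsilon> * card B \<le> card B'"
    "\<epsilon> \<le> \<bar>edge_density (edge_ind c k) A' B' - edge_density (edge_ind c k) A B\<bar>"
    using assms by (auto simp: irregular_def)
  then show ?thesis
    unfolding irregular_def edge_density_edge_ind_sym[of c k B A]
    using edge_density_edge_ind_sym[of c k B' A'] by metis
qed

lemma edge_density_edge_ind_other:
  assumes "finite A" "finite B" "A \<noteq> {}" "B \<noteq> {}"
  shows "edge_density (edge_ind c (other k)) A B = 1 - edge_density (edge_ind c k) A B"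
proof -
  have "edge_ind c (other k) z = 1 - edge_ind c k z" for z
    by (cases k; cases "c {fst z, snd z}"; cases z) (auto simp: edge_ind_def)
  then have "(\<Sum>z\<in>A \<times> B. edge_ind c (other k) z) = card A * card B - (\<Sum>z\<in>A \<times> B. edge_ind c k z)"
    by (simp add: sum_subtractf card_cartesian_product)
  then show ?thesis using assms by (simp add: edge_density_def diff_divide_distrib card_gt_0_iff)
qed

text \<open>On nonempty sets the densities of the two colours add up to one, so a deviation in one
  colour is the opposite deviation in the other. Regularising red therefore serves both
  colours.\<close>

lemma irregular_edge_ind_other:
  fixes \<epsilon> :: real
  assumes fin: "finite A" "finite B" "A \<noteq> {}" "B \<noteq> {}" and \<epsilon>: "0 < \<epsilon>"
    and irr: "irregular (edge_ind c (other k)) \<epsilon> A B"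
  shows "irregular (edge_ind c k) \<epsilon> A B"
proof -
  obtain A' B' where AB: "A' \<subseteq> A" "B' \<subseteq> B" "\<epsilon> * card A \<le> card A'" "\<epsilon> * card B \<le> card B'"
    "\<epsilon> \<le> \<bar>edge_density (edge_ind c (other k)) A' B' - edge_density (edge_ind c (other k)) A B\<bar>"
    using irr by (auto simp: irregular_def)
  have "0 < \<epsilon> * card A" "0 < \<epsilon> * card B" using fin \<epsilon> by (auto simp: card_gt_0_iff)
  then have "A' \<noteq> {}" "B' \<noteq> {}" using AB(3,4) by auto
  moreover have "finite A'" "finite B'" using AB fin finite_subset by auto
  ultimately have "\<epsilon> \<le> \<bar>edge_density (edge_ind c k) A' B' - edge_density (edge_ind c k) A B\<bar>"
    using AB(5) fin by (simp add: edge_density_edge_ind_other abs_minus_commute)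
  then show ?thesis unfolding irregular_def using AB by blast
qed

text \<open>If the exceptional vertices made up a proportion \<epsilon> of \<open>A\<close>, then
  they and \<open>B'\<close> would have density at most 1/4, a deviation of at least 1/4 from the
  density of the whole pair, against regularity.\<close>

lemma regular_imp_dense_pair:
  fixes \<epsilon> :: real
  assumes fin: "finite A" "finite B" "A \<noteq> {}" "B \<noteq> {}" and \<epsilon>: "0 < \<epsilon>" "\<epsilon> \<le> 1 / 4"
    and reg: "\<not> irregular (edge_ind c k) \<epsilon> A B" and d: "1 / 2 \<le> edge_density (edge_ind c k) A B"
  shows "dense_pair \<epsilon> c k A B"
  unfolding dense_pair_def
proof (intro allI impI)
  fix B' assume B': "B' \<subseteq> B" "\<epsilon> * card B \<le> card B'"
  let ?A = "{a \<in> A. 4 * card ({b. c {a, b} = k} \<inter> B') < card B'}"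
  show "card ?A < \<epsilon> * card A"
  proof (rule ccontr)
    assume "\<not> ?thesis"
    then have A': "\<epsilon> * card A \<le> card ?A" by simp
    have finB': "finite B'" using B' fin finite_subset by auto
    have finA': "finite ?A" using fin by simp
    have "0 < \<epsilon> * card A" "0 < \<epsilon> * card B" using fin \<epsilon> by (auto simp: card_gt_0_iff)
    then have pos: "0 < card ?A" "0 < card B'" using A' B'(2) by linarith+
    have sum_nb: "(\<Sum>b\<in>B'. edge_ind c k (a, b)) = card ({b. c {a, b} = k} \<inter> B')" for a
    proof -
      have "(\<Sum>b\<in>B'. edge_ind c k (a, b)) = (\<Sum>b\<in>B' \<inter> {b. c {a, b} = k}. 1)"
        unfolding sum.inter_restrict[OF finB'] by (intro sum.cong) (auto simp: edge_ind_def)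
      also have "\<dots> = card (B' \<inter> {b. c {a, b} = k})" by simp
      finally show ?thesis by (simp add: Int_commute)
    qed
    have "(\<Sum>z\<in>?A \<times> B'. edge_ind c k z) = (\<Sum>a\<in>?A. real (card ({b. c {a, b} = k} \<inter> B')))"
      by (simp add: sum.cartesian_product' sum_nb)
    also have "\<dots> \<le> (\<Sum>a\<in>?A. card B' / 4)" by (intro sum_mono) auto
    finally have "edge_density (edge_ind c k) ?A B' \<le> 1 / 4"
      using pos by (simp add: edge_density_def field_simps)
    moreover have "\<bar>edge_density (edge_ind c k) ?A B' - edge_density (edge_ind c k) A B\<bar> < \<epsilon>"
    proof (rule ccontr)
      assume "\<not> ?thesis"
      then have "irregular (edge_ind c k) \<epsilon> A B"
        unfolding irregular_def using A' B' by (intro exI[of _ ?A] exI[of _ B'] conjI) auto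
      then show False using reg by simp
    qed
    ultimately show False using d \<epsilon>(2) by linarith
  qed
qed

section \<open>From a regular partition to clusters and a matching\<close>

lemma card_small_atoms:
  fixes b :: real
  assumes V: "finite V" and F: "finite \<F>" and b: "0 \<le> b"
  shows "card {x \<in> V. card (atom V \<F> x) < b} \<le> 2 ^ card \<F> * b"
proof -
  let ?S = "{x \<in> V. card (atom V \<F> x) < b}"
  have "?S \<subseteq> \<Union>(atom V \<F> ` ?S)" using atom_self by fastforce
  moreover have fin: "finite (atom V \<F> ` ?S)" using V by simp
  ultimately have "card ?S \<le> card (\<Union>(atom V \<F> ` ?S))"
    using V by (intro card_mono) (auto simp: atom_def)
  also have "\<dots> \<le> (\<Sum>A\<in>atom V \<F> ` ?S. card A)" by (rule card_Union_le_sum_card) 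
  finally have "real (card ?S) \<le> (\<Sum>A\<in>atom V \<F> ` ?S. real (card A))" 
    by (simp flip: of_nat_sum)
  also have "\<dots> \<le> (\<Sum>A\<in>atom V \<F> ` ?S. b)" by (intro sum_mono) auto
  also have "\<dots> = card (atom V \<F> ` ?S) * b" by simp
  also have "\<dots> \<le> 2 ^ card \<F> * b"
  proof (rule mult_right_mono[OF _ b])
    have "card (atom V \<F> ` ?S) \<le> card (atom V \<F> ` V)" using V by (intro card_mono) auto
    then have "card (atom V \<F> ` ?S) \<le> 2 ^ card \<F>" using card_atoms(2)[OF F, of V] by linarith
    then show "real (card (atom V \<F> ` ?S)) \<le> 2 ^ card \<F>" by (metis of_nat_le_numeral_power_cancel_iff)
  qed
  finally show ?thesis .
qed

text \<open>Markov's inequality: more than \<open>e\<close> heavy vertices would account for more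
  than \<open>e * d\<close> pairs of \<open>I\<close>.\<close>

lemma card_heavy_le:
  fixes I :: "('a \<times> 'b) set" and d e :: real
  assumes "finite V" "finite I" "card I \<le> e * d" and d: "0 < d"
  shows "card {x \<in> V. d < card {y. (x, y) \<in> I}} \<le> e"
proof -
  let ?H = "{x \<in> V. d < card {y. (x, y) \<in> I}}"
  have finy: "finite {y. (x, y) \<in> I}" for x
    using finite_vimageI[OF assms(2), of "Pair x"] by (simp add: vimage_def inj_on_def)
  have "(\<Sum>x\<in>?H. d) \<le> (\<Sum>x\<in>?H. real (card {y. (x, y) \<in> I}))" by (intro sum_mono) auto
  also have "\<dots> = card (SIGMA x:?H. {y. (x, y) \<in> I})" using finy assms(1) by simp
  also have "\<dots> \<le> card I" using assms(2) by (intro of_nat_mono card_mono) auto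
  finally have "card ?H * d \<le> e * d" using assms(3) by simp
  then show ?thesis using d by simp
qed

text \<open>\<open>P\<close> consists of the clusters and \<open>cl\<close> assigns a cluster to a
  vertex, whereas \<open>M\<close> lives on vertices: how often it joins two clusters is the weight
  of that cluster pair. Connectedness, on the other hand, is stated for clusters, because the walk
  moves through them. \<open>27 * (N div 50)\<close> is 54 per cent of the vertices up to
  rounding.\<close>

definition reduced_config ::
  "(nat set \<Rightarrow> colour) \<Rightarrow> nat \<Rightarrow> nat \<Rightarrow> real \<Rightarrow> nat set set \<Rightarrow> colour \<Rightarrow> (nat \<times> nat) set \<Rightarrow> (nat \<Rightarrow> nat set) \<Rightarrow> bool"
  where
  "reduced_config c N K \<beta> P k M cl \<longleftrightarrow>
      finite P \<and> card P \<le> K \<and> disjoint P \<and> (\<forall>A\<in>P. A \<subseteq> {..<N} \<and> \<beta> * N \<le> card A) \<and>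
      matching (\<lambda>x y. dense_pair (1 / 10000) c k (cl x) (cl y) \<and> dense_pair (1 / 10000) c k (cl y) (cl x)) {..<N} M \<and>
      (\<forall>x\<in>cover M. cl x \<in> P \<and> x \<in> cl x) \<and>
      (\<forall>x\<in>cover M. \<forall>y\<in>cover M. (\<lambda>A B. A \<in> P \<and> B \<in> P \<and>
         dense_pair (1 / 10000) c k A B \<and> dense_pair (1 / 10000) c k B A)\<^sup>*\<^sup>* (cl x) (cl y)) \<and>
      27 * (N div 50) \<le> 2 * card M"

lemma reduced_structure:
  obtains K :: nat and \<beta> :: real where "0 < \<beta>"
    "\<And>N c. 400 \<le> N \<Longrightarrow> \<exists>P k M cl. reduced_config c N K \<beta> P k M cl"
proof -
  define \<epsilon> :: real where "\<epsilon> = 1 / 10000"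
  have \<epsilon>: "0 < \<epsilon>" "\<epsilon> \<le> 1 / 4" by (auto simp: \<epsilon>_def)
  obtain K where K: "\<And>V (\<F> :: nat set set) g. finite V \<Longrightarrow> finite \<F> \<Longrightarrow> card \<F> \<le> 200 \<Longrightarrow>
    (\<And>z. 0 \<le> g z) \<Longrightarrow> (\<And>z. g z \<le> 1) \<Longrightarrow>
    \<exists>\<G>. \<F> \<subseteq> \<G> \<and> finite \<G> \<and> card \<G> \<le> K \<and> card (irregular_pairs g \<epsilon> V \<G>) \<le> \<epsilon> * (card V)\<^sup>2"
    by (rule regularity_lemma[OF \<epsilon>(1), of 200]) blast
  \<comment> \<open>There are at most \<open>2 ^ K\<close> atoms, so those with fewer than
    \<open>\<beta> * N\<close> vertices contain at most \<open>\<epsilon> * N\<close> vertices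
    altogether.\<close>
  define \<beta> where "\<beta> = \<epsilon> / 2 ^ K"
  show ?thesis
  proof (rule that[of \<beta> "2 ^ K"])
    show "0 < \<beta>" using \<epsilon> by (simp add: \<beta>_def)
    fix N :: nat and c :: "nat set \<Rightarrow> colour" assume N: "400 \<le> N"
    define V where "V = {..<N}"
    have finV: "finite V" and cV: "card V = N" by (auto simp: V_def)
    \<comment> \<open>Refining a partition into 200 intervals of length \<open>h\<close> keeps the
      clusters at about N/200 vertices or less, so a vertex loses few partners to its own
      cluster.\<close>
    define h where "h = N div 200 + 1"
    have h: "0 < h" "N \<le> 200 * h" by (auto simp: h_def)
    define \<F> where "\<F> = (\<lambda>i. {x \<in> V. x div h = i}) ` {..<200}"
    have "finite \<F>" "card \<F> \<le> 200" unfolding \<F>_def using card_image_le[of "{..<200::nat}"] by auto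
    moreover have "0 \<le> edge_ind c Red z" "edge_ind c Red z \<le> 1" for z by (cases z; simp add: edge_ind_def)+
    ultimately obtain \<G> where G: "\<F> \<subseteq> \<G>" "finite \<G>" "card \<G> \<le> K"
      "card (irregular_pairs (edge_ind c Red) \<epsilon> V \<G>) \<le> \<epsilon> * (card V)\<^sup>2"
      using K[OF finV, of \<F> "edge_ind c Red"] by blast
    define cl where "cl = atom V \<G>"
    define Irr where "Irr = irregular_pairs (edge_ind c Red) \<epsilon> V \<G>"
    have finIrr: "finite Irr" using finV unfolding Irr_def irregular_pairs_def
      by (auto intro: finite_subset[of _ "V \<times> V"])
    have fin_at: "finite (cl x)" for x using finV atom_subset[of V \<G> x] finite_subset by (auto simp: cl_def)
    have ne_at: "cl x \<noteq> {}" "x \<in> cl x" if "x \<in> V" for x using that atom_self[of x V \<G>] by (auto simp: cl_def)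
    have at_le: "card (cl x) \<le> h" if x: "x \<in> V" for x
    proof -
      have "x div h < 200" using x h by (simp add: V_def div_less_iff_less_mult)
      then have F: "{y \<in> V. y div h = x div h} \<in> \<G>" using G(1) by (auto simp: \<F>_def)
      have "cl x \<subseteq> {y \<in> V. y div h = x div h}"
      proof
        fix y assume "y \<in> cl x"
        then have "cell_code \<G> y = cell_code \<G> x" by (auto simp: cl_def atom_def)
        moreover have "{y \<in> V. y div h = x div h} \<in> cell_code \<G> x" using F x by (simp add: cell_code_def)
        ultimately have "{y \<in> V. y div h = x div h} \<in> cell_code \<G> y" by (simp only:)
        then show "y \<in> {y \<in> V. y div h = x div h}" by (simp add: cell_code_def)
      qed
      also have "\<dots> \<subseteq> {h * (x div h)..<h * (x div h) + h}"
      proof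
        fix y assume "y \<in> {y \<in> V. y div h = x div h}"
        then have "h * (x div h) + y mod h = y" using mult_div_mod_eq[of h y] by simp
        moreover have "y mod h < h" using h(1) by simp
        ultimately show "y \<in> {h * (x div h)..<h * (x div h) + h}" by simp
      qed
      finally show ?thesis using card_mono[of "{h * (x div h)..<h * (x div h) + h}" "cl x"] by simp
    qed
    define small where "small = {x \<in> V. card (cl x) < \<beta> * N}"
    \<comment> \<open>Since \<epsilon> is the square of 1/100, at most N/100 vertices have more than
      N/100 irregular partners.\<close>
    define heavy where "heavy = {x \<in> V. N / 100 < card {y. (x, y) \<in> Irr}}"
    define V' where "V' = V - (small \<union> heavy)"
    have "card small \<le> 2 ^ card \<G> * (\<beta> * N)"
      unfolding small_def cl_def by (rule card_small_atoms[OF finV G(2)]) (use \<epsilon> in \<open>simp add: \<beta>_def\<close>)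
    also have "\<dots> \<le> 2 ^ K * (\<beta> * N)" using G(3) \<epsilon> by (intro mult_right_mono power_increasing) (auto simp: \<beta>_def)
    also have "\<dots> = N / 10000" by (simp add: \<beta>_def \<epsilon>_def)
    finally have small: "card small \<le> N / 10000" .
    have heavy: "card heavy \<le> N / 100"
      unfolding heavy_def using finV finIrr G(4) N
      by (intro card_heavy_le) (auto simp: Irr_def cV \<epsilon>_def power2_eq_square)
    have "card (small \<union> heavy) \<le> card small + card heavy" by (rule card_Un_le)
    moreover have "card V' = N - card (small \<union> heavy)"
      unfolding V'_def cV[symmetric] using finV by (intro card_Diff_subset) (auto simp: small_def heavy_def)
    ultimately have cV': "49 * (N div 50) \<le> card V'" using small heavy by linarith
    have V'V: "V' \<subseteq> V" by (auto simp: V'_def)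
    \<comment> \<open>The reduced graph blown up to the vertices: adjacency depends only on the
      clusters, and pairs inside one cluster count as missing.\<close>
    define R where "R k x y \<longleftrightarrow> cl x \<noteq> cl y \<and> \<not> irregular (edge_ind c Red) \<epsilon> (cl x) (cl y) \<and>
      1 / 2 \<le> edge_density (edge_ind c k) (cl x) (cl y)" for k x y
    interpret near_complete R V' "N div 50"
    proof
      show "finite V'" using finV by (simp add: V'_def)
      show "R k y x" if "R k x y" for k x y
        using that irregular_edge_ind_sym[of c Red \<epsilon> "cl y" "cl x"] edge_density_edge_ind_sym[of c k "cl x" "cl y"]
        by (auto simp: R_def)
      show "\<not> R k x x" for k x by (simp add: R_def)
      \<comment> \<open>The own cluster has at most N/200 + 1 vertices and there are at most N/100
        irregular partners; \<open>400 \<le> N\<close> makes the sum fit into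
        \<open>N div 50\<close>.\<close>
      show "card {y \<in> V'. \<not> R Red x y \<and> \<not> R Blue x y} \<le> N div 50" if x: "x \<in> V'" for x
      proof -
        have "{y \<in> V'. \<not> R Red x y \<and> \<not> R Blue x y} \<subseteq> cl x \<union> {y. (x, y) \<in> Irr}"
        proof
          fix y assume y: "y \<in> {y \<in> V'. \<not> R Red x y \<and> \<not> R Blue x y}"
          have xy: "x \<in> V" "y \<in> V" using x y V'V by auto
          show "y \<in> cl x \<union> {y. (x, y) \<in> Irr}"
          proof (cases "cl x = cl y \<or> (x, y) \<in> Irr")
            case True
            then show ?thesis using ne_at(2)[OF xy(2)] by auto
          next
            case False
            then have "\<not> irregular (edge_ind c Red) \<epsilon> (cl x) (cl y)"
              using xy by (simp add: Irr_def irregular_pairs_def cl_def)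
            moreover have "edge_density (edge_ind c Blue) (cl x) (cl y) = 1 - edge_density (edge_ind c Red) (cl x) (cl y)"
              using edge_density_edge_ind_other[of "cl x" "cl y" c Red] fin_at ne_at xy by simp
            ultimately show ?thesis using y False by (auto simp: R_def)
          qed
        qed
        moreover have finy: "finite {y. (x, y) \<in> Irr}"
          using finite_vimageI[OF finIrr, of "Pair x"] by (simp add: vimage_def inj_on_def)
        ultimately have "card {y \<in> V'. \<not> R Red x y \<and> \<not> R Blue x y} \<le> card (cl x \<union> {y. (x, y) \<in> Irr})"
          using fin_at by (intro card_mono) auto
        also have "\<dots> \<le> card (cl x) + card {y. (x, y) \<in> Irr}" by (rule card_Un_le)
        finally have "card {y \<in> V'. \<not> R Red x y \<and> \<not> R Blue x y} \<le> h + card {y. (x, y) \<in> Irr}"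
          using at_le[of x] x V'V by force
        moreover have "card {y. (x, y) \<in> Irr} \<le> N / 100" using x by (auto simp: V'_def heavy_def)
        ultimately show ?thesis using N unfolding h_def by linarith
      qed
      show "49 * (N div 50) \<le> card V'" by (rule cV')
      show "4 \<le> N div 50" using N by linarith
    qed
    obtain k M where M: "matching (R k) V' M" "27 * (N div 50) \<le> 2 * card M"
      "\<And>x y. x \<in> cover M \<Longrightarrow> y \<in> cover M \<Longrightarrow> joined (R k) V' x y"
      by (rule connected_matching) blast
    have dp: "dense_pair \<epsilon> c k (cl x) (cl y)" if "R k x y" "x \<in> V" "y \<in> V" for x y
    proof (rule regular_imp_dense_pair[OF fin_at fin_at _ _ \<epsilon>])
      show "\<not> irregular (edge_ind c k) \<epsilon> (cl x) (cl y)"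
      proof (cases k)
        case Red
        then show ?thesis using that by (simp add: R_def)
      next
        case Blue
        then show ?thesis using that irregular_edge_ind_other[of "cl x" "cl y" \<epsilon> c Red] fin_at ne_at \<epsilon>(1)
          by (auto simp: R_def)
      qed
    qed (use that ne_at in \<open>auto simp: R_def\<close>)
    have dp2: "dense_pair \<epsilon> c k (cl x) (cl y) \<and> dense_pair \<epsilon> c k (cl y) (cl x)"
      if "R k x y" "x \<in> V" "y \<in> V" for x y using that dp sym by blast
    define P where "P = cl ` V'"
    define link where "link A B \<longleftrightarrow> A \<in> P \<and> B \<in> P \<and> dense_pair \<epsilon> c k A B \<and> dense_pair \<epsilon> c k B A" for A B
    have con: "link\<^sup>*\<^sup>* (cl x) (cl y)" if "joined (R k) V' x y" for x y
      using that unfolding joined_def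
    proof induction
      case (step y z)
      then have "link (cl y) (cl z)" using dp2[of y z] V'V by (auto simp: link_def P_def)
      then show ?case using step by (meson rtranclp.rtrancl_into_rtrancl)
    qed simp
    have covV': "cover M \<subseteq> V'" using cover_subset[OF M(1)] .
    have "finite P" using finV by (simp add: P_def V'_def)
    moreover have "card P \<le> 2 ^ K"
    proof -
      have "card P \<le> card (atom V \<G> ` V)" unfolding P_def cl_def using finV V'V by (intro card_mono) auto
      also have "\<dots> \<le> 2 ^ card \<G>" by (rule card_atoms[OF G(2)])
      also have "\<dots> \<le> 2 ^ K" using G(3) by (intro power_increasing) auto
      finally show ?thesis .
    qed
    moreover have "disjoint P"
    proof (rule disjointI)
      fix A B assume "A \<in> P" "B \<in> P" "A \<noteq> B"
      then show "A \<inter> B = {}" by (auto simp: P_def cl_def atom_def)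
    qed
    moreover have "A \<subseteq> {..<N} \<and> \<beta> * N \<le> card A" if "A \<in> P" for A
      using that atom_subset[of V \<G>] by (fastforce simp: P_def cl_def V'_def V_def small_def)
    moreover have "matching (\<lambda>x y. dense_pair \<epsilon> c k (cl x) (cl y) \<and> dense_pair \<epsilon> c k (cl y) (cl x)) {..<N} M"
      using M(1) dp2 V'V unfolding matching_def V_def by fast
    moreover have "\<forall>x\<in>cover M. cl x \<in> P \<and> x \<in> cl x" using covV' V'V ne_at by (auto simp: P_def)
    moreover have "\<forall>x\<in>cover M. \<forall>y\<in>cover M. link\<^sup>*\<^sup>* (cl x) (cl y)" using con M(3) by blast
    ultimately have "reduced_config c N (2 ^ K) \<beta> P k M cl"
      unfolding link_def[abs_def] \<epsilon>_def reduced_config_def using M(2) by blast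
    then show "\<exists>P k M cl. reduced_config c N (2 ^ K) \<beta> P k M cl" by blast
  qed
qed

section \<open>Monochromatic grids\<close>

text \<open>The grid is a strip whose layers are its antidiagonals, indexed by the first coordinate.\<close>

definition antidiag :: "nat \<Rightarrow> nat \<Rightarrow> nat set" where
  "antidiag t s = {i. i < t \<and> i \<le> s \<and> s - i < t}"

lemma antidiag_eq: "antidiag t s = {Suc s - t..<min (Suc s) t}"
  by (auto simp: antidiag_def)

lemma finite_antidiag: "finite (antidiag t s)" by (simp add: antidiag_eq)

lemma card_antidiag: "card (antidiag t s) = min (Suc s) t - (Suc s - t)"
  by (simp add: antidiag_eq)

lemma sum_card_antidiag: "(\<Sum>s\<in>{0..<2 * t - 1}. card (antidiag t s)) = t * t"
proof -
  have "(\<Sum>s\<in>{0..<2 * t - 1}. card (antidiag t s)) = card (SIGMA s:{0..<2 * t - 1}. antidiag t s)"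
    by (simp add: finite_antidiag)
  also have "\<dots> = card ({..<t} \<times> {..<t})"
    by (rule bij_betw_same_card[of "\<lambda>(s, i). (i, s - i)"],
        rule bij_betwI[where g = "\<lambda>(x, y). (x + y, x)"]) (auto simp: antidiag_def)
  finally show ?thesis by simp
qed

lemma mono_grid:
  obtains t0 :: nat where "\<And>t (c :: nat set \<Rightarrow> colour). t0 \<le> t \<Longrightarrow> \<exists>F k. inj_on F ({..<t} \<times> {..<t}) \<and>
    F ` ({..<t} \<times> {..<t}) \<subseteq> {..<2 * t * (t - 1)} \<and>
    (\<forall>x y. Suc x < t \<longrightarrow> y < t \<longrightarrow> c {F (x, y), F (Suc x, y)} = k) \<and>
    (\<forall>x y. x < t \<longrightarrow> Suc y < t \<longrightarrow> c {F (x, y), F (x, Suc y)} = k)"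
proof -
  obtain K :: nat and \<beta> :: real where \<beta>: "0 < \<beta>" and reduced:
    "\<And>N c. 400 \<le> N \<Longrightarrow> \<exists>P k M cl. reduced_config c N K \<beta> P k M cl"
    by (rule reduced_structure) (rule that; assumption)
  \<comment> \<open>The walk visits at most \<open>K * K\<close> cluster pairs with an error of
    \<open>(K * K + 4) * t\<close> each; the summand 2000 makes the terms in \<open>t\<close>
    negligible for the strip embedding.\<close>
  define C :: real where "C = K * K * (K * K + 4) + 2000"
  \<comment> \<open>As \<open>N = 2 * t * (t - 1)\<close>, the quotient ensures
    \<open>C * t \<le> 1 / 50 * (\<beta> * N)\<close>. The summand 201 lets the quadratic surplus of
    capacity outweigh its linear loss.\<close>
  obtain t0 :: nat where t0: "C / (\<beta> / 25) + 201 \<le> t0" using real_arch_simple by blast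
  show ?thesis
  proof (rule that[of t0])
    fix t :: nat and c :: "nat set \<Rightarrow> colour" assume "t0 \<le> t"
    then have t: "C / (\<beta> / 25) + 201 \<le> t" using t0 by linarith
    have C0: "0 \<le> C" by (simp add: C_def)
    then have t200: "201 \<le> t" using t \<beta> divide_nonneg_pos[of C "\<beta> / 25"] by linarith
    define N where "N = 2 * t * (t - 1)"
    have rN: "real N = 2 * real t * (real t - 1)" using t200 by (simp add: N_def of_nat_diff)
    have N400: "400 \<le> N"
    proof -
      have "2 * 201 * 200 \<le> N" unfolding N_def using t200 by (intro mult_mono) auto
      then show ?thesis by simp
    qed
    have Ct: "C * t \<le> 1 / 50 * (\<beta> * N)"
    proof -
      have "C / (\<beta> / 25) \<le> real t - 1" using t by linarith
      then have "C \<le> (real t - 1) * (\<beta> / 25)" using \<beta> by (simp add: pos_divide_le_eq)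
      then have "C * t \<le> (real t - 1) * (\<beta> / 25) * t" by (intro mult_right_mono) auto
      also have "\<dots> = 1 / 50 * (\<beta> * N)" by (simp add: rN)
      finally show ?thesis .
    qed
    obtain P k M cl where rc: "reduced_config c N K \<beta> P k M cl" using reduced[OF N400, of c] by blast
    have P: "finite P" "card P \<le> K" "disjoint P" "\<And>A. A \<in> P \<Longrightarrow> A \<subseteq> {..<N}"
        "\<And>A. A \<in> P \<Longrightarrow> \<beta> * N \<le> card A"
      and M: "matching (\<lambda>x y. dense_pair (1 / 10000) c k (cl x) (cl y) \<and> dense_pair (1 / 10000) c k (cl y) (cl x)) {..<N} M"
      and cov: "\<And>x. x \<in> cover M \<Longrightarrow> cl x \<in> P" "\<And>x. x \<in> cover M \<Longrightarrow> x \<in> cl x"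
      and con: "\<And>x y. x \<in> cover M \<Longrightarrow> y \<in> cover M \<Longrightarrow> (\<lambda>A B. A \<in> P \<and> B \<in> P \<and>
         dense_pair (1 / 10000) c k A B \<and> dense_pair (1 / 10000) c k B A)\<^sup>*\<^sup>* (cl x) (cl y)"
      and cM: "27 * (N div 50) \<le> 2 * card M"
      using rc unfolding reduced_config_def by blast+
    define link where "link A B \<longleftrightarrow> A \<in> P \<and> B \<in> P \<and>
         dense_pair (1 / 10000) c k A B \<and> dense_pair (1 / 10000) c k B A" for A B
    have finM: "finite M" using matching_finite[OF M] by simp
    have fst_snd: "inj_on fst M" "inj_on snd M" "fst ` M \<inter> snd ` M = {}" using M by (auto simp: matching_def)
    have in_cov: "fst p \<in> cover M" "snd p \<in> cover M" if "p \<in> M" for p using that by (auto simp: cover_def)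
    have finP: "finite A" if "A \<in> P" for A using P(4)[OF that] finite_subset by blast
    define \<pi> where "\<pi> p = (cl (fst p), cl (snd p))" for p :: "nat \<times> nat"
    \<comment> \<open>On each side, a cluster pair may receive 24/25 of the number of matching edges
      between its two clusters.\<close>
    define m :: "nat set \<times> nat set \<Rightarrow> real" where "m e = 24 / 25 * card {p \<in> M. \<pi> p = e}" for e
    obtain ps where ps: "set ps = \<pi> ` M" "distinct ps" using finite_distinct_list[of "\<pi> ` M"] finM by auto
    define es where "es = map (\<lambda>e. (fst e, snd e, m e)) ps"
    have len: "length es \<le> K * K"
    proof -
      have "length es = card (\<pi> ` M)" using ps by (simp add: es_def distinct_card[symmetric])
      also have "\<dots> \<le> card (P \<times> P)" using P(1) cov(1) in_cov by (intro card_mono) (auto simp: \<pi>_def)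
      also have "\<dots> \<le> K * K" using P(2) by (simp add: card_cartesian_product mult_mono)
      finally show ?thesis .
    qed
    have sum_es: "(\<Sum>(i, j, m)\<leftarrow>es. h i j * m) = 24 / 25 * (\<Sum>p\<in>M. h (cl (fst p)) (cl (snd p)))"
      for h :: "nat set \<Rightarrow> nat set \<Rightarrow> real"
    proof -
      have "(\<Sum>(i, j, m)\<leftarrow>es. h i j * m) = (\<Sum>e\<in>\<pi> ` M. h (fst e) (snd e) * m e)"
        unfolding es_def ps(1)[symmetric] using ps(2) by (simp add: o_def sum_list_distinct_conv_sum_set)
      also have "\<dots> = (\<Sum>e\<in>\<pi> ` M. \<Sum>p | p \<in> M \<and> \<pi> p = e. 24 / 25 * h (cl (fst p)) (cl (snd p)))"
      proof (rule sum.cong[OF refl])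
        fix e
        have "(\<Sum>p | p \<in> M \<and> \<pi> p = e. 24 / 25 * h (cl (fst p)) (cl (snd p)))
            = (\<Sum>p | p \<in> M \<and> \<pi> p = e. 24 / 25 * h (fst e) (snd e))"
          by (intro sum.cong) (auto simp: \<pi>_def)
        then show "h (fst e) (snd e) * m e = (\<Sum>p | p \<in> M \<and> \<pi> p = e. 24 / 25 * h (cl (fst p)) (cl (snd p)))"
          by (simp add: m_def)
      qed
      also have "\<dots> = (\<Sum>p\<in>M. 24 / 25 * h (cl (fst p)) (cl (snd p)))" by (rule sum.image_gen[OF finM, symmetric])
      finally show ?thesis by (simp add: sum_distrib_left)
    qed
    \<comment> \<open>The first and second ends that lie in \<open>v\<close> are distinct vertices
      of \<open>v\<close>, so the loads planned for \<open>v\<close> stay below 24/25 of its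
      size.\<close>
    have load_es: "(\<Sum>(i, j, m)\<leftarrow>es. (if v = i then m else 0) + (if v = j then m else 0)) \<le> 24 / 25 * card v"
      if "v \<in> P" for v
    proof -
      have "(\<Sum>(i, j, m)\<leftarrow>es. (if v = i then m else 0) + (if v = j then m else 0))
          = (\<Sum>(i, j, m)\<leftarrow>es. ((if v = i then 1 else 0) + (if v = j then 1 else 0)) * m)"
        by (intro arg_cong[of _ _ sum_list] map_cong) auto
      also have "\<dots> = 24 / 25 * (\<Sum>p\<in>M. (if v = cl (fst p) then 1 else 0) + (if v = cl (snd p) then 1 else 0))"
        by (rule sum_es)
      also have "(\<Sum>p\<in>M. (if v = cl (fst p) then 1 else 0) + (if v = cl (snd p) then 1 else 0))
          = real (card {p \<in> M. v = cl (fst p)} + card {p \<in> M. v = cl (snd p)})"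
      proof -
        have "(\<Sum>p\<in>M. if v = g p then 1 else 0) = real (card {p \<in> M. v = g p})" for g :: "nat \<times> nat \<Rightarrow> nat set"
          using sum.inter_filter[OF finM, of "\<lambda>_. 1 :: real" "\<lambda>p. v = g p"] by simp
        then show ?thesis by (simp add: sum.distrib)
      qed
      also have "card {p \<in> M. v = cl (fst p)} + card {p \<in> M. v = cl (snd p)} =
          card (fst ` {p \<in> M. v = cl (fst p)}) + card (snd ` {p \<in> M. v = cl (snd p)})"
        using fst_snd by (simp add: card_image inj_on_subset)
      also have "\<dots> = card (fst ` {p \<in> M. v = cl (fst p)} \<union> snd ` {p \<in> M. v = cl (snd p)})"
        using finM fst_snd(3) by (intro card_Un_disjoint[symmetric]) auto
      also have "real \<dots> \<le> card v"
        using finP[OF that] cov(2) in_cov by (intro of_nat_mono card_mono) auto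
      finally show ?thesis by simp
    qed
    define Q where "Q = cl ` cover M"
    have QP: "Q \<subseteq> P" using cov(1) by (auto simp: Q_def)
    \<comment> \<open>Reachability needs no more steps than there are links, which bounds the
      detours independently of \<open>t\<close>.\<close>
    have path: "\<exists>n\<le>K * K. (link ^^ n) x y" if xy: "x \<in> Q" "y \<in> Q" for x y
    proof -
      let ?L = "{(A, B). link A B}"
      have sub: "?L \<subseteq> P \<times> P" by (auto simp: link_def)
      then have finL: "finite ?L" using P(1) finite_subset by blast
      have "card ?L \<le> card (P \<times> P)" using P(1) sub by (intro card_mono) auto
      also have "\<dots> \<le> K * K" using P(2) by (simp add: card_cartesian_product mult_mono)
      finally have cL: "card ?L \<le> K * K" .
      have "link\<^sup>*\<^sup>* x y" using con xy unfolding link_def[abs_def] Q_def by auto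
      then have "(x, y) \<in> ?L\<^sup>*" by (simp only: Enum.rtranclp_rtrancl_eq)
      then obtain n where "n \<le> card ?L" "(x, y) \<in> ?L ^^ n"
        unfolding rtrancl_finite_eq_relpow[OF finL] by blast
      have "(\<lambda>x y. (x, y) \<in> ?L) = link" by simp
      then have "(link ^^ n) x y" using relpowp_relpow_eq[of n ?L] \<open>(x, y) \<in> ?L ^^ n\<close> by (simp only:)
      then show ?thesis using cL \<open>n \<le> card ?L\<close> le_trans by blast
    qed
    define w where "w s = real (card (antidiag t s))" for s
    define T where "T = 2 * t - 1"
    have w1: "\<bar>w (Suc s) - w s\<bar> \<le> 1" "0 \<le> w s" "w s \<le> real t" for s
      unfolding w_def card_antidiag by (auto simp: min_def)
    have w2: "0 < w s" if "s < T" for s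
      using that unfolding w_def card_antidiag T_def by (auto simp: min_def)
    have "card M > 0" using cM N400 by (cases "card M") auto
    then have "M \<noteq> {}" by auto
    then obtain a where a: "a \<in> Q" using in_cov by (fastforce simp: Q_def)
    \<comment> \<open>The capacity is at least 24/25 * 27 * (N/50 - 1), whose leading term is
      648/625 t^2; the load to be placed is t^2.\<close>
    have total: "(\<Sum>s\<in>{0..<T}. w s) \<le> (\<Sum>(i, j, m)\<leftarrow>es. 2 * m)"
    proof -
      have "(\<Sum>(i, j, m)\<leftarrow>es. 2 * m) = 24 / 25 * real (2 * card M)" using sum_es[of "\<lambda>_ _. 2"] by simp
      moreover have "(\<Sum>s\<in>{0..<T}. w s) = real t * real t"
        using sum_card_antidiag[of t] unfolding w_def T_def by (metis of_nat_mult of_nat_sum)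
      moreover have "real t * real t \<le> 24 / 25 * real (2 * card M)"
      proof -
        have "27 * (real N / 50 - 1) \<le> real (2 * card M)"
        proof -
          have "real N / 50 - 1 \<le> real (N div 50)" by linarith
          moreover have "27 * real (N div 50) \<le> real (2 * card M)"
            using of_nat_mono[OF cM, where 'a = real] by simp
          ultimately show ?thesis by (simp add: algebra_simps)
        qed
        then have 1: "24 / 25 * (27 * (real N / 50 - 1)) \<le> 24 / 25 * real (2 * card M)" by simp
        have 2: "201 * real t \<le> real t * real t" using t200 by (intro mult_right_mono) auto
        have "24 / 25 * (27 * (real N / 50 - 1)) = 648 / 625 * (real t * real t) - 648 / 625 * real t - 648 / 25"
          unfolding rN by (simp add: field_simps)
        moreover have "201 \<le> real t" using t200 by simp
        ultimately have "real t * real t \<le> 24 / 25 * (27 * (real N / 50 - 1))"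
          using 2 by linarith
        then show ?thesis using 1 by linarith
      qed
      ultimately show ?thesis by linarith
    qed
    have "\<exists>\<phi>. \<phi> 0 = a \<and> (\<forall>s. 0 \<le> s \<longrightarrow> Suc s < T \<longrightarrow> link (\<phi> s) (\<phi> (Suc s))) \<and>
      (\<forall>v. load w \<phi> 0 T v \<le> (\<Sum>(i, j, m)\<leftarrow>es. (if v = i then m else 0) + (if v = j then m else 0))
        + length es * ((K * K + 4) * t))"
    proof -
      have "\<exists>\<phi>. \<phi> 0 = a \<and> (\<forall>s. 0 \<le> s \<longrightarrow> Suc s < T \<longrightarrow> link (\<phi> s) (\<phi> (Suc s))) \<and>
      (\<forall>v. load w \<phi> 0 T v \<le> (\<Sum>(i, j, m)\<leftarrow>es. (if v = i then m else 0) + (if v = j then m else 0))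
        + length es * (real (K * K + 4) * real t))"
      proof (rule walk_through_edges[where w = w and Q = Q and t = "real t" and ?s0.0 = 0 and a = a and R = link, OF w1 w2 _ path])
        show "i \<in> Q \<and> j \<in> Q \<and> link i j \<and> link j i \<and> 0 \<le> m'" if "(i, j, m') \<in> set es" for i j m'
        proof -
          have "(i, j) \<in> \<pi> ` M" "m' = m (i, j)" using that unfolding es_def ps(1)[symmetric] by auto
          then obtain p where p: "p \<in> M" "i = cl (fst p)" "j = cl (snd p)" "0 \<le> m'" by (auto simp: \<pi>_def m_def)
          have "dense_pair (1 / 10000) c k i j" "dense_pair (1 / 10000) c k j i"
            using M p(1) unfolding p(2,3) matching_def by fastforce+
          then show ?thesis using p in_cov[OF p(1)] cov(1) by (auto simp: Q_def link_def)
        qed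
        show "real T \<le> 2 * real t" by (simp add: T_def)
      qed (use a total in auto)
      then show ?thesis by simp
    qed
    then obtain \<phi> where \<phi>: "\<phi> 0 = a" "\<And>s. Suc s < T \<Longrightarrow> link (\<phi> s) (\<phi> (Suc s))"
      "\<And>v. load w \<phi> 0 T v \<le> (\<Sum>(i, j, m)\<leftarrow>es. (if v = i then m else 0) + (if v = j then m else 0))
        + length es * ((K * K + 4) * t)" by auto
    have \<phi>P: "\<phi> s \<in> P" if "s < T" for s
      using that \<phi>(1) a QP \<phi>(2)[of "s - 1"] by (cases s) (auto simp: link_def)
    \<comment> \<open>Past the last antidiagonal the walk need not stay in \<open>P\<close>; the
      empty set keeps all layers finite.\<close>
    define S where "S s = (if s < T then \<phi> s else {})" for s
    have SP: "s < T \<Longrightarrow> S s \<in> P" for s using \<phi>P by (simp add: S_def)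
    have big: "C * t \<le> 1 / 50 * card (S s)" if "s < T" for s
      using P(5)[OF SP[OF that]] Ct by simp
    obtain f where f: "inj_on (\<lambda>(s, i). f s i) (SIGMA s:{..<T}. antidiag t s)"
        "\<And>s i. s < T \<Longrightarrow> i \<in> antidiag t s \<Longrightarrow> f s i \<in> S s"
        "\<And>s i j. Suc s < T \<Longrightarrow> i \<in> antidiag t s \<Longrightarrow> j \<in> antidiag t (Suc s) \<Longrightarrow> j = i \<or> j = Suc i \<Longrightarrow>
          f (Suc s) j \<in> {b. c {f s i, b} = k}"
    proof (rule strip_embedding[of S "antidiag t" t T "1 / 10000" "1 / 50" "\<lambda>a. {b. c {a, b} = k}"])
      show "finite (S s)" for s using finP SP by (cases "s < T") (auto simp: S_def)
      show "card (antidiag t s) \<le> t" for s by (simp add: card_antidiag)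
      show "S s \<noteq> {}" if "s < T" for s
      proof -
        have "0 < \<beta> * N" using \<beta> N400 by simp
        then show ?thesis using P(5)[OF SP[OF that]] by auto
      qed
      show "card {a \<in> S s. 4 * card ({b. c {a, b} = k} \<inter> B) < card B} < 1 / 10000 * real (card (S s))"
        if "Suc s < T" "B \<subseteq> S (Suc s)" "1 / 10000 * real (card (S (Suc s))) \<le> card B" for s B
        using \<phi>(2)[OF that(1)] that by (auto simp: link_def dense_pair_def S_def)
      \<comment> \<open>The budget of a cluster: 48/50 planned load, 1/50 for the errors of the walk
        and 1/50 kept free.\<close>
      show "1 / 50 * real (card (S s)) + real (\<Sum>s'\<in>{s'. s' < s \<and> S s' \<inter> S s \<noteq> {}}. card (antidiag t s')) \<le> card (S s)"
        if s: "s < T" for s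
      proof -
        have "{s'. s' < s \<and> S s' \<inter> S s \<noteq> {}} \<subseteq> {s'. 0 \<le> s' \<and> s' < T \<and> \<phi> s' = \<phi> s}"
          using s disjointD[OF P(3) \<phi>P \<phi>P] by (auto simp: S_def)
        then have "(\<Sum>s'\<in>{s'. s' < s \<and> S s' \<inter> S s \<noteq> {}}. w s') \<le> load w \<phi> 0 T (\<phi> s)"
          unfolding load_def by (intro sum_mono2) (auto simp: w1)
        also have "\<dots> \<le> 24 / 25 * card (\<phi> s) + real (length es * ((K * K + 4) * t))"
          using \<phi>(3)[of "\<phi> s"] load_es[OF \<phi>P[OF s]] by linarith
        also have "real (length es * ((K * K + 4) * t)) \<le> real ((K * K) * ((K * K + 4) * t))"
          using len by (intro of_nat_mono mult_right_mono) auto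
        also have "\<dots> \<le> C * t" by (simp add: C_def algebra_simps)
        also have "C * t \<le> 1 / 50 * card (\<phi> s)" using big[OF s] s by (simp add: S_def)
        finally show ?thesis using s by (simp add: w_def S_def)
      qed
      show "16 * (2 * (1 / 10000 * real (card (S s))) + 2 * real t) \<le> 1 / 50 * real (card (S s))" if "s < T" for s
      proof -
        have "2000 * real t \<le> C * t" by (intro mult_right_mono) (auto simp: C_def)
        then show ?thesis using big[OF that] by simp
      qed
      show "finite (antidiag t s)" for s by (rule finite_antidiag)
    qed (simp, simp, rule that)
    \<comment> \<open>The point \<open>(x, y)\<close> is entry \<open>x\<close> of antidiagonal
      \<open>x + y\<close>. A step in \<open>y\<close> keeps the entry and a step in
      \<open>x\<close> raises it by one: these are the two adjacencies of a strip.\<close>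
    define F where "F = (\<lambda>(x, y). f (x + y) x)"
    have ad: "x \<in> antidiag t (x + y)" "x + y < T" if "x < t" "y < t" for x y
      using that by (auto simp: antidiag_def T_def)
    have "inj_on F ({..<t} \<times> {..<t})"
    proof (rule inj_onI)
      fix u v assume uv: "u \<in> {..<t} \<times> {..<t}" "v \<in> {..<t} \<times> {..<t}" "F u = F v"
      have "(\<lambda>(s, i). f s i) (fst u + snd u, fst u) = (\<lambda>(s, i). f s i) (fst v + snd v, fst v)"
        using uv(3) by (simp add: F_def split_def)
      then have "(fst u + snd u, fst u) = (fst v + snd v, fst v)"
        by (rule inj_onD[OF f(1)]) (use uv ad in auto)
      then show "u = v" by (simp add: prod_eq_iff)
    qed
    moreover have "F ` ({..<t} \<times> {..<t}) \<subseteq> {..<2 * t * (t - 1)}"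
    proof
      fix z assume "z \<in> F ` ({..<t} \<times> {..<t})"
      then obtain x y where xy: "x < t" "y < t" "z = f (x + y) x" by (auto simp: F_def)
      then have "z \<in> S (x + y)" using f(2) ad by simp
      then show "z \<in> {..<2 * t * (t - 1)}" using P(4)[OF SP[OF ad(2)[OF xy(1,2)]]] by (auto simp: N_def)
    qed
    moreover have "c {F (x, y), F (Suc x, y)} = k" if "Suc x < t" "y < t" for x y
      using f(3)[of "x + y" x "Suc x"] ad[of x y] ad[of "Suc x" y] that by (simp add: F_def)
    moreover have "c {F (x, y), F (x, Suc y)} = k" if "x < t" "Suc y < t" for x y
      using f(3)[of "x + y" x x] ad[of x y] ad[of x "Suc y"] that by (simp add: F_def)
    ultimately show "\<exists>F k. inj_on F ({..<t} \<times> {..<t}) \<and>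
      F ` ({..<t} \<times> {..<t}) \<subseteq> {..<2 * t * (t - 1)} \<and>
      (\<forall>x y. Suc x < t \<longrightarrow> y < t \<longrightarrow> c {F (x, y), F (Suc x, y)} = k) \<and>
      (\<forall>x y. x < t \<longrightarrow> Suc y < t \<longrightarrow> c {F (x, y), F (x, Suc y)} = k)" by blast
  qed
qed

section \<open>Ramsey chains and graph images\<close>

text \<open>Relabelling is used to place copies in complete graphs, and also to move the grids to
  natural numbers for the final family.\<close>

definition graph_image :: "('a \<Rightarrow> 'b) \<Rightarrow> 'a graph \<Rightarrow> 'b graph" where
  "graph_image h G = Graph (h ` verts G) ((`) h ` edges G)"

lemma graph_image_simps [simp]:
  "verts (graph_image h G) = h ` verts G" "edges (graph_image h G) = (`) h ` edges G"
  by (simp_all add: graph_image_def)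

lemma simple_graph_edge_subset: "simple_graph G \<Longrightarrow> e \<in> edges G \<Longrightarrow> e \<subseteq> verts G"
  by (auto simp: simple_graph_def nsets_def)

lemma graph_iso_trans:
  assumes "graph_iso G H" "graph_iso H J"
  shows "graph_iso G J"
proof -
  obtain f g where f: "bij_betw f (verts G) (verts H)"
    "\<And>u v. u \<in> verts G \<Longrightarrow> v \<in> verts G \<Longrightarrow> {u, v} \<in> edges G \<longleftrightarrow> {f u, f v} \<in> edges H"
    and g: "bij_betw g (verts H) (verts J)"
    "\<And>u v. u \<in> verts H \<Longrightarrow> v \<in> verts H \<Longrightarrow> {u, v} \<in> edges H \<longleftrightarrow> {g u, g v} \<in> edges J"
    using assms by (auto simp: graph_iso_def)
  have "f u \<in> verts H" if "u \<in> verts G" for u using f(1) that by (auto simp: bij_betw_def)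
  then show ?thesis
    unfolding graph_iso_def using bij_betw_trans[OF f(1) g(1)] f(2) g(2)
    by (intro exI[of _ "g \<circ> f"]) simp
qed

lemma graph_iso_sym:
  assumes "graph_iso G H"
  shows "graph_iso H G"
proof -
  obtain f where f: "bij_betw f (verts G) (verts H)"
    "\<And>u v. u \<in> verts G \<Longrightarrow> v \<in> verts G \<Longrightarrow> {u, v} \<in> edges G \<longleftrightarrow> {f u, f v} \<in> edges H"
    using assms by (auto simp: graph_iso_def)
  let ?g = "inv_into (verts G) f"
  have "?g u \<in> verts G" "f (?g u) = u" if "u \<in> verts H" for u
    using f(1) that by (auto simp: bij_betw_def inv_into_into f_inv_into_f)
  then show ?thesis
    unfolding graph_iso_def using bij_betw_inv_into[OF f(1)] f(2)
    by (intro exI[of _ ?g]) simp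
qed

lemma graph_iso_card_verts: "graph_iso G H \<Longrightarrow> card (verts G) = card (verts H)"
  by (auto simp: graph_iso_def bij_betw_same_card)

lemma graph_iso_image:
  assumes "inj_on h (verts G)" "\<And>e. e \<in> edges G \<Longrightarrow> e \<subseteq> verts G"
  shows "graph_iso G (graph_image h G)"
proof -
  have "{u, v} \<in> edges G \<longleftrightarrow> {h u, h v} \<in> (`) h ` edges G" if uv: "u \<in> verts G" "v \<in> verts G" for u v
  proof
    assume "{h u, h v} \<in> (`) h ` edges G"
    then obtain e where e: "e \<in> edges G" "h ` e = h ` {u, v}" by auto
    then have "e = {u, v}" using inj_on_image_eq_iff[OF assms(1) assms(2)[OF e(1)], of "{u, v}"] uv by auto
    then show "{u, v} \<in> edges G" using e by simp
  qed (auto intro: rev_image_eqI)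
  then show ?thesis
    unfolding graph_iso_def using assms(1) by (intro exI[of _ h]) (auto simp: bij_betw_def)
qed

lemma simple_graph_image:
  assumes "simple_graph G" "inj_on h (verts G)"
  shows "simple_graph (graph_image h G)"
proof -
  have "h ` e \<in> [h ` verts G]\<^bsup>2\<^esup>" if "e \<in> edges G" for e
    using assms that card_image[of h e] inj_on_subset[of h "verts G" e]
    by (auto simp: simple_graph_def nsets_def)
  then show ?thesis using assms by (auto simp: simple_graph_def)
qed

lemma subgraph_complete_imageI:
  assumes "simple_graph G" "inj_on h (verts G)" "h ` verts G \<subseteq> {..<n}"
  shows "subgraph (graph_image h G) (complete_graph n)"
  using simple_graph_image[OF assms(1,2)] assms(3) nsets_mono[OF assms(3), of 2]
  by (auto simp: subgraph_def complete_graph_def simple_graph_def)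

section \<open>Chains: the counting bound and existence\<close>

lemma ramsey_chain_order:
  assumes "ramsey_chain n c G H"
  shows "card (edges G) < n \<or> card (edges G) = 0"
proof (rule disjCI)
  define m where "m = card (edges G)"
  assume "card (edges G) \<noteq> 0"
  then have m: "0 < m" by (simp add: m_def)
  have H: "\<And>i. i \<in> {1..m} \<Longrightarrow> edges (H i) \<subseteq> [{..<n}]\<^bsup>2\<^esup>" "\<And>i. i \<in> {1..m} \<Longrightarrow> card (edges (H i)) = i"
    "\<And>i j. i \<in> {1..m} \<Longrightarrow> j \<in> {1..m} \<Longrightarrow> i \<noteq> j \<Longrightarrow> edges (H i) \<inter> edges (H j) = {}"
    using assms by (auto simp: ramsey_chain_def Let_def m_def subgraph_def complete_graph_def)
  have fin: "finite ([{..<n}]\<^bsup>2\<^esup>)" by (simp add: finite_imp_finite_nsets)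
  have "(\<Sum>i\<in>{1..m}. i) = (\<Sum>i\<in>{1..m}. card (edges (H i)))" using H(2) by simp
  also have "\<dots> = card (\<Union>i\<in>{1..m}. edges (H i))"
    using H finite_subset[OF H(1) fin] by (intro card_UN_disjoint[symmetric]) auto
  also have "\<dots> \<le> card ([{..<n}]\<^bsup>2\<^esup>)" by (intro card_mono fin UN_least H(1))
  also have "\<dots> = n * (n - 1) div 2" by (simp add: card_nsets choose_two)
  finally have "m * (m + 1) div 2 \<le> n * (n - 1) div 2" by (simp add: Sum_Icc_nat)
  \<comment> \<open>Both products are even, so the truncating division loses nothing.\<close>
  moreover have "even (m * (m + 1))" "even (n * (n - 1))" by auto
  ultimately have le: "m * (m + 1) \<le> n * (n - 1)" by (metis dvd_mult_div_cancel mult_le_mono2)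
  show "card (edges G) < n"
  proof (rule ccontr)
    assume "\<not> ?thesis"
    then have "n \<le> m" by (simp add: m_def)
    then have "n * (n - 1) \<le> m * (m - 1)" by (intro mult_mono) auto
    also have "\<dots> < m * (m + 1)" using m by (intro mult_strict_left_mono) auto
    finally show False using le by simp
  qed
qed

text \<open>Ramsey's theorem inside an arbitrary vertex set of sufficient size, so that it can be
  applied to disjoint blocks of one complete graph.\<close>

lemma ramsey_mono_set:
  obtains r :: nat where "\<And>(c :: nat set \<Rightarrow> colour) V. finite V \<Longrightarrow> r \<le> card V \<Longrightarrow>
    \<exists>W k. W \<subseteq> V \<and> card W = v \<and> (\<forall>x\<in>W. \<forall>y\<in>W. x \<noteq> y \<longrightarrow> c {x, y} = k)"
proof -
  obtain r :: nat where r: "\<And>(V :: nat set) (E :: nat set set). finite V \<Longrightarrow> r \<le> card V \<Longrightarrow>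
    \<exists>R\<subseteq>V. card R = v \<and> clique R E \<or> card R = v \<and> indep R E"
    using ramsey2[of v v] by metis
  show ?thesis
  proof (rule that)
    fix c :: "nat set \<Rightarrow> colour" and V :: "nat set" assume V: "finite V" "r \<le> card V"
    obtain R where "R \<subseteq> V" "card R = v" "clique R {e. c e = Red} \<or> indep R {e. c e = Red}"
      using r[OF V, of "{e. c e = Red}"] by blast
    moreover have "c d = Blue" if "c d \<noteq> Red" for d using that by (cases "c d") auto
    ultimately have "(\<forall>x\<in>R. \<forall>y\<in>R. x \<noteq> y \<longrightarrow> c {x, y} = Red) \<or> (\<forall>x\<in>R. \<forall>y\<in>R. x \<noteq> y \<longrightarrow> c {x, y} = Blue)"
      unfolding clique_def indep_def mem_Collect_eq by metis
    then show "\<exists>W k. W \<subseteq> V \<and> card W = v \<and> (\<forall>x\<in>W. \<forall>y\<in>W. x \<noteq> y \<longrightarrow> c {x, y} = k)"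
      using \<open>R \<subseteq> V\<close> \<open>card R = v\<close> by blast
  qed
qed

text \<open>Shows that \<open>target_ramsey_number\<close> is a genuine minimum. Take one block of
  \<open>r\<close> vertices for each edge of \<open>G\<close>. Every block contains a monochromatic
  clique of the order of \<open>G\<close>, and successive cliques receive longer and longer initial
  segments of the edge list; disjoint blocks make these copies edge-disjoint.\<close>

lemma ex_ramsey_chain:
  fixes G :: "'a graph"
  assumes G: "simple_graph G"
  shows "\<exists>n. \<forall>c. \<exists>H. ramsey_chain n c G H"
proof -
  define m where "m = card (edges G)"
  define v where "v = card (verts G)"
  have finV: "finite (verts G)" and ne: "verts G \<noteq> {}" and E: "edges G \<subseteq> [verts G]\<^bsup>2\<^esup>"
    using G by (auto simp: simple_graph_def)
  have finE: "finite (edges G)" using finite_subset[OF E finite_imp_finite_nsets[OF finV]] .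
  obtain e where e: "bij_betw e {..<m} (edges G)"
    using ex_bij_betw_nat_finite[OF finE] by (auto simp: m_def atLeast0LessThan)
  obtain r where r: "\<And>(c :: nat set \<Rightarrow> colour) V. finite V \<Longrightarrow> r \<le> card V \<Longrightarrow>
    \<exists>W k. W \<subseteq> V \<and> card W = v \<and> (\<forall>x\<in>W. \<forall>y\<in>W. x \<noteq> y \<longrightarrow> c {x, y} = k)"
    by (rule ramsey_mono_set) blast
  have "\<exists>H. ramsey_chain (m * r) c G H" for c
  proof -
    have "\<exists>h k. inj_on h (verts G) \<and> h ` verts G \<subseteq> {i * r..<Suc i * r} \<and>
        (\<forall>x\<in>verts G. \<forall>y\<in>verts G. x \<noteq> y \<longrightarrow> c {h x, h y} = k)" for i
    proof -
      obtain W k where W: "W \<subseteq> {i * r..<Suc i * r}" "card W = v" "\<forall>x\<in>W. \<forall>y\<in>W. x \<noteq> y \<longrightarrow> c {x, y} = k"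
        using r[of "{i * r..<Suc i * r}" c] by auto
      have "finite W" using W(1) finite_subset by blast
      then obtain h where h: "bij_betw h (verts G) W"
        using finite_same_card_bij[OF finV, of W] W(2) by (auto simp: v_def)
      then have "\<forall>x\<in>verts G. \<forall>y\<in>verts G. x \<noteq> y \<longrightarrow> c {h x, h y} = k"
        using W(3) unfolding bij_betw_def inj_on_def by blast
      then show ?thesis using h W(1) by (auto simp: bij_betw_def)
    qed
    then obtain h k where h: "\<And>i. inj_on (h i) (verts G)" "\<And>i. h i ` verts G \<subseteq> {i * r..<Suc i * r}"
      "\<And>i x y. x \<in> verts G \<Longrightarrow> y \<in> verts G \<Longrightarrow> x \<noteq> y \<Longrightarrow> c {h i x, h i y} = k i" by metis
    \<comment> \<open>All members keep the full vertex set of \<open>G\<close>, so that they are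
      nested and the last one is \<open>G\<close> itself.\<close>
    define F where "F i = Graph (verts G) (e ` {..<i})" for i
    \<comment> \<open>Blocks are numbered from 0 and members from 1, whence the shift.\<close>
    define H where "H i = graph_image (h (i - 1)) (F i)" for i
    have eE: "e j \<in> edges G" if "j < m" for j using e that by (auto simp: bij_betw_def)
    have sF: "simple_graph (F i)" if "i \<le> m" for i
    proof -
      have "e ` {..<i} \<subseteq> edges G" using eE that by auto
      then show ?thesis using finV ne E by (auto simp: simple_graph_def F_def)
    qed
    have iF: "graph_iso (F i) (graph_image (h j) (F i))" if "i \<le> m" for i j
      using graph_iso_image[of "h j" "F i"] h(1) simple_graph_edge_subset[OF sF[OF that]] by (simp add: F_def)
    have block: "{(i - 1) * r..<Suc (i - 1) * r} \<subseteq> {..<m * r}" if "i \<in> {1..m}" for i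
      using that mult_le_mono1[of i m r] by (auto intro: less_le_trans)
    have sub: "subgraph (H i) (complete_graph (m * r))" if i: "i \<in> {1..m}" for i
      unfolding H_def
    proof (rule subgraph_complete_imageI)
      show "simple_graph (F i)" using sF i by simp
      show "inj_on (h (i - 1)) (verts (F i))" using h(1) by (simp add: F_def)
      show "h (i - 1) ` verts (F i) \<subseteq> {..<m * r}"
        using subset_trans[OF h(2) block[OF i]] by (simp only: F_def graph.sel)
    qed
    have mono: "mono_coloured c (H i)" if i: "i \<in> {1..m}" for i
    proof -
      have "c (h (i - 1) ` e j) = k (i - 1)" if "j < i" for j
      proof -
        have "e j \<in> [verts G]\<^bsup>2\<^esup>" using eE[of j] E that i by auto
        then obtain x y where "e j = {x, y}" "x \<in> verts G" "y \<in> verts G" "x \<noteq> y" by (elim nsets2_E)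
        then show ?thesis using h(3)[of x y "i - 1"] by simp
      qed
      then show ?thesis by (auto simp: mono_coloured_def H_def F_def)
    qed
    have inj_e: "inj_on e {..<m}" using e by (simp add: bij_betw_def)
    have card: "card (edges (H i)) = i" if i: "i \<in> {1..m}" for i
    proof -
      have "e ` {..<i} \<subseteq> Pow (verts G)"
      proof
        fix d assume "d \<in> e ` {..<i}"
        then have "d \<in> edges G" using eE i by auto
        then show "d \<in> Pow (verts G)" using simple_graph_edge_subset[OF G] by simp
      qed
      then have "inj_on ((`) (h (i - 1))) (e ` {..<i})"
        by (rule inj_on_subset[OF inj_on_image_Pow[OF h(1)]])
      moreover have "inj_on e {..<i}" using inj_e i by (auto intro: inj_on_subset)
      ultimately show ?thesis by (simp add: H_def F_def card_image)
    qed
    have in_block: "d \<noteq> {} \<and> d \<subseteq> {(i - 1) * r..<Suc (i - 1) * r}" if d: "i \<in> {1..m}" "d \<in> edges (H i)" for i d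
    proof -
      obtain j where j: "j < i" "d = h (i - 1) ` e j" using d(2) by (auto simp: H_def F_def)
      then have "e j \<in> [verts G]\<^bsup>2\<^esup>" using eE[of j] E d(1) by auto
      then have "e j \<subseteq> verts G" "e j \<noteq> {}" by (auto simp: nsets_def)
      then show ?thesis using j(2) h(2)[of "i - 1"] by blast
    qed
    have disj: "edges (H i) \<inter> edges (H j) = {}" if ij: "i \<in> {1..m}" "j \<in> {1..m}" "i \<noteq> j" for i j
    proof (rule ccontr)
      assume "edges (H i) \<inter> edges (H j) \<noteq> {}"
      then obtain d where d: "d \<in> edges (H i)" "d \<in> edges (H j)" by blast
      then obtain x where "x \<in> {(i - 1) * r..<Suc (i - 1) * r}" "x \<in> {(j - 1) * r..<Suc (j - 1) * r}"
        using in_block[OF ij(1)] in_block[OF ij(2)] by blast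
      then have "x div r = i - 1" "x div r = j - 1"
        by (auto intro!: div_nat_eqI simp: mult.commute)
      then show False using ij by auto
    qed
    have chain: "\<exists>J. subgraph J (H (Suc i)) \<and> graph_iso (H i) J" if i: "i \<in> {1..<m}" for i
    proof (intro exI conjI)
      let ?J = "graph_image (h i) (F i)"
      show "subgraph ?J (H (Suc i))"
        using simple_graph_image[OF sF, of i "h i"] h(1) i
        by (auto simp: subgraph_def H_def F_def)
      show "graph_iso (H i) ?J"
        unfolding H_def using iF[of i "i - 1"] iF[of i i] i
        by (auto intro: graph_iso_trans graph_iso_sym)
    qed
    have "F m = G" using e by (cases G) (auto simp: F_def bij_betw_def)
    then have "graph_iso (H m) G" using iF[of m "m - 1"] by (simp add: H_def graph_iso_sym)
    then have "ramsey_chain (m * r) c G H"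
      unfolding ramsey_chain_def Let_def m_def[symmetric] using sub mono card disj chain by blast
    then show ?thesis by (intro exI)
  qed
  then show ?thesis by blast
qed

text \<open>The lower bound needs no special colouring: a chain has too many edges for
  \<open>card (edges G)\<close> vertices in any colouring, here the all-red one. Hypothesis
  \<open>R\<close> says that so many vertices suffice for the ordinary Ramsey number.\<close>

theorem target_ramsey_number_greater:
  assumes "simple_graph G" "0 < card (edges G)"
    and R: "\<And>c. \<exists>H. subgraph H (complete_graph (card (edges G))) \<and> mono_coloured c H \<and> graph_iso H G"
  shows "ramsey_number G < target_ramsey_number G"
proof -
  have "\<exists>H. ramsey_chain (target_ramsey_number G) (\<lambda>_. Red) G H"
    unfolding target_ramsey_number_def using LeastI_ex[OF ex_ramsey_chain[OF assms(1)]] by blast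
  then have "card (edges G) < target_ramsey_number G" using ramsey_chain_order assms(2) by fastforce
  moreover have "ramsey_number G \<le> card (edges G)"
    unfolding ramsey_number_def by (rule Least_le) (use R in blast)
  ultimately show ?thesis by simp
qed

section \<open>The grid graph and its properties\<close>

definition hor :: "nat \<times> nat \<Rightarrow> (nat \<times> nat) set" where
  "hor = (\<lambda>(x, y). {(x, y), (Suc x, y)})"

definition ver :: "nat \<times> nat \<Rightarrow> (nat \<times> nat) set" where
  "ver = (\<lambda>(x, y). {(x, y), (x, Suc y)})"

lemma verts_grid: "verts (grid_graph t) = {..<t} \<times> {..<t}"
  by (simp add: grid_graph_def cartesian_product_def path_graph_def)

lemma edges_grid: "edges (grid_graph t) = hor ` ({..<t - 1} \<times> {..<t}) \<union> ver ` ({..<t} \<times> {..<t - 1})"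
proof -
  have path: "{v, v'} \<in> {{i, Suc i} | i. Suc i < t} \<longleftrightarrow> (\<exists>i. Suc i < t \<and> (v = i \<and> v' = Suc i \<or> v = Suc i \<and> v' = i))" for v v'
    by (auto simp: doubleton_eq_iff)
  have "{{(u, v), (u, v')} | u v v'. u \<in> {..<t} \<and> {v, v'} \<in> {{i, Suc i} | i. Suc i < t}} = ver ` ({..<t} \<times> {..<t - 1})"
    (is "?A = ?B")
  proof
    show "?A \<subseteq> ?B"
    proof
      fix d assume "d \<in> ?A"
      then obtain u i where "u < t" "Suc i < t" "d = ver (u, i)"
        unfolding path by (auto simp: ver_def insert_commute)
      then show "d \<in> ?B" by auto
    qed
    show "?B \<subseteq> ?A"
    proof
      fix d assume "d \<in> ?B"
      then obtain x y where "x < t" "Suc y < t" "d = ver (x, y)" by (auto simp: less_diff_conv)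
      then have "x < t" "Suc y < t" "d = {(x, y), (x, Suc y)}" by (simp_all add: ver_def)
      moreover from this have "{y, Suc y} \<in> {{i, Suc i} | i. Suc i < t}" by blast
      ultimately show "d \<in> ?A" by blast
    qed
  qed
  moreover have "{{(u, v), (u', v)} | u u' v. {u, u'} \<in> {{i, Suc i} | i. Suc i < t} \<and> v \<in> {..<t}} = hor ` ({..<t - 1} \<times> {..<t})"
    (is "?A = ?B")
  proof
    show "?A \<subseteq> ?B"
    proof
      fix d assume "d \<in> ?A"
      then obtain i v where "v < t" "Suc i < t" "d = hor (i, v)"
        unfolding path by (auto simp: hor_def insert_commute)
      then show "d \<in> ?B" by auto
    qed
    show "?B \<subseteq> ?A"
    proof
      fix d assume "d \<in> ?B"
      then obtain x y where "Suc x < t" "y < t" "d = hor (x, y)" by (auto simp: less_diff_conv)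
      then have "Suc x < t" "y < t" "d = {(x, y), (Suc x, y)}" by (simp_all add: hor_def)
      moreover from this have "{x, Suc x} \<in> {{i, Suc i} | i. Suc i < t}" by blast
      ultimately show "d \<in> ?A" by blast
    qed
  qed
  ultimately show ?thesis by (simp add: grid_graph_def cartesian_product_def path_graph_def Un_commute)
qed

lemma edges_gridE:
  assumes "d \<in> edges (grid_graph t)"
  obtains x y where "Suc x < t" "y < t" "d = {(x, y), (Suc x, y)}"
    | x y where "x < t" "Suc y < t" "d = {(x, y), (x, Suc y)}"
proof -
  from assms consider (h) x y where "Suc x < t" "y < t" "d = hor (x, y)"
    | (v) x y where "x < t" "Suc y < t" "d = ver (x, y)"
    unfolding edges_grid by (fastforce simp: less_diff_conv)
  then show ?thesis
  proof cases
    case h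
    then show ?thesis by (intro that(1)[of x y]) (simp_all add: hor_def)
  next
    case v
    then show ?thesis by (intro that(2)[of x y]) (simp_all add: ver_def)
  qed
qed

lemma hor_in_grid: "Suc x < t \<Longrightarrow> y < t \<Longrightarrow> {(x, y), (Suc x, y)} \<in> edges (grid_graph t)"
  by (auto simp: edges_grid hor_def intro!: rev_image_eqI[of "(x, y)"])

lemma ver_in_grid: "x < t \<Longrightarrow> Suc y < t \<Longrightarrow> {(x, y), (x, Suc y)} \<in> edges (grid_graph t)"
  by (auto simp: edges_grid ver_def intro!: rev_image_eqI[of "(x, y)"])

lemma card_edges_grid: "card (edges (grid_graph t)) = 2 * t * (t - 1)"
proof -
  have "inj hor"
  proof (rule injI)
    fix u v assume that: "hor u = hor v"
    have "u \<in> hor v" "v \<in> hor u" using that by (cases u; cases v; auto simp: hor_def)+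
    then show "u = v" by (cases u; cases v; auto simp: hor_def)
  qed
  then have "inj_on hor A" for A by (rule inj_on_subset) simp
  moreover have "inj ver"
  proof (rule injI)
    fix u v assume that: "ver u = ver v"
    have "u \<in> ver v" "v \<in> ver u" using that by (cases u; cases v; auto simp: ver_def)+
    then show "u = v" by (cases u; cases v; auto simp: ver_def)
  qed
  then have "inj_on ver A" for A by (rule inj_on_subset) simp
  moreover have "hor u \<noteq> ver v" for u v
  proof
    assume "hor u = ver v"
    then have "v \<in> hor u" "(fst v, Suc (snd v)) \<in> hor u" by (auto simp: ver_def split_def)
    then show False by (auto simp: hor_def split_def prod_eq_iff)
  qed
  then have "hor ` A \<inter> ver ` B = {}" for A B by blast
  ultimately show ?thesis unfolding edges_grid
    by (subst card_Un_disjoint) (auto simp: card_image card_cartesian_product)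
qed

lemma simple_grid: "0 < t \<Longrightarrow> simple_graph (grid_graph t)"
  by (auto simp: simple_graph_def verts_grid elim!: edges_gridE)

lemma connected_grid: "connected_graph (grid_graph t)"
proof -
  let ?r = "\<lambda>u v. {u, v} \<in> edges (grid_graph t)"
  have row: "?r\<^sup>*\<^sup>* (0, y) (x, y)" if "x < t" "y < t" for x y
    using that
  proof (induction x)
    case (Suc x)
    then show ?case using hor_in_grid[of x t y] by (auto intro: rtranclp.rtrancl_into_rtrancl)
  qed simp
  have col: "?r\<^sup>*\<^sup>* (0, 0) (0, y)" if "y < t" for y
    using that
  proof (induction y)
    case (Suc y)
    then show ?case using ver_in_grid[of 0 t y] by (auto intro: rtranclp.rtrancl_into_rtrancl)
  qed simp
  have "?r\<^sup>*\<^sup>* (0, 0) u" if "u \<in> {..<t} \<times> {..<t}" for u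
    using that row col by (cases u) (auto intro: rtranclp_trans)
  moreover have "symp ?r" by (auto simp: symp_def insert_commute)
  then have "symp ?r\<^sup>*\<^sup>*" by (rule symp_rtranclp)
  ultimately show ?thesis unfolding connected_graph_def verts_grid
    by (blast intro: rtranclp_trans dest: sympD)
qed

lemma bipartite_grid: "bipartite_graph (grid_graph t)"
  unfolding bipartite_graph_def verts_grid
proof (intro exI conjI ballI)
  let ?A = "{u \<in> {..<t} \<times> {..<t}. even (fst u + snd u)}" and ?B = "{u \<in> {..<t} \<times> {..<t}. odd (fst u + snd u)}"
  show "?A \<union> ?B = {..<t} \<times> {..<t}" "?A \<inter> ?B = {}" by auto
  fix d assume "d \<in> edges (grid_graph t)"
  then obtain u v where "d = {u, v}" "u \<in> {..<t} \<times> {..<t}" "v \<in> {..<t} \<times> {..<t}"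
      "even (fst u + snd u) \<noteq> even (fst v + snd v)"
    by (elim edges_gridE) (force+)
  then show "\<exists>a\<in>?A. \<exists>b\<in>?B. d = {a, b}"
  proof (cases "even (fst u + snd u)")
    case True
    then show ?thesis using \<open>d = {u, v}\<close> \<open>u \<in> _\<close> \<open>v \<in> _\<close> \<open>even (fst u + snd u) \<noteq> _\<close>
      by (intro bexI[of _ u] bexI[of _ v]) auto
  next
    case False
    then show ?thesis using \<open>d = {u, v}\<close> \<open>u \<in> _\<close> \<open>v \<in> _\<close> \<open>even (fst u + snd u) \<noteq> _\<close>
      by (intro bexI[of _ v] bexI[of _ u]) auto
  qed
qed

text \<open>\<open>3 \<le> t\<close> provides the inner vertex \<open>(1, 1)\<close>, which has all
  four neighbours.\<close>

lemma max_degree_grid: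
  assumes "3 \<le> t"
  shows "max_degree (grid_graph t) = 4"
proof -
  have fin: "finite (edges (grid_graph t))" by (simp add: edges_grid)
  have le: "degree (grid_graph t) (x, y) \<le> 4" for x y
  proof -
    have "{d \<in> edges (grid_graph t). (x, y) \<in> d} \<subseteq>
        set [{(x, y), (Suc x, y)}, {(x - 1, y), (x, y)}, {(x, y), (x, Suc y)}, {(x, y - 1), (x, y)}]"
    proof
      fix d assume "d \<in> {d \<in> edges (grid_graph t). (x, y) \<in> d}"
      then have d: "d \<in> edges (grid_graph t)" "(x, y) \<in> d" by auto
      from d(1) show "d \<in> set [{(x, y), (Suc x, y)}, {(x - 1, y), (x, y)}, {(x, y), (x, Suc y)}, {(x, y - 1), (x, y)}]"
      proof (cases rule: edges_gridE)
        case (1 a b)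
        then have "x = a \<and> y = b \<or> x = Suc a \<and> y = b" using d(2) by auto
        then show ?thesis unfolding 1(3) by (elim disjE) simp_all
      next
        case (2 a b)
        then have "x = a \<and> y = b \<or> x = a \<and> y = Suc b" using d(2) by auto
        then show ?thesis unfolding 2(3) by (elim disjE) simp_all
      qed
    qed
    then show ?thesis unfolding degree_def
      by (rule le_trans[OF card_mono[OF finite_set] le_trans[OF card_length]]) simp
  qed
  let ?D = "{{(1, 1), (2, 1)}, {(0, 1), (1, 1)}, {(1, 1), (1, 2)}, {(1, 0), (1, 1)}} :: (nat \<times> nat) set set"
  have cD: "card ?D = 4" by (simp add: doubleton_eq_iff)
  have sub: "?D \<subseteq> {d \<in> edges (grid_graph t). (1, 1) \<in> d}"
    using hor_in_grid[of 1 t 1] hor_in_grid[of 0 t 1] ver_in_grid[of 1 t 1] ver_in_grid[of 1 t 0] assms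
    by (simp add: numeral_2_eq_2)
  have "4 \<le> degree (grid_graph t) (1, 1)"
    unfolding degree_def cD[symmetric] by (rule card_mono[OF _ sub]) (simp add: fin)
  then have "degree (grid_graph t) (1, 1) = 4" using le[of 1 1] by simp
  then show ?thesis unfolding max_degree_def
    by (intro Max_eqI) (use le assms in \<open>auto simp: verts_grid intro!: rev_image_eqI[of "(1, 1)"]\<close>)
qed

text \<open>Drawing by unit segments between lattice points. A relative interior point of an edge
  has exactly one nonintegral coordinate. Which one it is tells the direction of the edge, and its
  integer part together with the other coordinate determines the edge; so such a point is no vertex
  and lies on no other edge.\<close>

lemma planar_grid: "planar_graph (grid_graph t)"
proof -
  define p :: "nat \<times> nat \<Rightarrow> complex" where "p u = Complex (fst u) (snd u)" for u
  have inj_p: "inj p" by (auto simp: inj_def p_def prod_eq_iff)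
  define segm where "segm d z \<longleftrightarrow> (\<exists>x y. d = hor (x, y) \<and> Im z = real y \<and> real x \<le> Re z \<and> Re z \<le> real x + 1) \<or>
       (\<exists>x y. d = ver (x, y) \<and> Re z = real x \<and> real y \<le> Im z \<and> Im z \<le> real y + 1)" for d z
  have "\<exists>\<gamma>. arc \<gamma> \<and> {pathstart \<gamma>, pathfinish \<gamma>} = p ` d \<and>
     (\<forall>z\<in>path_image \<gamma>. segm d z)"
    if d: "d \<in> edges (grid_graph t)" for d
    using d
  proof (cases rule: edges_gridE)
    case (1 x y)
    have d1: "d = hor (x, y)" by (simp add: 1(3) hor_def)
    have ne: "p (x, y) \<noteq> p (Suc x, y)" using inj_p by (auto dest: injD)
    have cl: "Im z = real y \<and> real x \<le> Re z \<and> Re z \<le> real x + 1" if "z \<in> closed_segment (p (x, y)) (p (Suc x, y))" for z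
    proof -
      obtain u where "0 \<le> u" "u \<le> 1" "z = (1 - u) *\<^sub>R p (x, y) + u *\<^sub>R p (Suc x, y)"
        using \<open>z \<in> _\<close> by (auto simp: in_segment)
      then have "Re z = (1 - u) * Re (p (x, y)) + u * Re (p (Suc x, y))" "Im z = (1 - u) * Im (p (x, y)) + u * Im (p (Suc x, y))"
        by simp_all
      then show ?thesis using \<open>0 \<le> u\<close> \<open>u \<le> 1\<close> by (simp add: p_def algebra_simps)
    qed
    have "\<forall>z\<in>path_image (linepath (p (x, y)) (p (Suc x, y))). segm d z"
      unfolding path_image_linepath segm_def by (intro ballI disjI1 exI) (rule conjI[OF d1 cl])
    moreover have "arc (linepath (p (x, y)) (p (Suc x, y)))" using ne by (rule arc_linepath)
    moreover have "{pathstart (linepath (p (x, y)) (p (Suc x, y))), pathfinish (linepath (p (x, y)) (p (Suc x, y)))} = p ` d"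
      using 1(3) by simp
    ultimately show ?thesis by blast
  next
    case (2 x y)
    have d2: "d = ver (x, y)" by (simp add: 2(3) ver_def)
    have ne: "p (x, y) \<noteq> p (x, Suc y)" using inj_p by (auto dest: injD)
    have cl: "Re z = real x \<and> real y \<le> Im z \<and> Im z \<le> real y + 1" if "z \<in> closed_segment (p (x, y)) (p (x, Suc y))" for z
    proof -
      obtain u where "0 \<le> u" "u \<le> 1" "z = (1 - u) *\<^sub>R p (x, y) + u *\<^sub>R p (x, Suc y)"
        using \<open>z \<in> _\<close> by (auto simp: in_segment)
      then have "Re z = (1 - u) * Re (p (x, y)) + u * Re (p (x, Suc y))" "Im z = (1 - u) * Im (p (x, y)) + u * Im (p (x, Suc y))"
        by simp_all
      then show ?thesis using \<open>0 \<le> u\<close> \<open>u \<le> 1\<close> by (simp add: p_def algebra_simps)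
    qed
    have "\<forall>z\<in>path_image (linepath (p (x, y)) (p (x, Suc y))). segm d z"
      unfolding path_image_linepath segm_def by (intro ballI disjI2 exI) (rule conjI[OF d2 cl])
    moreover have "arc (linepath (p (x, y)) (p (x, Suc y)))" using ne by (rule arc_linepath)
    moreover have "{pathstart (linepath (p (x, y)) (p (x, Suc y))), pathfinish (linepath (p (x, y)) (p (x, Suc y)))} = p ` d"
      using 2(3) by simp
    ultimately show ?thesis by blast
  qed
  then obtain \<gamma> where arc: "\<And>d. d \<in> edges (grid_graph t) \<Longrightarrow> arc (\<gamma> d)"
    and ends: "\<And>d. d \<in> edges (grid_graph t) \<Longrightarrow> {pathstart (\<gamma> d), pathfinish (\<gamma> d)} = p ` d"
    and seg: "\<And>d z. d \<in> edges (grid_graph t) \<Longrightarrow> z \<in> path_image (\<gamma> d) \<Longrightarrow> segm d z" by metis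
  \<comment> \<open>Removing the two ends makes the inequalities strict.\<close>
  have inner: "(\<exists>x y. d = hor (x, y) \<and> Im z = y \<and> x < Re z \<and> Re z < real x + 1) \<or>
       (\<exists>x y. d = ver (x, y) \<and> Re z = x \<and> y < Im z \<and> Im z < real y + 1)"
    if d: "d \<in> edges (grid_graph t)" "z \<in> path_image (\<gamma> d) - p ` d" for d z
  proof -
    have ne: "\<not> (Re z = fst u \<and> Im z = snd u)" if "u \<in> d" for u
      using d(2) that by (auto simp: p_def complex_eq_iff)
    have "z \<in> path_image (\<gamma> d)" using d(2) by simp
    from seg[OF d(1) this, unfolded segm_def] show ?thesis
    proof (elim disjE exE conjE)
      fix x y assume z: "d = hor (x, y)" "Im z = real y" "real x \<le> Re z" "Re z \<le> real x + 1"
      have "(x, y) \<in> d" "(Suc x, y) \<in> d" by (simp_all add: z(1) hor_def)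
      then have "Re z \<noteq> x" "Re z \<noteq> x + 1" using ne[of "(x, y)"] ne[of "(Suc x, y)"] z(2) by simp_all
      then have "real x < Re z \<and> Re z < real x + 1" using z(3,4) by linarith
      then show ?thesis using z(1,2) by blast
    next
      fix x y assume z: "d = ver (x, y)" "Re z = real x" "real y \<le> Im z" "Im z \<le> real y + 1"
      have "(x, y) \<in> d" "(x, Suc y) \<in> d" by (simp_all add: z(1) ver_def)
      then have "Im z \<noteq> y" "Im z \<noteq> y + 1" using ne[of "(x, y)"] ne[of "(x, Suc y)"] z(2) by simp_all
      then have "real y < Im z \<and> Im z < real y + 1" using z(3,4) by linarith
      then show ?thesis using z(1,2) by blast
    qed
  qed
  have no_nat: False if "real x < r" "r < real x + 1" "r = real n" for x n r
  proof -
    have "real x < real n" "real n < real (Suc x)" using that by simp_all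
    then show False unfolding of_nat_less_iff by simp
  qed
  have innerE: thesis
    if d: "d \<in> edges (grid_graph t)" "z \<in> path_image (\<gamma> d) - p ` d"
      and "\<And>x y. d = hor (x, y) \<Longrightarrow> Im z = real y \<Longrightarrow> real x < Re z \<Longrightarrow> Re z < real x + 1 \<Longrightarrow> thesis"
      and "\<And>x y. d = ver (x, y) \<Longrightarrow> Re z = real x \<Longrightarrow> real y < Im z \<Longrightarrow> Im z < real y + 1 \<Longrightarrow> thesis"
    for d z thesis
    using inner[OF d] that(3,4) by (elim disjE exE conjE)
  have segE: thesis
    if d: "d \<in> edges (grid_graph t)" "z \<in> path_image (\<gamma> d)"
      and "\<And>x y. d = hor (x, y) \<Longrightarrow> Im z = real y \<Longrightarrow> real x \<le> Re z \<Longrightarrow> Re z \<le> real x + 1 \<Longrightarrow> thesis"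
      and "\<And>x y. d = ver (x, y) \<Longrightarrow> Re z = real x \<Longrightarrow> real y \<le> Im z \<Longrightarrow> Im z \<le> real y + 1 \<Longrightarrow> thesis"
    for d z thesis
    using seg[OF d, unfolded segm_def] that(3,4) by (elim disjE exE conjE)
  have vertex_free: "z \<notin> range p" if d: "d \<in> edges (grid_graph t)" "z \<in> path_image (\<gamma> d) - p ` d" for d z
  proof
    assume "z \<in> range p"
    then obtain u where u: "Re z = real (fst u)" "Im z = real (snd u)" by (auto simp: p_def)
    show False by (rule innerE[OF d]) (use u no_nat in blast)+
  qed
  have same: "m = n" if "real m \<le> r" "r \<le> real m + 1" "real n < r" "r < real n + 1" for m n r
  proof -
    have "real m < real (Suc n)" "real n < real (Suc m)" using that by simp_all
    then show ?thesis unfolding of_nat_less_iff by simp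
  qed
  have "path_image (\<gamma> d) \<inter> path_image (\<gamma> d') \<subseteq> p ` d" if d: "d \<in> edges (grid_graph t)" "d' \<in> edges (grid_graph t)" "d' \<noteq> d" for d d'
  proof (rule ccontr)
    assume "\<not> ?thesis"
    then obtain z where z: "z \<in> path_image (\<gamma> d) - p ` d" "z \<in> path_image (\<gamma> d')" by blast
    show False
    proof (rule innerE[OF d(1) z(1)]; rule segE[OF d(2) z(2)])
      fix x y x' y'
      assume *: "d = hor (x, y)" "Im z = real y" "real x < Re z" "Re z < real x + 1"
        "d' = hor (x', y')" "Im z = real y'" "real x' \<le> Re z" "Re z \<le> real x' + 1"
      have "x' = x" using same[OF *(7,8,3,4)] .
      moreover have "y' = y" using *(2,6) by simp
      ultimately have "d' = d" by (simp only: *(1,5))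
      then show False using d(3) by simp
    next
      fix x y x' y'
      assume *: "d = ver (x, y)" "Re z = real x" "real y < Im z" "Im z < real y + 1"
        "d' = ver (x', y')" "Re z = real x'" "real y' \<le> Im z" "Im z \<le> real y' + 1"
      have "y' = y" using same[OF *(7,8,3,4)] .
      moreover have "x' = x" using *(2,6) by simp
      ultimately have "d' = d" by (simp only: *(1,5))
      then show False using d(3) by simp
    qed (use no_nat in blast)+
  qed
  note disj = this
  have "plane_drawing (grid_graph t) p \<gamma>"
    unfolding plane_drawing_def
  proof (intro conjI ballI impI)
    show "inj_on p (verts (grid_graph t))" using inj_p by (rule inj_on_subset) simp
    fix d assume d: "d \<in> edges (grid_graph t)"
    show "arc (\<gamma> d)" "{pathstart (\<gamma> d), pathfinish (\<gamma> d)} = p ` d" using arc[OF d] ends[OF d] .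
    show "(path_image (\<gamma> d) - p ` d) \<inter> p ` verts (grid_graph t) = {}" using vertex_free[OF d] by blast
    fix d' assume "d' \<in> edges (grid_graph t)" "d' \<noteq> d"
    then show "(path_image (\<gamma> d) - p ` d) \<inter> path_image (\<gamma> d') = {}" using disj[OF d] by blast
  qed
  then show ?thesis unfolding planar_graph_def by blast
qed

section \<open>Invariance under injective relabelling\<close>

lemma connected_graph_image:
  assumes "connected_graph G"
  shows "connected_graph (graph_image h G)"
proof -
  have "(\<lambda>x y. {x, y} \<in> edges (graph_image h G))\<^sup>*\<^sup>* (h u) (h v)"
    if "(\<lambda>x y. {x, y} \<in> edges G)\<^sup>*\<^sup>* u v" for u v
    using that
  proof induction
    case (step v w)
    have "{h v, h w} \<in> edges (graph_image h G)" using imageI[OF step(2), of "(`) h"] by simp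
    then show ?case by (rule rtranclp.rtrancl_into_rtrancl[OF step(3)])
  qed simp
  then show ?thesis using assms by (auto simp: connected_graph_def)
qed

lemma bipartite_graph_image:
  assumes "bipartite_graph G" "inj h"
  shows "bipartite_graph (graph_image h G)"
proof -
  obtain A B where AB: "A \<union> B = verts G" "A \<inter> B = {}" "\<And>e. e \<in> edges G \<Longrightarrow> \<exists>a\<in>A. \<exists>b\<in>B. e = {a, b}"
    using assms(1) by (auto simp: bipartite_graph_def)
  have split: "\<exists>a\<in>h ` A. \<exists>b\<in>h ` B. d = {a, b}" if d: "d \<in> edges (graph_image h G)" for d
  proof -
    obtain e where e: "e \<in> edges G" "d = h ` e" using d by auto
    obtain a b where ab: "a \<in> A" "b \<in> B" "e = {a, b}" using AB(3)[OF e(1)] by (elim bexE)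
    have "d = {h a, h b}" by (simp add: e(2) ab(3))
    then show ?thesis using imageI[OF ab(1), of h] imageI[OF ab(2), of h] by (intro bexI)
  qed
  have un: "h ` A \<union> h ` B = verts (graph_image h G)" using AB(1) by (simp flip: image_Un)
  have int: "h ` A \<inter> h ` B = {}" using AB(2) by (simp flip: image_Int[OF assms(2)])
  show ?thesis unfolding bipartite_graph_def
    by (rule exI[of _ "h ` A"], rule exI[of _ "h ` B"], intro conjI ballI un int split)
qed

text \<open>Points and arcs are kept; only their names are pulled back along
  \<open>inv h\<close>.\<close>

lemma planar_graph_image:
  assumes "planar_graph G" "inj h"
  shows "planar_graph (graph_image h G)"
proof -
  obtain p \<gamma> where p: "plane_drawing G p \<gamma>" using assms(1) by (auto simp: planar_graph_def)
  have inv: "inv h ` h ` A = A" for A using assms(2) by (simp add: image_image)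
  have comp: "(p \<circ> inv h) ` h ` A = p ` A" for A by (simp only: image_comp[symmetric] inv)
  note p = p[unfolded plane_drawing_def, THEN conjunct1] p[unfolded plane_drawing_def, THEN conjunct2]
  have inj_p: "inj_on p (verts G)" using p(1) .
  have drawn: "arc (\<gamma> e) \<and> {pathstart (\<gamma> e), pathfinish (\<gamma> e)} = p ` e \<and>
        (path_image (\<gamma> e) - p ` e) \<inter> p ` verts G = {}" if "e \<in> edges G" for e
    using bspec[OF p(2) that] by (simp only:)
  have disj: "(path_image (\<gamma> e) - p ` e) \<inter> path_image (\<gamma> e') = {}"
    if "e \<in> edges G" "e' \<in> edges G" "e' \<noteq> e" for e e'
    using bspec[OF p(2) that(1)] that(2,3) by (simp only: simp_thms)
  have "plane_drawing (graph_image h G) (p \<circ> inv h) (\<lambda>d. \<gamma> (inv h ` d))"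
    unfolding plane_drawing_def graph_image_simps
  proof (intro conjI ballI impI)
    show "inj_on (p \<circ> inv h) (h ` verts G)"
      using inj_p by (intro comp_inj_on inj_on_inv_into) (simp_all add: inv image_mono)
    fix d assume "d \<in> (`) h ` edges G"
    then obtain e where e: "e \<in> edges G" "d = h ` e" by blast
    show "arc (\<gamma> (inv h ` d))"
      "{pathstart (\<gamma> (inv h ` d)), pathfinish (\<gamma> (inv h ` d))} = (p \<circ> inv h) ` d"
      "(path_image (\<gamma> (inv h ` d)) - (p \<circ> inv h) ` d) \<inter> (p \<circ> inv h) ` h ` verts G = {}"
      using drawn[OF e(1)] unfolding e(2) comp inv by simp_all
    fix d' assume "d' \<in> (`) h ` edges G" "d' \<noteq> d"
    then obtain e' where "e' \<in> edges G" "d' = h ` e'" "e' \<noteq> e" using e(2) by blast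
    then show "(path_image (\<gamma> (inv h ` d)) - (p \<circ> inv h) ` d) \<inter> path_image (\<gamma> (inv h ` d')) = {}"
      using disj[OF e(1)] unfolding e(2) by (simp only: comp inv)
  qed
  then show ?thesis unfolding planar_graph_def by blast
qed

lemma max_degree_image:
  assumes "inj h"
  shows "max_degree (graph_image h G) = max_degree G"
proof -
  have "degree (graph_image h G) (h v) = degree G v" for v
  proof -
    have "{d \<in> edges (graph_image h G). h v \<in> d} = (`) h ` {e \<in> edges G. v \<in> e}"
    proof (intro equalityI subsetI)
      fix d assume "d \<in> {d \<in> edges (graph_image h G). h v \<in> d}"
      then obtain e where "e \<in> edges G" "d = h ` e" "h v \<in> h ` e" by auto
      then show "d \<in> (`) h ` {e \<in> edges G. v \<in> e}" using inj_image_mem_iff[OF assms, of v e] by simp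
    qed auto
    moreover have "inj ((`) h)" using assms by (simp add: inj_image_eq_iff inj_def)
    ultimately show ?thesis unfolding degree_def by (simp add: card_image inj_on_subset)
  qed
  then show ?thesis unfolding max_degree_def by (simp add: image_image)
qed

lemma card_edges_image: "inj h \<Longrightarrow> card (edges (graph_image h G)) = card (edges G)"
  by (auto intro!: card_image simp: inj_on_def inj_image_eq_iff)

text \<open>Stated for every injective relabelling, because the inequality is needed both for the
  grid on pairs and for its copy on natural numbers.\<close>

lemma grid_target_ramsey:
  obtains t0 where "\<And>t h. t0 \<le> t \<Longrightarrow> inj h \<Longrightarrow>
    ramsey_number (graph_image h (grid_graph t)) < target_ramsey_number (graph_image h (grid_graph t))"
proof -
  obtain t0 where t0: "\<And>t (c :: nat set \<Rightarrow> colour). t0 \<le> t \<Longrightarrow> \<exists>F k. inj_on F ({..<t} \<times> {..<t}) \<and>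
    F ` ({..<t} \<times> {..<t}) \<subseteq> {..<2 * t * (t - 1)} \<and>
    (\<forall>x y. Suc x < t \<longrightarrow> y < t \<longrightarrow> c {F (x, y), F (Suc x, y)} = k) \<and>
    (\<forall>x y. x < t \<longrightarrow> Suc y < t \<longrightarrow> c {F (x, y), F (x, Suc y)} = k)"
    by (rule mono_grid) blast
  show ?thesis
  \<comment> \<open>From 2 on the grid has an edge.\<close>
  proof (rule that[of "max t0 2"])
    fix t and h :: "nat \<times> nat \<Rightarrow> 'b" assume t: "max t0 2 \<le> t" and h: "inj h"
    let ?G = "grid_graph t"
    have sG: "simple_graph ?G" using t by (intro simple_grid) simp
    have injh: "inj_on h (verts ?G)" using h by (rule inj_on_subset) simp
    have cE: "card (edges (graph_image h ?G)) = 2 * t * (t - 1)"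
      by (simp only: card_edges_image[OF h] card_edges_grid)
    show "ramsey_number (graph_image h ?G) < target_ramsey_number (graph_image h ?G)"
    proof (rule target_ramsey_number_greater)
      show "simple_graph (graph_image h ?G)" using sG injh by (rule simple_graph_image)
      show "0 < card (edges (graph_image h ?G))" unfolding cE using t by simp
      fix c :: "nat set \<Rightarrow> colour"
      obtain F k where F: "inj_on F ({..<t} \<times> {..<t})" "F ` ({..<t} \<times> {..<t}) \<subseteq> {..<2 * t * (t - 1)}"
        "\<And>x y. Suc x < t \<Longrightarrow> y < t \<Longrightarrow> c {F (x, y), F (Suc x, y)} = k"
        "\<And>x y. x < t \<Longrightarrow> Suc y < t \<Longrightarrow> c {F (x, y), F (x, Suc y)} = k"
        using t0[of t c] t by auto
      have F': "inj_on F (verts ?G)" "F ` verts ?G \<subseteq> {..<2 * t * (t - 1)}"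
        using F(1,2) by (simp_all only: verts_grid)
      have "subgraph (graph_image F ?G) (complete_graph (card (edges (graph_image h ?G))))"
        unfolding cE by (rule subgraph_complete_imageI[OF sG F'])
      moreover have "mono_coloured c (graph_image F ?G)"
        unfolding mono_coloured_def using F(3,4) by (auto elim!: edges_gridE)
      moreover have "graph_iso (graph_image F ?G) (graph_image h ?G)"
        using graph_iso_image[OF F'(1)] graph_iso_image[OF injh] simple_graph_edge_subset[OF sG]
        by (meson graph_iso_sym graph_iso_trans)
      ultimately show "\<exists>H. subgraph H (complete_graph (card (edges (graph_image h ?G)))) \<and>
        mono_coloured c H \<and> graph_iso H (graph_image h ?G)" by blast
    qed
  qed
qed

theorem theorem3:
  shows "(\<forall>\<^sub>F t in sequentially.
            target_ramsey_number (grid_graph t) > ramsey_number (grid_graph t)) \<and>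
         (\<exists>\<G> :: nat graph set. infinite \<G> \<and>
            pairwise (\<lambda>G H. \<not> graph_iso G H) \<G> \<and>
            (\<forall>G\<in>\<G>. simple_graph G \<and> connected_graph G \<and> planar_graph G \<and>
                   bipartite_graph G \<and> max_degree G = 4 \<and>
                   target_ramsey_number G > ramsey_number G))"
proof
  obtain t0 where t0: "\<And>t (h :: nat \<times> nat \<Rightarrow> nat \<times> nat). t0 \<le> t \<Longrightarrow> inj h \<Longrightarrow>
    ramsey_number (graph_image h (grid_graph t)) < target_ramsey_number (graph_image h (grid_graph t))"
    by (rule grid_target_ramsey) blast
  have "graph_image id G = G" for G :: "(nat \<times> nat) graph" by (cases G) (simp add: graph_image_def)
  then show "\<forall>\<^sub>F t in sequentially. ramsey_number (grid_graph t) < target_ramsey_number (grid_graph t)"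
    using t0[of _ id] by (auto simp: eventually_sequentially)
next
  obtain t0 where t0: "\<And>t (h :: nat \<times> nat \<Rightarrow> nat). t0 \<le> t \<Longrightarrow> inj h \<Longrightarrow>
    ramsey_number (graph_image h (grid_graph t)) < target_ramsey_number (graph_image h (grid_graph t))"
    by (rule grid_target_ramsey) blast
  \<comment> \<open>The family consists of graphs on natural numbers, so the pairs are coded; the
    number of vertices, t^2, tells different members apart.\<close>
  define g where "g t = graph_image prod_encode (grid_graph t)" for t
  have inj: "inj prod_encode" by (rule inj_prod_encode)
  have card_g: "card (verts (g t)) = t * t" for t
    by (simp add: g_def verts_grid card_image[OF inj_prod_encode] card_cartesian_product)
  have distinct: "s = t" if "graph_iso (g s) (g t)" for s t
    using graph_iso_card_verts[OF that] by (simp add: card_g power2_eq_square[symmetric])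
  show "\<exists>\<G> :: nat graph set. infinite \<G> \<and>
            pairwise (\<lambda>G H. \<not> graph_iso G H) \<G> \<and>
            (\<forall>G\<in>\<G>. simple_graph G \<and> connected_graph G \<and> planar_graph G \<and>
                   bipartite_graph G \<and> max_degree G = 4 \<and>
                   target_ramsey_number G > ramsey_number G)"
  proof (intro exI conjI ballI)
    \<comment> \<open>From 3 on the maximum degree is four.\<close>
    let ?\<G> = "g ` {max t0 3..}"
    have "inj g"
    proof (rule injI)
      fix s t assume "g s = g t"
      then have "card (verts (g s)) = card (verts (g t))" by simp
      then show "s = t" by (simp add: card_g power2_eq_square[symmetric])
    qed
    then show "infinite ?\<G>" by (simp add: finite_image_iff inj_on_subset infinite_Ici)
    show "pairwise (\<lambda>G H. \<not> graph_iso G H) ?\<G>"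
      using distinct by (auto simp: pairwise_def)
    fix G assume "G \<in> ?\<G>"
    then obtain t where t: "max t0 3 \<le> t" "G = g t" by auto
    show "simple_graph G" unfolding t(2) g_def
      using t(1) by (intro simple_graph_image simple_grid inj_on_subset[OF inj]) auto
    show "connected_graph G" unfolding t(2) g_def by (intro connected_graph_image connected_grid)
    show "planar_graph G" unfolding t(2) g_def by (intro planar_graph_image planar_grid inj)
    show "bipartite_graph G" unfolding t(2) g_def by (intro bipartite_graph_image bipartite_grid inj)
    show "max_degree G = 4" unfolding t(2) g_def using t(1) by (simp add: max_degree_image[OF inj] max_degree_grid)
    show "ramsey_number G < target_ramsey_number G" unfolding t(2) g_def using t0[OF _ inj] t(1) by simp
  qed
qed

end
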